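(* Let $x,y,z$ be non-negative integers and let $\mathbf a=(a_1,\dots,a_m)$, $\mathbf b=(b_1,\dots,b_n)$ be two sequences of non-negative integers. Put $\mu=2\lfloor\frac{m+1}{2}\rfloor$, $\mu'=2\lceil\frac{m-1}{2}\rceil$, $\nu=2\lfloor\frac{n+1}{2}\rfloor$, $\nu'=2\lceil\frac{n-1}{2}\rceil$, and $$\mathbf t^{+}=(a_1,\dots,a_{\mu'},\,a_{\mu'+1}+x+y+b_{\nu},\,b_{\nu-1},\dots,b_1),\qquad \mathbf t^{-}=(0,a_1,\dots,a_{\mu-1},\,a_{\mu}+x+y+b_{\nu'+1},\,b_{\nu'},\dots,b_1,z).$$ Then $$M(NR^{(2)}_{x,y,z}(\mathbf a;\mathbf b))=\frac{M(NR^{(2)}_{x+y,0,z}(\mathbf a;\mathbf b))\,M(NR^{(2)}_{0,y,z}(\mathbf a;\mathbf b))}{M(NR^{(2)}_{y,0,z}(\mathbf a;\mathbf b))}\cdot\frac{T(x+1,2a+b+2y+z-1,y)\,T(x+a+1,b+2y+z-1,y)}{T(1,2a+b+2y+z-1,y)\,T(a+1,b+2y+z-1,y)}$$ $$=2^{a_1-y}\,K(\mathbf t^{+})\,Q'(\mathbf t^{-})\cdot\frac{H_2(2e_a+2o_b)\,H_2(2o_a+2e_b+2z+1)}{H_2(2e_a+2o_b+2y)\,H_2(2o_a+2e_b+2y+2z+1)}\cdot\frac{H(2a+b+2y+z)\,H(b+y+z)}{H(2a+b+y+z)\,H(b+z)}$$ $$\cdot\frac{T(x+1,2a+b+2y+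z-1,y)\,T(x+a+1,b+2y+z-1,y)}{T(1,2a+b+2y+z-1,y)\,T(a+1,b+2y+z-1,y)}.$$
   Context: Lattice and tilings. For real $u,k$ let $[u;k]$ be the point of the plane with Cartesian coordinates $(u,\frac{\sqrt3}{2}k)$. The triangular lattice has as vertices all $[u;k]$ with $k\in\mathbb Z$, $u-k/2\in\mathbb Z$; its faces are unit equilateral triangles, up-pointing or down-pointing. A region is a finite union of unit triangles. A lozenge is the union of two unit triangles sharing an edge; it is vertical if that edge is horizontal. A tiling of a region is a covering of it by lozenges contained in it, without gaps or overlaps. $M(R)$ is the sum of the weights of all tilings of $R$, the weight of a tiling being the product of the weights of its lozenges; lozenges have weight $1$ unless stated otherwise; $M(\emptyset)=1$. Sequences. $a=\sum a_i$, $b=\sum b_j$; $o_a,e_a$ are the sums of the $a_i$ with $i$ odd, resp. even; $o_b,e_b$ likewise. $a_i=0$ for $i>m$, $b_j=0$ for $j>n$; an empty sequence is treated as the one-term sequence $(0)$. Functions. $H(n)=\prod_{i=0}^{n-1}i!$; $H_2(n)=\prod_{i=1}^{\lfloor n/2\rfloor}(n-2i)!$; for $n\ge0$, $(x)_n=x(x+1)\cdots(x+n-1)$ ($1$ for $n=0$); $T(x,n,m)=\prod_{i=0}^{m-1}(x+i)_{n-2i}$. Empty products are $1$. Quartered hexagons. For a sequence $\mathbf t=(t_1,\dots,t_{2l})$ of non-negative integers let $s_k=t_1+\dots+t_k$, $o_t=\sum_{i\text{ odd}}t_i$, $e_t=\sum_{i\text{ even}}t_i$. $Q'(\mathbf t)$: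 take the region bounded by the base from $[0;0]$ to $[o_t+e_t;0]$, the segment from $[o_t+e_t;0]$ to $[o_t;2e_t]$, the north side from $[o_t;2e_t]$ to $[0;2e_t]$, and the west zigzag through $[0;0],[-\frac12;1],[0;2],[-\frac12;3],\dots,[0;2e_t]$; remove from it, for each $1\le i\le l$, the up-pointing triangle with base from $[s_{2i-1};0]$ to $[s_{2i};0]$; give weight $\frac12$ to each vertical lozenge whose two western (left) sides both lie on the west zigzag. $Q'(\mathbf t)$ is $M$ of this weighted region. $K(\mathbf t)$: if $e_t\ge1$, take the region bounded by the base from $[0;0]$ to $[o_t+e_t;0]$, the segment from $[o_t+e_t;0]$ to $[o_t+\frac12;2e_t-1]$, the north side from there to $[\frac12;2e_t-1]$, and the west zigzag through $[0;0],[\frac12;1],[0;2],[\frac12;3],\dots,[\frac12;2e_t-1]$; remove the same up-pointing triangles. $K(\mathbf t)$ is the number of tilings of the resulting region; if $e_t=0$, $K(\mathbf t)=1$. The region $NR^{(2)}_{x,y,z}(\mathbf a;\mathbf b)$. Let $L=x+y+a+b$, $A=2(y+e_a+o_b)-1$, $B=2(y+z+o_a+e_b)$, and let $\ell$ be the line $k=0$. Upper part (empty if $A=-1$): bounded by $\ell$ between $[0;0]$ and $[L;0]$, the segment from $[L;0]$ to $[L-\frac A2;A]$, the horizontal north side at height $k=A$, and the west zigzag through the points $[\alpha(k);k]$, $0\le k\le A$, with $\alpha(k)=0$ for $k$ even and $\frac12$ for $k$ odd. Lower part: bounded by $\ell$ between $[0;0]$ and $[L;0]$, the segments from $[L;0]$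 to $[L+\frac z2;-z]$ and from there to $[L+z-\frac B2;-B]$, the horizontal south side at $k=-B$, and the west zigzag through $[\beta(k);-k]$, $0\le k\le B$, with $\beta(k)=0$ for $k$ even and $-\frac12$ for $k$ odd. The region is the union of the two parts (lozenges may cross $\ell$) after removing: (i) from the lower part, everything at points $[u;-k]$ with $u<a_1-k/2$ (a down-pointing half triangle of side $2a_1$); (ii) for $2\le i\le m$, the triangle of side $a_i$ having a side on $\ell$ from $[a_1+\dots+a_{i-1};0]$ to $[a_1+\dots+a_i;0]$, up-pointing (above $\ell$) if $i$ is even, down-pointing (below $\ell$) if $i$ is odd; (iii) for $1\le j\le n$, the triangle of side $b_j$ having a side on $\ell$ from $[L-b_1-\dots-b_j;0]$ to $[L-b_1-\dots-b_{j-1};0]$, up-pointing (above $\ell$) if $j$ is odd, down-pointing (below $\ell$) if $j$ is even. Each vertical lozenge whose two western (left) sides both lie on the lower west zigzag has weight $\frac12$; all others have weight $1$. *)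

theory Defs
  imports Complex_Main "HOL-Library.Disjoint_Sets"
begin

section \<open>The triangular lattice, regions and weighted tilings\<close>

text \<open>
  The pair \<open>(i, k)\<close> stands for the lattice vertex \<open>[i + k/2; k]\<close>, so that all integer pairs are
  vertices and every vertex arises once.  Only the vertical coordinate is scaled (by
  \<open>sqrt 3 / 2\<close>) in passing from \<open>[u; k]\<close> to Cartesian coordinates.
\<close>

type_synonym vertex = "int \<times> int"

definition xcoord :: "vertex \<Rightarrow> real" where
  "xcoord v = real_of_int (fst v) + real_of_int (snd v) / 2"

abbreviation height :: "vertex \<Rightarrow> int" where
  "height v \<equiv> snd v"

text \<open>\<open>Up i k\<close> and \<open>Down i k\<close> are the two faces on the horizontal edge from \<open>(i, k)\<close> to
  \<open>(i + 1, k)\<close>, above and below it.\<close>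

datatype face = Up int int | Down int int

fun verts :: "face \<Rightarrow> vertex set" where
  "verts (Up i k) = {(i, k), (i + 1, k), (i, k + 1)}"
| "verts (Down i k) = {(i, k), (i + 1, k), (i + 1, k - 1)}"

text \<open>A region is the set of its faces, and a lozenge is the set of its two faces; two distinct
  faces share an edge iff they have exactly two common vertices.\<close>

type_synonym region = "face set"

definition is_lozenge :: "face set \<Rightarrow> bool" where
  "is_lozenge l \<longleftrightarrow> (\<exists>f g. f \<noteq> g \<and> card (verts f \<inter> verts g) = 2 \<and> l = {f, g})"

definition tilings :: "region \<Rightarrow> face set set set" where
  "tilings R = {P. partition_on R P \<and> (\<forall>l\<in>P. is_lozenge l)}"

definition tiling_sum :: "(face set \<Rightarrow> real) \<Rightarrow> region \<Rightarrow> real" where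
  "tiling_sum w R = (\<Sum>P\<in>tilings R. \<Prod>l\<in>P. w l)"

text \<open>
  The part of the plane between the heights \<open>lo\<close> and \<open>hi\<close>, to the east of the curve \<open>u = w k\<close> and
  to the west of the curve \<open>u = e k\<close>.  The curves are given at integer heights and are straight
  in between, so in each lattice row the area is a trapezoid, and a face lies in it iff its
  three vertices do.
\<close>

definition strip :: "int \<Rightarrow> int \<Rightarrow> (int \<Rightarrow> real) \<Rightarrow> (int \<Rightarrow> real) \<Rightarrow> region" where
  "strip lo hi w e = {f. \<forall>v\<in>verts f. lo \<le> height v \<and> height v \<le> hi \<and>
                        w (height v) \<le> xcoord v \<and> xcoord v \<le> e (height v)}"

text \<open>The triangles with a side from \<open>[p; 0]\<close> to \<open>[q; 0]\<close>.\<close>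

definition up_triangle :: "real \<Rightarrow> real \<Rightarrow> region" where
  "up_triangle p q = {f. \<forall>v\<in>verts f. 0 \<le> height v \<and>
     p + real_of_int (height v) / 2 \<le> xcoord v \<and> xcoord v \<le> q - real_of_int (height v) / 2}"

definition down_triangle :: "real \<Rightarrow> real \<Rightarrow> region" where
  "down_triangle p q = {f. \<forall>v\<in>verts f. height v \<le> 0 \<and>
     p - real_of_int (height v) / 2 \<le> xcoord v \<and> xcoord v \<le> q + real_of_int (height v) / 2}"

text \<open>The two west zigzags; \<open>zig_west\<close> is also used at negative heights.\<close>

definition zig_east :: "int \<Rightarrow> real" where
  "zig_east k = (if even k then 0 else 1 / 2)"

definition zig_west :: "int \<Rightarrow> real" where
  "zig_west k = (if even k then 0 else - (1 / 2))"

text \<open>The unit edges, as sets of end points, of the curve \<open>u = c k\<close> between two heights.\<close>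

definition curve_edges :: "(int \<Rightarrow> real) \<Rightarrow> int \<Rightarrow> int \<Rightarrow> vertex set set" where
  "curve_edges c lo hi = {{v, w} | v w. lo \<le> height v \<and> height w = height v + 1 \<and> height w \<le> hi \<and>
                            xcoord v = c (height v) \<and> xcoord w = c (height w)}"

text \<open>The western sides of the vertical lozenge \<open>{Up i k, Down i k}\<close> are the edges from its
  western vertex \<open>(i, k)\<close> to \<open>(i, k + 1)\<close> and to \<open>(i + 1, k - 1)\<close>.\<close>

definition half_weight :: "vertex set set \<Rightarrow> face set \<Rightarrow> real" where
  "half_weight Z l =
     (if \<exists>i k. l = {Up i k, Down i k} \<and> {(i, k), (i, k + 1)} \<in> Z \<and> {(i, k), (i + 1, k - 1)} \<in> Z
      then 1 / 2 else 1)"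

section \<open>Sequences\<close>

text \<open>Sequences are lists, with entries numbered from 1 and extended by 0.\<close>

definition entry :: "nat list \<Rightarrow> nat \<Rightarrow> nat" where
  "entry xs i = (if 1 \<le> i \<and> i \<le> length xs then xs ! (i - 1) else 0)"

definition psum :: "nat list \<Rightarrow> nat \<Rightarrow> nat" where
  "psum xs k = (\<Sum>i = 1..k. entry xs i)"

definition osum :: "nat list \<Rightarrow> nat" where
  "osum xs = (\<Sum>i | i \<in> {1..length xs} \<and> odd i. entry xs i)"

definition esum :: "nat list \<Rightarrow> nat" where
  "esum xs = (\<Sum>i | i \<in> {1..length xs} \<and> even i. entry xs i)"

text \<open>The empty sequence counts as the sequence \<open>(0)\<close>; this only matters where the length of a
  sequence is used.\<close>

definition seq_length :: "nat list \<Rightarrow> nat" where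
  "seq_length xs = (if xs = [] then 1 else length xs)"

section \<open>Product functions\<close>

definition Hfun :: "nat \<Rightarrow> real" where
  "Hfun n = (\<Prod>i<n. fact i)"

definition Hfun2 :: "nat \<Rightarrow> real" where
  "Hfun2 n = (\<Prod>i = 1..n div 2. fact (n - 2 * i))"

text \<open>The second argument is an integer because it can be \<open>-1\<close> when the product is empty;
  the subscripts \<open>n - 2 i\<close> that actually occur are non-negative.\<close>

definition Tfun :: "real \<Rightarrow> int \<Rightarrow> nat \<Rightarrow> real" where
  "Tfun x n m = (\<Prod>i<m. pochhammer (x + real i) (nat (n - 2 * int i)))"

section \<open>Quartered hexagons\<close>

text \<open>Both are meant for sequences of even length.\<close>

definition quartered_dents :: "nat list \<Rightarrow> region" where
  "quartered_dents t =
     (\<Union>i\<in>{1..length t div 2}. up_triangle (real (psum t (2 * i - 1))) (real (psum t (2 * i))))"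

definition quartered_east :: "nat list \<Rightarrow> int \<Rightarrow> real" where
  "quartered_east t k = real (osum t + esum t) - real_of_int k / 2"

definition Qprime :: "nat list \<Rightarrow> real" where
  "Qprime t = tiling_sum (half_weight (curve_edges zig_west 0 (2 * int (esum t))))
     (strip 0 (2 * int (esum t)) zig_west (quartered_east t) - quartered_dents t)"

definition Kfun :: "nat list \<Rightarrow> nat" where
  "Kfun t = (if esum t \<ge> 1
     then card (tilings (strip 0 (2 * int (esum t) - 1) zig_east (quartered_east t) - quartered_dents t))
     else 1)"

section \<open>The regions with two dent sequences\<close>

definition NR_L :: "nat \<Rightarrow> nat \<Rightarrow> nat list \<Rightarrow> nat list \<Rightarrow> nat" where
  "NR_L x y a b = x + y + sum_list a + sum_list b"

definition NR_A :: "nat \<Rightarrow> nat list \<Rightarrow> nat list \<Rightarrow> int" where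
  "NR_A y a b = 2 * int (y + esum a + osum b) - 1"

definition NR_B :: "nat \<Rightarrow> nat \<Rightarrow> nat list \<Rightarrow> nat list \<Rightarrow> int" where
  "NR_B y z a b = 2 * int (y + z + osum a + esum b)"

definition NR_upper :: "nat \<Rightarrow> nat \<Rightarrow> nat list \<Rightarrow> nat list \<Rightarrow> region" where
  "NR_upper x y a b = strip 0 (NR_A y a b) zig_east (\<lambda>k. real (NR_L x y a b) - real_of_int k / 2)"

text \<open>The east boundary at height \<open>k = -d\<close> is at \<open>L + d/2\<close> for \<open>d \<le> z\<close> and at \<open>L + z - d/2\<close> below.\<close>

definition NR_lower :: "nat \<Rightarrow> nat \<Rightarrow> nat \<Rightarrow> nat list \<Rightarrow> nat list \<Rightarrow> region" where
  "NR_lower x y z a b = strip (- NR_B y z a b) 0 zig_west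
     (\<lambda>k. if - k \<le> int z then real (NR_L x y a b) - real_of_int k / 2
          else real (NR_L x y a b) + real z + real_of_int k / 2)"

text \<open>The half triangle cut off by the line \<open>u = a\<^sub>1 - d/2\<close> at depth \<open>d\<close>.  This is a lattice
  line, so a face is to the west of it iff its three vertices are weakly so.\<close>

definition NR_half_triangle :: "nat list \<Rightarrow> region" where
  "NR_half_triangle a =
     {f. \<forall>v\<in>verts f. xcoord v \<le> real (entry a 1) + real_of_int (height v) / 2}"

definition NR_dents_a :: "nat list \<Rightarrow> region" where
  "NR_dents_a a = (\<Union>i\<in>{2..length a}.
     (if even i then up_triangle else down_triangle) (real (psum a (i - 1))) (real (psum a i)))"

definition NR_dents_b :: "nat \<Rightarrow> nat list \<Rightarrow> region" where
  "NR_dents_b l b = (\<Union>j\<in>{1..length b}.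
     (if odd j then up_triangle else down_triangle)
       (real l - real (psum b j)) (real l - real (psum b (j - 1))))"

definition NR2 :: "nat \<Rightarrow> nat \<Rightarrow> nat \<Rightarrow> nat list \<Rightarrow> nat list \<Rightarrow> region" where
  "NR2 x y z a b =
     (NR_upper x y a b \<union> (NR_lower x y z a b - NR_half_triangle a))
       - NR_dents_a a - NR_dents_b (NR_L x y a b) b"

definition M_NR2 :: "nat \<Rightarrow> nat \<Rightarrow> nat \<Rightarrow> nat list \<Rightarrow> nat list \<Rightarrow> real" where
  "M_NR2 x y z a b =
     tiling_sum (half_weight (curve_edges zig_west (- NR_B y z a b) 0)) (NR2 x y z a b)"

section \<open>The sequences of the two quartered hexagons\<close>

definition mu :: "nat list \<Rightarrow> nat" where
  "mu xs = 2 * nat \<lfloor>(real (seq_length xs) + 1) / 2\<rfloor>"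

definition mu' :: "nat list \<Rightarrow> nat" where
  "mu' xs = 2 * nat \<lceil>(real (seq_length xs) - 1) / 2\<rceil>"

definition t_plus :: "nat \<Rightarrow> nat \<Rightarrow> nat list \<Rightarrow> nat list \<Rightarrow> nat list" where
  "t_plus x y a b =
     map (entry a) [1..<mu' a + 1]
     @ [entry a (mu' a + 1) + x + y + entry b (mu b)]
     @ map (entry b) (rev [1..<mu b])"

definition t_minus :: "nat \<Rightarrow> nat \<Rightarrow> nat \<Rightarrow> nat list \<Rightarrow> nat list \<Rightarrow> nat list" where
  "t_minus x y z a b =
     [0] @ map (entry a) [1..<mu a]
     @ [entry a (mu a) + x + y + entry b (mu' b + 1)]
     @ map (entry b) (rev [1..<mu' b + 1]) @ [z]"

end

theory Submission
  imports Defs "Jordan_Normal_Form.Determinant"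
begin

text \<open>
  The lozenges that cross the line \<open>k = 0\<close> are vertical.  Cutting along the line therefore writes
  the tiling sum as a sum, over the sets \<open>V\<close> of positions of the crossing lozenges, of products of
  the tiling sums of two quartered hexagons with dents at \<open>V\<close>.  By forced lozenges, dents of any
  size may be replaced by rows of unit dents, and the half triangle by unit dents at the cost of
  a factor \<open>2\<close> to the power \<open>- a\<^sub>1\<close>.

  Read row by row, a tiling of a quartered hexagon with unit dents is a pattern of interlacing
  positions.  Vandermonde products in the squares of the positions are determinants, and summing
  them over an interlacing row gives a product of the same kind, because central factorials
  telescope.  Hence both factors are explicit products of differences of squares.  Each
  position on the line outside the free interval is a dent of exactly one of the two parts, so
  the dents enter the sum over \<open>V\<close> only through a weight that does not depend on their
  orientation.  What remains is a discrete Selberg sum with a Racah weight.  Andreief's identity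
  turns it into a determinant of beta sums, which reduces to a Hankel determinant of
  binomial coefficients.
\<close>


section \<open>Weighted perfect matchings\<close>

text \<open>A dented quartered hexagon has a product formula, but a sum of products of two such
  formulas need not have one. It does here because both parts see the same crossing set V. So the
  square of the Vandermonde product of V appears, and the rest of the weight of a position s is s
  times the differences of s^2 and u^2, where u runs over the first a odd numbers and over b + z
  consecutive odd numbers beyond the free interval. For this weight the moments in suitable bases
  have closed forms. Apart from that sum, the dents enter only through a factor that sees x and y as
  x + y. For y = 0 only the empty V is left, so the value is this factor times constants, namely
  2^(a_1) K Q'. Hence the arguments (x + y, 0) and (y, 0) in the quotient, and the sum x + y in the
  middle entries of both sequences. The value at x = 0 supplies the factor due to y; the quotient of
  T functions is the ratio of the Selberg sums at x and at 0.\<close>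

definition matchings :: "'a set set \<Rightarrow> 'a set \<Rightarrow> 'a set set set" where
  "matchings E S = {P. partition_on S P \<and> P \<subseteq> E}"

definition matching_sum :: "('a set \<Rightarrow> real) \<Rightarrow> 'a set set \<Rightarrow> 'a set \<Rightarrow> real" where
  "matching_sum w E S = (\<Sum>P\<in>matchings E S. \<Prod>l\<in>P. w l)"

lemma finite_matchings: "finite S \<Longrightarrow> finite (matchings E S)"
  by (rule finite_subset[of _ "Pow (Pow S)"]) (auto simp: matchings_def partition_on_def)

lemma matchings_finite_parts: "finite S \<Longrightarrow> P \<in> matchings E S \<Longrightarrow> finite P"
  by (auto simp: matchings_def intro: finite_elements)

lemma matching_sum_empty [simp]: "matching_sum w E {} = 1"
proof -
  have "matchings E {} = {{}}"
    by (auto simp: matchings_def partition_on_def)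
  then show ?thesis by (simp add: matching_sum_def)
qed

text \<open>A matching is determined by its parts that meet both sides and by what it does on the
  rest of each side. As such parts are pairwise disjoint, every set X of them may be prescribed; the
  sum therefore runs over a full power set, and the two sides become independent.\<close>

lemma matching_sum_cut:
  assumes fin: "finite A" "finite B" and AB: "A \<inter> B = {}"
    and dis: "disjoint {l \<in> E. l \<inter> A \<noteq> {} \<and> l \<inter> B \<noteq> {}}"
  shows "matching_sum w E (A \<union> B) =
    (\<Sum>X\<in>Pow {l \<in> E. l \<subseteq> A \<union> B \<and> l \<inter> A \<noteq> {} \<and> l \<inter> B \<noteq> {}}.
       (\<Prod>l\<in>X. w l) * matching_sum w E (A - \<Union>X) * matching_sum w E (B - \<Union>X))"
proof -
  define C where "C = {l \<in> E. l \<subseteq> A \<union> B \<and> l \<inter> A \<noteq> {} \<and> l \<inter> B \<noteq> {}}"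
  have finC: "finite C"
    by (rule finite_subset[of _ "Pow (A \<union> B)"]) (use fin in \<open>auto simp: C_def\<close>)
  have disC: "l = l'" if "l \<in> C" "l' \<in> C" "l \<inter> l' \<noteq> {}" for l l'
    using dis that unfolding disjoint_def C_def by blast
  define T where "T = Sigma (Pow C) (\<lambda>X. matchings E (A - \<Union>X) \<times> matchings E (B - \<Union>X))"
  have "(\<Sum>X\<in>Pow C. (\<Prod>l\<in>X. w l) * matching_sum w E (A - \<Union>X) * matching_sum w E (B - \<Union>X)) =
     (\<Sum>X\<in>Pow C. \<Sum>(P, Q)\<in>matchings E (A - \<Union>X) \<times> matchings E (B - \<Union>X).
        (\<Prod>l\<in>X. w l) * (\<Prod>l\<in>P. w l) * (\<Prod>l\<in>Q. w l))"
    unfolding matching_sum_def sum.cartesian_product[symmetric]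
    by (intro sum.cong) (auto simp: sum_product sum_distrib_left mult_ac)
  also have "\<dots> = (\<Sum>(X, P, Q)\<in>T. (\<Prod>l\<in>X. w l) * (\<Prod>l\<in>P. w l) * (\<Prod>l\<in>Q. w l))"
    unfolding T_def
    by (subst sum.Sigma) (use finC fin in \<open>auto simp: finite_matchings split_def\<close>)
  also have "\<dots> = matching_sum w E (A \<union> B)"
    unfolding matching_sum_def
  proof (rule sum.reindex_bij_witness[where i = "\<lambda>P. (P \<inter> C, {l \<in> P. l \<subseteq> A}, {l \<in> P. l \<subseteq> B})"
        and j = "\<lambda>(X, P, Q). X \<union> P \<union> Q"])
    fix t assume "t \<in> T"
    then obtain X P Q where t: "t = (X, P, Q)" and X: "X \<subseteq> C"
      and P: "P \<in> matchings E (A - \<Union>X)" and Q: "Q \<in> matchings E (B - \<Union>X)"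
      by (auto simp: T_def)
    have P': "\<Union>P = A - \<Union>X" "disjoint P" "{} \<notin> P" "P \<subseteq> E"
      and Q': "\<Union>Q = B - \<Union>X" "disjoint Q" "{} \<notin> Q" "Q \<subseteq> E"
      using P Q by (auto simp: matchings_def partition_on_def)
    have XC: "l \<in> E" "l \<subseteq> A \<union> B" "l \<inter> A \<noteq> {}" "l \<inter> B \<noteq> {}" if "l \<in> X" for l
      using X that by (auto simp: C_def)
    have PA: "l \<subseteq> A" "l \<inter> B = {}" "l \<noteq> {}" "l \<inter> \<Union>X = {}" if "l \<in> P" for l
      using P' that AB by auto
    have QB: "l \<subseteq> B" "l \<inter> A = {}" "l \<noteq> {}" "l \<inter> \<Union>X = {}" if "l \<in> Q" for l
      using Q' that AB by auto
    have e1: "(X \<union> P \<union> Q) \<inter> C = X"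
      using X PA(2) QB(2) unfolding C_def by blast
    have e2: "{l \<in> X \<union> P \<union> Q. l \<subseteq> A} = P"
    proof
      show "P \<subseteq> {l \<in> X \<union> P \<union> Q. l \<subseteq> A}" using PA(1) by auto
      have "\<not> l \<subseteq> A" if "l \<in> X" for l using XC(4)[OF that] AB by auto
      moreover have "\<not> l \<subseteq> A" if "l \<in> Q" for l using QB(1,3)[OF that] AB by auto
      ultimately show "{l \<in> X \<union> P \<union> Q. l \<subseteq> A} \<subseteq> P" by auto
    qed
    have e3: "{l \<in> X \<union> P \<union> Q. l \<subseteq> B} = Q"
    proof
      show "Q \<subseteq> {l \<in> X \<union> P \<union> Q. l \<subseteq> B}" using QB(1) by auto
      have "\<not> l \<subseteq> B" if "l \<in> X" for l using XC(3)[OF that] AB by auto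
      moreover have "\<not> l \<subseteq> B" if "l \<in> P" for l using PA(1,3)[OF that] AB by auto
      ultimately show "{l \<in> X \<union> P \<union> Q. l \<subseteq> B} \<subseteq> Q" by auto
    qed
    show "(case case t of (X, P, Q) \<Rightarrow> X \<union> P \<union> Q of P \<Rightarrow> (P \<inter> C, {l \<in> P. l \<subseteq> A}, {l \<in> P. l \<subseteq> B})) = t"
      using e1 e2 e3 by (simp add: t)
    have un: "\<Union>(X \<union> P \<union> Q) = A \<union> B"
    proof -
      have "\<Union>X \<subseteq> A \<union> B" using XC(2) by (rule Sup_least)
      then show ?thesis unfolding Union_Un_distrib P'(1) Q'(1) by auto
    qed
    have dX: "disjoint X" using disC X unfolding disjoint_def by blast
    have "disjoint (X \<union> P \<union> Q)"
      unfolding disjoint_def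
    proof (intro ballI impI)
      fix l l' assume l: "l \<in> X \<union> P \<union> Q" "l' \<in> X \<union> P \<union> Q" "l \<noteq> l'"
      have 1: "l \<inter> l' = {}" if "l \<in> X" "l' \<in> X"
        using that l(3) dX by (auto simp: disjoint_def)
      have 2: "l \<inter> l' = {}" if "l \<in> P" "l' \<in> P"
        using that l(3) P'(2) by (auto simp: disjoint_def)
      have 3: "l \<inter> l' = {}" if "l \<in> Q" "l' \<in> Q"
        using that l(3) Q'(2) by (auto simp: disjoint_def)
      have 4: "m \<inter> m' = {}" "m' \<inter> m = {}" if "m \<in> P" "m' \<in> X" for m m'
        using that PA(4)[of m] by auto
      have 5: "m \<inter> m' = {}" "m' \<inter> m = {}" if "m \<in> Q" "m' \<in> X" for m m'
        using that QB(4)[of m] by auto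
      have 6: "m \<inter> m' = {}" "m' \<inter> m = {}" if "m \<in> P" "m' \<in> Q" for m m'
        using PA(1)[OF that(1)] QB(2)[OF that(2)] by auto
      show "l \<inter> l' = {}"
        using l(1,2) 1 2 3 4 5 6 by (elim UnE) simp_all
    qed
    moreover have "{} \<notin> X \<union> P \<union> Q" using P' Q' XC by blast
    moreover have "X \<union> P \<union> Q \<subseteq> E" using P' Q' XC by blast
    ultimately show "(case t of (X, P, Q) \<Rightarrow> X \<union> P \<union> Q) \<in> matchings E (A \<union> B)"
      using un by (simp add: t matchings_def partition_on_def)
    have fins: "finite X" "finite P" "finite Q"
      using finite_subset[OF X finC] matchings_finite_parts[OF _ P] matchings_finite_parts[OF _ Q] fin
      by auto
    have "l \<notin> X" "l \<notin> Q" if "l \<in> P" for l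
      using PA[OF that] XC(4)[of l] QB(2)[of l] by auto
    moreover have "l \<notin> X" if "l \<in> Q" for l
      using QB[OF that] XC(3)[of l] by auto
    ultimately have "X \<inter> P = {}" "(X \<union> P) \<inter> Q = {}" by auto
    then show "(\<Prod>l\<in>(case t of (X, P, Q) \<Rightarrow> X \<union> P \<union> Q). w l) =
        (case t of (X, P, Q) \<Rightarrow> (\<Prod>l\<in>X. w l) * (\<Prod>l\<in>P. w l) * (\<Prod>l\<in>Q. w l))"
      using fins by (simp add: t prod.union_disjoint)
  next
    fix P assume P: "P \<in> matchings E (A \<union> B)"
    then have P': "\<Union>P = A \<union> B" "disjoint P" "{} \<notin> P" "P \<subseteq> E"
      by (auto simp: matchings_def partition_on_def)
    define X where "X = P \<inter> C"
    define PA where "PA = {l \<in> P. l \<subseteq> A}"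
    define PB where "PB = {l \<in> P. l \<subseteq> B}"
    have cover: "X \<union> PA \<union> PB = P"
    proof
      show "P \<subseteq> X \<union> PA \<union> PB"
      proof
        fix l assume l: "l \<in> P"
        then have "l \<subseteq> A \<union> B" "l \<in> E" using P' by auto
        then show "l \<in> X \<union> PA \<union> PB"
          using l by (auto simp: X_def PA_def PB_def C_def)
      qed
    qed (auto simp: X_def PA_def PB_def)
    have dd: "l = l'" if "l \<in> P" "l' \<in> P" "x \<in> l" "x \<in> l'" for l l' x
      using P'(2) that unfolding disjoint_def by blast
    have uA: "\<Union>PA = A - \<Union>X"
    proof
      show "\<Union>PA \<subseteq> A - \<Union>X"
      proof
        fix x assume "x \<in> \<Union>PA"
        then obtain l where l: "l \<in> P" "l \<subseteq> A" "x \<in> l" by (auto simp: PA_def)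
        have "x \<notin> m" if "m \<in> X" for m
          using dd[OF l(1) _ l(3), of m] l(2) AB that by (auto simp: X_def C_def)
        then show "x \<in> A - \<Union>X" using l by auto
      qed
      show "A - \<Union>X \<subseteq> \<Union>PA"
        using P'(1) cover AB unfolding PB_def by blast
    qed
    have uB: "\<Union>PB = B - \<Union>X"
    proof
      show "\<Union>PB \<subseteq> B - \<Union>X"
      proof
        fix x assume "x \<in> \<Union>PB"
        then obtain l where l: "l \<in> P" "l \<subseteq> B" "x \<in> l" by (auto simp: PB_def)
        have "x \<notin> m" if "m \<in> X" for m
          using dd[OF l(1) _ l(3), of m] l(2) AB that by (auto simp: X_def C_def)
        then show "x \<in> B - \<Union>X" using l by auto
      qed
      show "B - \<Union>X \<subseteq> \<Union>PB"
        using P'(1) cover AB unfolding PA_def by blast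
    qed
    have "(X, PA, PB) \<in> T"
      unfolding T_def using uA uB P'(2-4)
      by (auto simp: X_def PA_def PB_def matchings_def partition_on_def disjoint_def)
    then show "(P \<inter> C, {l \<in> P. l \<subseteq> A}, {l \<in> P. l \<subseteq> B}) \<in> T"
      by (simp add: X_def PA_def PB_def)
    show "(case (P \<inter> C, {l \<in> P. l \<subseteq> A}, {l \<in> P. l \<subseteq> B}) of (X, P, Q) \<Rightarrow> X \<union> P \<union> Q) = P"
      using cover by (simp add: X_def PA_def PB_def)
  qed
  finally show ?thesis by (simp add: C_def)
qed

lemma matching_sum_union:
  assumes "finite A" "finite B" "A \<inter> B = {}"
    and "\<And>l. l \<in> E \<Longrightarrow> l \<inter> A = {} \<or> l \<inter> B = {}"
  shows "matching_sum w E (A \<union> B) = matching_sum w E A * matching_sum w E B"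
proof -
  have *: "{l \<in> E. l \<subseteq> A \<union> B \<and> l \<inter> A \<noteq> {} \<and> l \<inter> B \<noteq> {}} = {}"
    "{l \<in> E. l \<inter> A \<noteq> {} \<and> l \<inter> B \<noteq> {}} = {}"
    using assms(4) by blast+
  have "disjoint {l \<in> E. l \<inter> A \<noteq> {} \<and> l \<inter> B \<noteq> {}}"
    unfolding *(2) by simp
  from matching_sum_cut[OF assms(1-3) this, of w] show ?thesis
    unfolding *(1) by simp
qed

text \<open>The part that covers \<open>f\<close> can only be \<open>l\<close>, so removing it is a
  bijection onto the matchings of the rest.\<close>

lemma matching_sum_forced:
  assumes "finite S" "l \<in> E" "l \<subseteq> S" "f \<in> l"
    and uniq: "\<And>l'. l' \<in> E \<Longrightarrow> l' \<subseteq> S \<Longrightarrow> f \<in> l' \<Longrightarrow> l' = l"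
  shows "matching_sum w E S = w l * matching_sum w E (S - l)"
proof -
  have notin: "l \<notin> P" if "P \<in> matchings E (S - l)" for P
    using that assms(4) by (auto simp: matchings_def partition_on_def)
  have "matchings E S = insert l ` matchings E (S - l)"
  proof (intro equalityI subsetI)
    fix P assume P: "P \<in> matchings E S"
    then have P': "\<Union>P = S" "disjoint P" "{} \<notin> P" "P \<subseteq> E"
      by (auto simp: matchings_def partition_on_def)
    obtain l' where "l' \<in> P" "f \<in> l'" using P'(1) assms(3,4) by blast
    then have l: "l \<in> P" using uniq[of l'] P' by blast
    have "\<Union>(P - {l}) = S - l"
      using P' l unfolding disjoint_def by blast
    then have "P - {l} \<in> matchings E (S - l)"
      using P' by (auto simp: matchings_def partition_on_def disjoint_def)
    then show "P \<in> insert l ` matchings E (S - l)"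
      using l by (metis image_eqI insert_Diff)
  next
    fix P assume "P \<in> insert l ` matchings E (S - l)"
    then obtain Q where Q: "P = insert l Q" "Q \<in> matchings E (S - l)" by blast
    then have Q': "\<Union>Q = S - l" "disjoint Q" "{} \<notin> Q" "Q \<subseteq> E"
      by (auto simp: matchings_def partition_on_def)
    have "m \<inter> l = {}" "l \<inter> m = {}" if "m \<in> Q" for m using that Q'(1) by auto
    then have "disjoint P" using Q'(2) by (auto simp: Q(1) disjoint_def)
    moreover have "\<Union>P = S" using Q(1) Q'(1) assms(3) by auto
    ultimately show "P \<in> matchings E S"
      using Q(1) Q' assms(2-4) by (auto simp: matchings_def partition_on_def)
  qed
  moreover have "inj_on (insert l) (matchings E (S - l))"
    by (rule inj_onI) (metis notin insert_ident)
  ultimately have "matching_sum w E S = (\<Sum>P\<in>matchings E (S - l). \<Prod>l'\<in>insert l P. w l')"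
    by (simp add: matching_sum_def sum.reindex)
  also have "\<dots> = (\<Sum>P\<in>matchings E (S - l). w l * (\<Prod>l'\<in>P. w l'))"
    using notin assms(1) by (intro sum.cong refl prod.insert) (auto intro: matchings_finite_parts)
  finally show ?thesis by (simp add: matching_sum_def sum_distrib_left)
qed

text \<open>Serves both the passage from faces to cells and the reflection in the cutting line. The
  edge sets have to correspond only on subsets of \<open>S\<close>, because no other part occurs in
  a matching.\<close>

lemma matching_sum_image:
  assumes inj: "inj_on h S"
    and E: "\<And>l. l \<subseteq> S \<Longrightarrow> h ` l \<in> E' \<longleftrightarrow> l \<in> E"
    and w: "\<And>l. l \<subseteq> S \<Longrightarrow> l \<in> E \<Longrightarrow> w' (h ` l) = w l"
  shows "matching_sum w' E' (h ` S) = matching_sum w E S"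
proof -
  have PS: "l \<subseteq> S" if "P \<in> matchings E S" "l \<in> P" for P l
    using that by (auto simp: matchings_def partition_on_def)
  have inj2: "inj_on ((`) h) (Pow S)"
    by (rule inj_on_image_Pow[OF inj])
  have inj3: "inj_on ((`) ((`) h)) (Pow (Pow S))"
    by (rule inj_on_image_Pow[OF inj2])
  have sub: "matchings E S \<subseteq> Pow (Pow S)" using PS by blast
  have im: "matchings E' (h ` S) = (`) ((`) h) ` matchings E S"
  proof (intro equalityI subsetI)
    fix Q assume Q: "Q \<in> matchings E' (h ` S)"
    \<comment> \<open>\<open>g\<close> takes preimages; on the parts of \<open>Q\<close> it inverts
      taking images, since these lie in the image of \<open>S\<close>.\<close>
    define g where "g = (\<lambda>m. {x \<in> S. h x \<in> m})"
    have Q': "\<Union>Q = h ` S" "disjoint Q" "{} \<notin> Q" "Q \<subseteq> E'"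
      using Q by (auto simp: matchings_def partition_on_def)
    have hg: "h ` g m = m" if "m \<in> Q" for m
      using that Q'(1) by (auto simp: g_def)
    have "\<Union>(g ` Q) = S" using Q'(1) by (auto simp: g_def)
    moreover have "disjoint (g ` Q)"
      using Q'(2) by (auto simp: disjoint_def g_def)
    moreover have "{} \<notin> g ` Q" using hg Q'(3) by force
    moreover have "g ` Q \<subseteq> E"
    proof
      fix l assume "l \<in> g ` Q"
      then obtain m where m: "m \<in> Q" "l = g m" by auto
      then have "l \<subseteq> S" by (auto simp: g_def)
      with E[of l] show "l \<in> E" using hg[OF m(1)] m Q'(4) by auto
    qed
    ultimately have "g ` Q \<in> matchings E S" by (auto simp: matchings_def partition_on_def)
    moreover have "Q = (`) h ` g ` Q" using hg by (force simp: image_image)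
    ultimately show "Q \<in> (`) ((`) h) ` matchings E S" by blast
  next
    fix Q assume "Q \<in> (`) ((`) h) ` matchings E S"
    then obtain P where P: "P \<in> matchings E S" "Q = (`) h ` P" by auto
    then have P': "\<Union>P = S" "disjoint P" "{} \<notin> P" "P \<subseteq> E"
      by (auto simp: matchings_def partition_on_def)
    have "disjoint Q"
      unfolding disjoint_def
    proof (intro ballI impI)
      fix m m' assume "m \<in> Q" "m' \<in> Q" "m \<noteq> m'"
      then obtain l l' where l: "l \<in> P" "l' \<in> P" "m = h ` l" "m' = h ` l'" "l \<noteq> l'" using P by auto
      then have "l \<inter> l' = {}" using P'(2) by (auto simp: disjoint_def)
      then show "m \<inter> m' = {}"
        using l inj_on_image_Int[OF inj, of l l'] P'(1) by auto
    qed
    moreover have "\<Union>Q = h ` S" using P P' by auto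
    moreover have "{} \<notin> Q" using P P' by auto
    moreover have "Q \<subseteq> E'"
    proof
      fix m assume "m \<in> Q"
      then obtain l where "l \<in> P" "m = h ` l" using P by auto
      then show "m \<in> E'" using E[OF PS[OF P(1)]] P'(4) by auto
    qed
    ultimately show "Q \<in> matchings E' (h ` S)" by (auto simp: matchings_def partition_on_def)
  qed
  have "matching_sum w' E' (h ` S) = (\<Sum>P\<in>matchings E S. \<Prod>m\<in>(`) h ` P. w' m)"
    unfolding matching_sum_def im
    by (subst sum.reindex) (use inj_on_subset[OF inj3 sub] in auto)
  also have "\<dots> = (\<Sum>P\<in>matchings E S. \<Prod>l\<in>P. w l)"
  proof (rule sum.cong)
    fix P assume P: "P \<in> matchings E S"
    have "inj_on ((`) h) P" using inj_on_subset[OF inj2] PS[OF P] by blast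
    then have "(\<Prod>m\<in>(`) h ` P. w' m) = (\<Prod>l\<in>P. w' (h ` l))" by (simp add: prod.reindex)
    also have "\<dots> = (\<Prod>l\<in>P. w l)"
      using P PS by (intro prod.cong refl w) (auto simp: matchings_def)
    finally show "(\<Prod>m\<in>(`) h ` P. w' m) = (\<Prod>l\<in>P. w l)" .
  qed simp
  finally show ?thesis by (simp add: matching_sum_def)
qed

text \<open>A colouring argument: a signed count that vanishes on every part vanishes on every set
  that can be matched.\<close>

lemma matching_sum_unbalanced:
  fixes s :: "'a \<Rightarrow> int"
  assumes "finite S" "\<And>l. l \<in> E \<Longrightarrow> sum s l = 0" "sum s S \<noteq> 0"
  shows "matching_sum w E S = 0"
proof -
  have "P \<notin> matchings E S" for P
  proof
    assume P: "P \<in> matchings E S"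
    then have P': "\<Union>P = S" "disjoint P" "P \<subseteq> E"
      by (auto simp: matchings_def partition_on_def)
    have "sum s S = sum (sum s) P"
      unfolding P'(1)[symmetric]
    proof (subst sum.Union_disjoint)
      show "\<forall>A\<in>P. finite A" using finite_subset[OF _ assms(1)] Union_upper[of _ P] P'(1) by auto
      show "\<forall>A\<in>P. \<forall>B\<in>P. A \<noteq> B \<longrightarrow> A \<inter> B = {}" using P'(2) by (auto simp: disjoint_def)
    qed simp
    also have "\<dots> = 0" using P' assms(2) by (intro sum.neutral) auto
    finally show False using assms(3) by simp
  qed
  then have "matchings E S = {}" by blast
  then show ?thesis by (simp add: matching_sum_def)
qed

section \<open>Brick-wall coordinates\<close>

text \<open>Cell \<open>(k, c)\<close> is a face in the row between the heights \<open>k\<close> and \<open>k + 1\<close>, and \<open>c\<close> is twice the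
  abscissa of its centre.  In these coordinates the faces form a brick wall, all boundaries
  of the regions are given by linear inequalities, and positions on a horizontal line keep
  their value of \<open>c\<close> from one row to the next.\<close>

fun cell :: "face \<Rightarrow> int \<times> int" where
  "cell (Up i k) = (k, 2 * i + k + 1)"
| "cell (Down i k) = (k - 1, 2 * i + k + 1)"

definition bricks :: "(int \<times> int) set set" where
  "bricks = {{(k, c), (k, c + 1)} | k c. True} \<union> {{(k, c), (k + 1, c)} | k c. even (c - k)}"

text \<open>The vertical lozenges with both western sides on a zigzag are those in column \<open>0\<close>; the regions
  whose lozenges all have weight \<open>1\<close> have no cell there, so that one weight serves all regions.\<close>

definition brick_weight :: "(int \<times> int) set \<Rightarrow> real" where
  "brick_weight l = (if \<exists>k. l = {(k, 0), (k + 1, 0)} then 1 / 2 else 1)"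

abbreviation brick_sum :: "(int \<times> int) set \<Rightarrow> real" where
  "brick_sum \<equiv> matching_sum brick_weight bricks"

lemma inj_cell: "inj cell"
proof (rule injI)
  fix f g show "cell f = cell g \<Longrightarrow> f = g"
    by (cases f; cases g) (auto, presburger+)
qed

lemma card_three_Int:
  "a \<noteq> b \<Longrightarrow> b \<noteq> c \<Longrightarrow> a \<noteq> c \<Longrightarrow>
    card ({a, b, c} \<inter> B) = of_bool (a \<in> B) + of_bool (b \<in> B) + of_bool (c \<in> B)"
  by (auto simp: Int_insert_left)

lemma brick_iff:
  "{(k, c), (l, d)} \<in> bricks \<longleftrightarrow>
     (k = l \<and> (d = c + 1 \<or> c = d + 1)) \<or> (l = k + 1 \<and> c = d \<and> even (c - k)) \<or> (k = l + 1 \<and> c = d \<and> even (c - l))"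
  unfolding bricks_def by (simp add: doubleton_eq_iff) blast

text \<open>The brick wall is the dual graph of the lattice: slanted edges become horizontal bricks
  and horizontal edges become vertical ones.\<close>

lemma share_edge_iff:
  "f \<noteq> g \<and> card (verts f \<inter> verts g) = 2 \<longleftrightarrow> {cell f, cell g} \<in> bricks"
proof (cases f; cases g)
  fix i k j l assume fg: "f = Up i k" "g = Up j l"
  show ?thesis unfolding fg cell.simps brick_iff verts.simps
    by (subst card_three_Int; cases "l = k"; cases "l = k + 1"; cases "l = k - 1")
      (auto simp: of_bool_def split: if_splits)
next
  fix i k j l assume fg: "f = Down i k" "g = Down j l"
  show ?thesis unfolding fg cell.simps brick_iff verts.simps
    by (subst card_three_Int; cases "l = k"; cases "l = k + 1"; cases "l = k - 1")
      (auto simp: of_bool_def split: if_splits)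
next
  fix i k j l assume fg: "f = Up i k" "g = Down j l"
  show ?thesis unfolding fg cell.simps brick_iff verts.simps
    by (subst card_three_Int; cases "l = k"; cases "l = k + 1"; cases "l = k - 1")
      (auto simp: of_bool_def split: if_splits)
next
  fix i k j l assume fg: "f = Down i k" "g = Up j l"
  show ?thesis unfolding fg cell.simps brick_iff verts.simps
    by (subst card_three_Int; cases "l = k"; cases "l = k + 1"; cases "l = k - 1")
      (auto simp: of_bool_def split: if_splits)
qed

lemma brick_doubleton: "l \<in> bricks \<Longrightarrow> \<exists>p q. p \<noteq> q \<and> l = {p, q}"
proof -
  assume "l \<in> bricks"
  then consider k c where "l = {(k, c), (k, c + 1)}" | k c where "l = {(k, c), (k + 1, c)}"
    by (auto simp: bricks_def)
  then show ?thesis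
  proof cases
    case 1
    then show ?thesis by (intro exI[of _ "(k, c)"] exI[of _ "(k, c + 1)"]) simp
  next
    case 2
    then show ?thesis by (intro exI[of _ "(k, c)"] exI[of _ "(k + 1, c)"]) simp
  qed
qed

lemma is_lozenge_iff: "is_lozenge l \<longleftrightarrow> cell ` l \<in> bricks"
proof
  assume "is_lozenge l"
  then show "cell ` l \<in> bricks"
    by (auto simp: is_lozenge_def simp flip: share_edge_iff)
next
  assume b: "cell ` l \<in> bricks"
  then obtain p q where pq: "p \<noteq> q" "cell ` l = {p, q}" using brick_doubleton by blast
  then obtain f g where fg: "f \<in> l" "g \<in> l" "cell f = p" "cell g = q" by (metis imageE insertCI)
  have "x = f \<or> x = g" if "x \<in> l" for x
  proof -
    have "cell x \<in> {p, q}" using that pq(2) by blast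
    then show ?thesis using fg inj_cell by (auto dest: injD)
  qed
  then have "l = {f, g}" using fg by blast
  then show "is_lozenge l"
    using share_edge_iff[of f g] b by (auto simp: is_lozenge_def)
qed

lemma tiling_sum_cells:
  assumes "\<And>l. l \<subseteq> R \<Longrightarrow> is_lozenge l \<Longrightarrow> brick_weight (cell ` l) = w l"
  shows "tiling_sum w R = brick_sum (cell ` R)"
proof -
  have "tilings R = matchings {l. is_lozenge l} R"
    by (auto simp: tilings_def matchings_def)
  then have "tiling_sum w R = matching_sum w {l. is_lozenge l} R"
    by (simp add: tiling_sum_def matching_sum_def)
  also have "\<dots> = brick_sum (cell ` R)"
    by (rule matching_sum_image[symmetric])
      (use inj_cell assms in \<open>auto simp: is_lozenge_iff intro: inj_on_subset\<close>)
  finally show ?thesis .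
qed

lemma cell_image_iff:
  "(k, c) \<in> cell ` R \<longleftrightarrow>
     (if odd (c - k) then Up ((c - k - 1) div 2) k \<in> R else Down ((c - k - 2) div 2) (k + 1) \<in> R)"
proof (cases "odd (c - k)")
  case True
  then have "cell (Up ((c - k - 1) div 2) k) = (k, c)" by (auto elim: oddE)
  then show ?thesis using True inj_cell by (metis inj_image_mem_iff)
next
  case False
  then have "cell (Down ((c - k - 2) div 2) (k + 1)) = (k, c)" by (auto elim: evenE)
  then show ?thesis using False inj_cell by (metis inj_image_mem_iff)
qed

text \<open>The index \<open>k + 1\<close> of the down-pointing face puts it into the same row as
  the up-pointing one, so both hypotheses speak of row \<open>k\<close>.\<close>

lemma cell_image_eqI:
  assumes "\<And>i k. Up i k \<in> R \<longleftrightarrow> (k, 2 * i + k + 1) \<in> S"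
    and "\<And>i k. Down i (k + 1) \<in> R \<longleftrightarrow> (k, 2 * i + k + 2) \<in> S"
  shows "cell ` R = S"
proof (rule Set.set_eqI)
  fix p :: "int \<times> int"
  obtain k c where p: "p = (k, c)" by (cases p)
  show "p \<in> cell ` R \<longleftrightarrow> p \<in> S"
  proof (cases "odd (c - k)")
    case True
    then obtain i where "c = 2 * i + k + 1" by (metis add.commute diff_add_cancel group_cancel.add1 oddE)
    then show ?thesis using assms(1)[of i k] by (simp add: p cell_image_iff)
  next
    case False
    then have "even (c - k)" by simp
    then obtain i where "c - k = 2 * i" by (rule evenE)
    then have "c = 2 * (i - 1) + k + 2" by simp
    then show ?thesis using assms(2)[of "i - 1" k] by (simp add: p cell_image_iff)
  qed
qed

section \<open>The cells of strips, triangles and the half triangle\<close>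

lemma real_half_le_iff:
  "real_of_int a + real_of_int k / 2 \<le> real_of_int b / 2 \<longleftrightarrow> 2 * a + k \<le> b"
  "real_of_int b / 2 \<le> real_of_int a + real_of_int k / 2 \<longleftrightarrow> b \<le> 2 * a + k"
  by linarith+

text \<open>Doubling all abscissae clears the halves, so that membership becomes integer linear
  arithmetic.\<close>

lemma strip_iff:
  assumes "\<And>k. w k = real_of_int (w2 k) / 2" "\<And>k. e k = real_of_int (e2 k) / 2"
  shows "f \<in> strip lo hi w e \<longleftrightarrow>
    (\<forall>(i, k)\<in>verts f. lo \<le> k \<and> k \<le> hi \<and> w2 k \<le> 2 * i + k \<and> 2 * i + k \<le> e2 k)"
  by (auto simp: strip_def xcoord_def assms real_half_le_iff)

text \<open>A cell of column 0 has its base at an odd height, between the abscissae -1/2 and 1/2.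
  The zigzag with teeth to the east cuts these cells off, the one with teeth to the west includes
  them; this is the only difference to the next lemma.\<close>

lemma cells_strip_east:
  "cell ` strip 0 H zig_east (\<lambda>k. real W - real_of_int k / 2) =
     {(k, c). 0 \<le> k \<and> k < H \<and> 1 \<le> c \<and> c \<le> 2 * int W - k - 1}" (is "cell ` ?R = ?S")
proof (rule cell_image_eqI)
  have iff: "f \<in> ?R \<longleftrightarrow> (\<forall>(i, k)\<in>verts f. 0 \<le> k \<and> k \<le> H \<and>
      (if even k then 0 else 1) \<le> 2 * i + k \<and> 2 * i + k \<le> (2 * int W - k))" for f
    by (rule strip_iff) (auto simp: zig_east_def field_simps)
  fix i k :: int
  obtain j where j: "k = 2 * j \<or> k = 2 * j + 1" by (metis evenE oddE)
  show "Up i k \<in> ?R \<longleftrightarrow> (k, 2 * i + k + 1) \<in> ?S"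
    unfolding iff using j by (elim disjE; auto; presburger)
  show "Down i (k + 1) \<in> ?R \<longleftrightarrow> (k, 2 * i + k + 2) \<in> ?S"
    unfolding iff using j by (elim disjE; auto; presburger)
qed

lemma cells_strip_west:
  "cell ` strip 0 H zig_west (\<lambda>k. real W - real_of_int k / 2) =
     {(k, c). 0 \<le> k \<and> k < H \<and> 0 \<le> c \<and> c \<le> 2 * int W - k - 1}" (is "cell ` ?R = ?S")
proof (rule cell_image_eqI)
  have iff: "f \<in> ?R \<longleftrightarrow> (\<forall>(i, k)\<in>verts f. 0 \<le> k \<and> k \<le> H \<and>
      (if even k then 0 else - 1) \<le> 2 * i + k \<and> 2 * i + k \<le> (2 * int W - k))" for f
    by (rule strip_iff) (auto simp: zig_west_def field_simps)
  fix i k :: int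
  obtain j where j: "k = 2 * j \<or> k = 2 * j + 1" by (metis evenE oddE)
  show "Up i k \<in> ?R \<longleftrightarrow> (k, 2 * i + k + 1) \<in> ?S"
    unfolding iff using j by (elim disjE; auto; presburger)
  show "Down i (k + 1) \<in> ?R \<longleftrightarrow> (k, 2 * i + k + 2) \<in> ?S"
    unfolding iff using j by (elim disjE; auto; presburger)
qed

lemma cells_strip_kinked:
  "cell ` strip (- B) 0 zig_west
     (\<lambda>k. if - k \<le> int z then real L - real_of_int k / 2 else real L + real z + real_of_int k / 2) =
     {(k, c). - B \<le> k \<and> k < 0 \<and> 0 \<le> c \<and>
        c \<le> (if - k \<le> int z then 2 * int L - k - 1 else 2 * int L + 2 * int z + k)}"
  (is "cell ` ?R = ?S")
proof (rule cell_image_eqI)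
  define w2 :: "int \<Rightarrow> int" where "w2 = (\<lambda>k. if even k then 0 else - 1)"
  define e2 :: "int \<Rightarrow> int" where
    "e2 = (\<lambda>k. if - k \<le> int z then 2 * int L - k else 2 * int L + 2 * int z + k)"
  have iff: "f \<in> ?R \<longleftrightarrow> (\<forall>(i, k)\<in>verts f. - B \<le> k \<and> k \<le> 0 \<and>
      w2 k \<le> 2 * i + k \<and> 2 * i + k \<le> e2 k)" for f
    by (rule strip_iff) (auto simp: zig_west_def w2_def e2_def field_simps)
  fix i k :: int
  have w: "w2 k \<le> 2 * i + k \<and> w2 (k + 1) \<le> 2 * i + (k + 1) \<longleftrightarrow> 0 \<le> 2 * i + k + 1"
    unfolding w2_def by (cases "even k"; simp; presburger)
  have e: "2 * (i + 1) + k \<le> e2 k \<and> 2 * i + (k + 1) \<le> e2 (k + 1) \<longleftrightarrow>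
      2 * i + k + 1 \<le> (if - k \<le> int z then 2 * int L - k - 1 else 2 * int L + 2 * int z + k)"
    unfolding e2_def by (auto split: if_splits; presburger)
  have "w2 k \<le> 2 * i + k \<Longrightarrow> w2 k \<le> 2 * (i + 1) + k"
    "2 * (i + 1) + k \<le> e2 k \<Longrightarrow> 2 * i + k \<le> e2 k" by simp_all
  then have "Up i k \<in> ?R \<longleftrightarrow> - B \<le> k \<and> k + 1 \<le> 0 \<and>
      (w2 k \<le> 2 * i + k \<and> w2 (k + 1) \<le> 2 * i + (k + 1)) \<and>
      (2 * (i + 1) + k \<le> e2 k \<and> 2 * i + (k + 1) \<le> e2 (k + 1))"
    unfolding iff verts.simps by auto
  then show "Up i k \<in> ?R \<longleftrightarrow> (k, 2 * i + k + 1) \<in> ?S"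
    unfolding w e by auto
  have w: "w2 (k + 1) \<le> 2 * i + (k + 1) \<and> w2 k \<le> 2 * (i + 1) + k \<longleftrightarrow> 0 \<le> 2 * i + k + 2"
    unfolding w2_def by (cases "even k"; simp; presburger)
  have e: "2 * (i + 1) + (k + 1) \<le> e2 (k + 1) \<and> 2 * (i + 1) + k \<le> e2 k \<longleftrightarrow>
      2 * i + k + 2 \<le> (if - k \<le> int z then 2 * int L - k - 1 else 2 * int L + 2 * int z + k)"
    unfolding e2_def by (auto split: if_splits; presburger)
  have "w2 (k + 1) \<le> 2 * i + (k + 1) \<Longrightarrow> w2 (k + 1) \<le> 2 * (i + 1) + (k + 1)"
    "2 * (i + 1) + (k + 1) \<le> e2 (k + 1) \<Longrightarrow> 2 * i + (k + 1) \<le> e2 (k + 1)" by simp_all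
  then have "Down i (k + 1) \<in> ?R \<longleftrightarrow> - B \<le> k \<and> k + 1 \<le> 0 \<and>
      (w2 (k + 1) \<le> 2 * i + (k + 1) \<and> w2 k \<le> 2 * (i + 1) + k) \<and>
      (2 * (i + 1) + (k + 1) \<le> e2 (k + 1) \<and> 2 * (i + 1) + k \<le> e2 k)"
    unfolding iff verts.simps by auto
  then show "Down i (k + 1) \<in> ?R \<longleftrightarrow> (k, 2 * i + k + 2) \<in> ?S"
    unfolding w e by auto
qed

lemma cells_up_triangle:
  "cell ` up_triangle (real p) (real q) =
     {(k, c). 0 \<le> k \<and> 2 * int p + k + 1 \<le> c \<and> c \<le> 2 * int q - k - 1}"
proof -
  have "f \<in> up_triangle (real p) (real q) \<longleftrightarrow>
    (\<forall>(i, k)\<in>verts f. 0 \<le> k \<and> 2 * int p + k \<le> 2 * i + k \<and> 2 * i + k \<le> 2 * int q - k)" for f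
    using real_half_le_iff(2)[of "2 * int p + k" i k for i k]
      real_half_le_iff(1)[of i k "2 * int q - k" for i k]
    by (auto simp: up_triangle_def xcoord_def field_simps)
  then show ?thesis
    by (intro cell_image_eqI; simp; presburger)
qed

lemma cells_down_triangle:
  "cell ` down_triangle (real p) (real q) =
     {(k, c). k < 0 \<and> 2 * int p - k \<le> c \<and> c \<le> 2 * int q + k}"
proof -
  have "f \<in> down_triangle (real p) (real q) \<longleftrightarrow>
    (\<forall>(i, k)\<in>verts f. k \<le> 0 \<and> 2 * int p - k \<le> 2 * i + k \<and> 2 * i + k \<le> 2 * int q + k)" for f
    using real_half_le_iff(2)[of "2 * int p - k" i k for i k]
      real_half_le_iff(1)[of i k "2 * int q + k" for i k]
    by (auto simp: down_triangle_def xcoord_def field_simps)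
  then show ?thesis
    by (intro cell_image_eqI; simp; presburger)
qed

lemma cells_half_triangle:
  "cell ` NR_half_triangle a = {(k, c). c \<le> 2 * int (entry a 1) + k}"
proof -
  have "f \<in> NR_half_triangle a \<longleftrightarrow> (\<forall>(i, k)\<in>verts f. i \<le> int (entry a 1))" for f
    by (auto simp: NR_half_triangle_def xcoord_def)
  then show ?thesis
    by (intro cell_image_eqI; simp; presburger)
qed

section \<open>Determinants of functions of two indices\<close>

lemma chain_less:
  fixes d :: "nat \<Rightarrow> 'a::order"
  assumes "\<And>j. j < n \<Longrightarrow> d j < d (Suc j)" "i < j" "j \<le> n"
  shows "d i < d j"
  using assms(2,3)
proof (induction j)
  case (Suc j)
  then have "d j < d (Suc j)" using assms(1) by simp
  then show ?case using Suc by (cases "i = j") (auto intro: less_trans)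
qed simp

lemma chain_le:
  fixes d :: "nat \<Rightarrow> 'a::order"
  assumes "\<And>j. j < n \<Longrightarrow> d j < d (Suc j)" "i \<le> j" "j \<le> n"
  shows "d i \<le> d j"
  using chain_less[of n d i j] assms by (cases "i = j") auto

text \<open>Written with a function of two indices, so that the rewriting rules below carry no
  conditions on matrix dimensions.\<close>

definition fdet :: "nat \<Rightarrow> (nat \<Rightarrow> nat \<Rightarrow> real) \<Rightarrow> real" where
  "fdet n f = det (mat n n (\<lambda>(i, j). f i j))"

lemma fdet_cong:
  assumes "\<And>i j. i < n \<Longrightarrow> j < n \<Longrightarrow> f i j = g i j"
  shows "fdet n f = fdet n g"
  unfolding fdet_def by (rule arg_cong[of _ _ det], rule eq_matI) (use assms in auto)

lemma fdet_mult: "fdet n (\<lambda>i j. \<Sum>k<n. f i k * g k j) = fdet n f * fdet n g"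
proof -
  have "mat n n (\<lambda>(i, j). \<Sum>k<n. f i k * g k j) = mat n n (\<lambda>(i, j). f i j) * mat n n (\<lambda>(i, j). g i j)"
    by (rule eq_matI) (auto simp: scalar_prod_def lessThan_atLeast0)
  then show ?thesis
    unfolding fdet_def by (metis det_mult mat_carrier)
qed

lemma fdet_transpose: "fdet n (\<lambda>i j. f j i) = fdet n f"
proof -
  have "mat n n (\<lambda>(i, j). f j i) = transpose_mat (mat n n (\<lambda>(i, j). f i j))"
    by (rule eq_matI) auto
  then show ?thesis unfolding fdet_def by (metis det_transpose mat_carrier)
qed

lemma fdet_upper:
  assumes "\<And>i j. j < i \<Longrightarrow> i < n \<Longrightarrow> f i j = 0"
  shows "fdet n f = (\<Prod>i<n. f i i)"
  unfolding fdet_def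
  by (subst det_upper_triangular) (use assms in \<open>auto simp: prod_list_diag_prod lessThan_atLeast0 upper_triangular_def\<close>)

lemma fdet_lower:
  assumes "\<And>i j. i < j \<Longrightarrow> j < n \<Longrightarrow> f i j = 0"
  shows "fdet n f = (\<Prod>i<n. f i i)"
  using fdet_upper[of n "\<lambda>i j. f j i"] assms fdet_transpose[of n f] by simp

lemma fdet_leibniz:
  "fdet n f = (\<Sum>p | p permutes {..<n}. of_int (sign p) * (\<Prod>i<n. f i (p i)))"
proof -
  have "fdet n f = (\<Sum>p | p permutes {0..<n}. of_int (sign p) * (\<Prod>i=0..<n. mat n n (\<lambda>(i, j). f i j) $$ (i, p i)))"
    unfolding fdet_def by (rule det_def') simp
  also have "\<dots> = (\<Sum>p | p permutes {0..<n}. of_int (sign p) * (\<Prod>i=0..<n. f i (p i)))"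
    by (intro sum.cong prod.cong refl arg_cong2[of _ _ _ _ "(*)"]) (auto dest: permutes_in_image)
  finally show ?thesis by (simp add: lessThan_atLeast0)
qed

lemma fdet_scale: "fdet n (\<lambda>i j. r i * s j * f i j) = (\<Prod>i<n. r i) * (\<Prod>j<n. s j) * fdet n f"
proof -
  have *: "of_int (sign p) * (\<Prod>i<n. r i * s (p i) * f i (p i)) =
      (\<Prod>i<n. r i) * (\<Prod>j<n. s j) * (of_int (sign p) * (\<Prod>i<n. f i (p i)))" if "p permutes {..<n}" for p
    using prod.permute[OF that, of s] by (simp add: prod.distrib o_def)
  show ?thesis
    unfolding fdet_leibniz sum_distrib_left by (rule sum.cong) (use * in auto)
qed

text \<open>Multilinearity in the rows: expanding selects one summand from each row. Read backwards,
  it turns a sum over positions chosen one from each gap into a single determinant.\<close>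

lemma fdet_sum_rows:
  assumes "\<And>i. i < n \<Longrightarrow> finite (X i)"
  shows "fdet n (\<lambda>i j. \<Sum>v\<in>X i. g i v j) = (\<Sum>v\<in>PiE {..<n} X. fdet n (\<lambda>i j. g i (v i) j))"
proof -
  have "fdet n (\<lambda>i j. \<Sum>v\<in>X i. g i v j) =
     (\<Sum>p | p permutes {..<n}. \<Sum>v\<in>PiE {..<n} X. of_int (sign p) * (\<Prod>i<n. g i (v i) (p i)))"
    unfolding fdet_leibniz sum_distrib_left[symmetric]
    by (intro sum.cong refl arg_cong2[of _ _ _ _ "(*)"] prod_sum_PiE) (use assms in auto)
  also have "\<dots> = (\<Sum>v\<in>PiE {..<n} X. fdet n (\<lambda>i j. g i (v i) j))"
    unfolding fdet_leibniz by (rule sum.swap)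
  finally show ?thesis .
qed

lemma fdet_permute_rows:
  assumes "p permutes {..<n}"
  shows "fdet n (\<lambda>i j. f (p i) j) = of_int (sign p) * fdet n f"
proof -
  have p: "p permutes {0..<n}" using assms by (simp add: lessThan_atLeast0)
  have "mat n n (\<lambda>(i, j). f (p i) j) = mat n n (\<lambda>(i, j). mat n n (\<lambda>(i, j). f i j) $$ (p i, j))"
    by (rule eq_matI) (use permutes_in_image[OF p] in auto)
  then show ?thesis
    unfolding fdet_def using det_permute_rows[OF mat_carrier p, of "\<lambda>(i, j). f i j"] by simp
qed

text \<open>\<open>B\<close> is recovered from its row differences by partial sums, that is, by a
  unitriangular matrix of ones. The telescoping gap sums produce exactly such differences.\<close>

lemma fdet_cumulative:
  "fdet n (\<lambda>i j. B i j - (if i = 0 then 0 else B (i - 1) j)) = fdet n B"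
proof -
  define A where "A = (\<lambda>i j. B i j - (if i = 0 then 0 else B (i - 1) j))"
  have tele: "(\<Sum>k\<le>i. A k j) = B i j" for i j
    by (induction i) (auto simp: A_def)
  have "fdet n B = fdet n (\<lambda>i j. \<Sum>k<n. (if k \<le> i then 1 else 0) * A k j)"
  proof (rule fdet_cong)
    fix i j assume "i < n" "j < n"
    have "(\<Sum>k<n. (if k \<le> i then 1 else 0) * A k j) = (\<Sum>k\<le>i. A k j)"
      using \<open>i < n\<close> by (intro sum.mono_neutral_cong_right) auto
    then show "B i j = (\<Sum>k<n. (if k \<le> i then 1 else 0) * A k j)" by (simp add: tele)
  qed
  also have "\<dots> = fdet n (\<lambda>i k. if k \<le> i then 1 else 0) * fdet n A" by (rule fdet_mult)
  also have "fdet n (\<lambda>i k. if k \<le> i then 1 else 0) = 1"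
    by (subst fdet_lower) auto
  finally show ?thesis by (simp add: A_def)
qed

section \<open>Newton bases and Vandermonde determinants\<close>

definition newton :: "(nat \<Rightarrow> real) \<Rightarrow> nat \<Rightarrow> real poly" where
  "newton r n = (\<Prod>k<n. [:- r k, 1:])"

lemma poly_newton: "poly (newton r n) t = (\<Prod>k<n. t - r k)"
  by (simp add: newton_def poly_prod)

lemma degree_newton: "degree (newton r n) = n"
  unfolding newton_def by (subst degree_prod_eq_sum_degree) auto

lemma monic_newton: "lead_coeff (newton r n) = 1"
  unfolding newton_def by (simp add: lead_coeff_prod)

lemma coeff_newton: "coeff (newton r n) n = 1"
  using monic_newton[of r n] by (simp add: degree_newton)

text \<open>Subtracting the top coefficient times the monic \<open>newton r n\<close> lowers the
  bound. The bound is put on coefficients instead of the degree so that \<open>n = 0\<close> forces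
  the zero polynomial.\<close>

lemma newton_expansion:
  assumes "\<And>i. n \<le> i \<Longrightarrow> coeff p i = 0"
  shows "\<exists>u. \<forall>t. poly p t = (\<Sum>k<n. u k * poly (newton r k) t)"
  using assms
proof (induction n arbitrary: p)
  case 0
  then have "p = 0" by (auto intro: poly_eqI)
  then show ?case by simp
next
  case (Suc n)
  define q where "q = p - smult (coeff p n) (newton r n)"
  have "coeff q i = 0" if "n \<le> i" for i
    using that Suc.prems[of i] degree_newton[of r n] monic_newton[of r n]
      coeff_eq_0[of "newton r n" i]
    by (cases "i = n") (auto simp: q_def)
  then obtain u where u: "\<And>t. poly q t = (\<Sum>k<n. u k * poly (newton r k) t)"
    using Suc.IH by blast
  have "poly p t = (\<Sum>k<Suc n. (u(n := coeff p n)) k * poly (newton r k) t)" for t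
    using u[of t] by (simp add: q_def algebra_simps)
  then show ?case by blast
qed

text \<open>In the Newton basis whose nodes are the points \<open>x\<close> themselves the
  evaluation matrix is lower triangular, and the passage from that basis to any other monic one of
  the same degrees is unitriangular.\<close>

lemma vandermonde_poly:
  assumes "\<And>j. j < n \<Longrightarrow> degree (h j) = j" "\<And>j. j < n \<Longrightarrow> lead_coeff (h j) = 1"
  shows "fdet n (\<lambda>i j. poly (h j) (x i)) = (\<Prod>j<n. \<Prod>i<j. x j - x i)"
proof -
  have "\<exists>u. \<forall>t. poly (h j) t - poly (newton x j) t = (\<Sum>k<j. u k * poly (newton x k) t)" if "j < n" for j
  proof -
    have "coeff (h j - newton x j) i = 0" if "j \<le> i" for i
      using that assms[OF \<open>j < n\<close>] degree_newton[of x j] monic_newton[of x j]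
        coeff_eq_0[of "newton x j" i] coeff_eq_0[of "h j" i]
      by (cases "i = j") auto
    from newton_expansion[OF this, where r = x] show ?thesis by simp
  qed
  then obtain u where u: "\<And>j t. j < n \<Longrightarrow> poly (h j) t - poly (newton x j) t = (\<Sum>k<j. u j k * poly (newton x k) t)"
    by metis
  define U where "U = (\<lambda>k j. if k < j then u j k else if k = j then 1 else 0)"
  have "fdet n (\<lambda>i j. poly (h j) (x i)) = fdet n (\<lambda>i j. \<Sum>k<n. poly (newton x k) (x i) * U k j)"
  proof (rule fdet_cong)
    fix i j assume "i < n" "j < n"
    have "(\<Sum>k<n. poly (newton x k) (x i) * U k j) = (\<Sum>k<Suc j. poly (newton x k) (x i) * U k j)"
      using \<open>j < n\<close> by (intro sum.mono_neutral_right) (auto simp: U_def)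
    also have "\<dots> = poly (h j) (x i)"
      using u[OF \<open>j < n\<close>, of "x i"] by (simp add: U_def algebra_simps)
    finally show "poly (h j) (x i) = (\<Sum>k<n. poly (newton x k) (x i) * U k j)" by simp
  qed
  also have "\<dots> = fdet n (\<lambda>i k. poly (newton x k) (x i)) * fdet n U" by (rule fdet_mult)
  also have "fdet n U = 1" by (subst fdet_upper) (auto simp: U_def)
  also have "fdet n (\<lambda>i k. poly (newton x k) (x i)) = (\<Prod>j<n. \<Prod>i<j. x j - x i)"
    by (subst fdet_lower) (auto simp: poly_newton)
  finally show ?thesis by simp
qed

section \<open>Interlacing sums\<close>

text \<open>Central factorials with nodes at the odd and at the even integers.  Symmetric differences
  exchange the two kinds, which makes the sums over interlacing positions telescope.\<close>

definition phi :: "nat \<Rightarrow> real \<Rightarrow> real" where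
  "phi n c = (\<Prod>k<n. c\<^sup>2 - (2 * real k + 1)\<^sup>2)"

definition psi :: "nat \<Rightarrow> real \<Rightarrow> real" where
  "psi n c = (\<Prod>k<n. c\<^sup>2 - (2 * real k)\<^sup>2)"

lemma phi_poly: "phi n c = poly (newton (\<lambda>k. (2 * real k + 1)\<^sup>2) n) (c\<^sup>2)"
  by (simp add: phi_def poly_newton)

lemma psi_poly: "psi n c = poly (newton (\<lambda>k. (2 * real k)\<^sup>2) n) (c\<^sup>2)"
  by (simp add: psi_def poly_newton)

text \<open>In linear factors, the shift by 1 carries the even nodes to odd ones; all factors on the
  left reappear in \<open>phi n c\<close> except two at the ends.\<close>

lemma psi_plus: "psi (Suc n) (c + 1) = (c + 1) * (c + 1 + 2 * real n) * phi n c"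
  by (induction n) (auto simp: psi_def phi_def power2_eq_square algebra_simps)

lemma phi_minus: "phi n (- c) = phi n c" and psi_minus: "psi n (- c) = psi n c"
  by (simp_all add: phi_def psi_def)

lemma psi_diff: "psi (Suc n) (c + 1) - psi (Suc n) (c - 1) = 4 * (real n + 1) * c * phi n c"
proof -
  have "psi (Suc n) (c - 1) = psi (Suc n) (- c + 1)" using psi_minus[of "Suc n" "c - 1"] by simp
  also have "\<dots> = (- c + 1) * (- c + 1 + 2 * real n) * phi n c"
    unfolding psi_plus phi_minus ..
  finally show ?thesis unfolding psi_plus by (simp add: algebra_simps)
qed

lemma phi_plus: "c * phi n (c + 1) = (c + 2 * real n) * psi n c"
proof (induction n)
  case (Suc n)
  have "c * phi (Suc n) (c + 1) = (c * phi n (c + 1)) * ((c + 1)\<^sup>2 - (2 * real n + 1)\<^sup>2)"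
    by (simp add: phi_def)
  also have "\<dots> = (c + 2 * real n) * psi n c * ((c + 1)\<^sup>2 - (2 * real n + 1)\<^sup>2)" by (simp only: Suc)
  also have "\<dots> = (c + 2 * real (Suc n)) * psi (Suc n) c"
    by (simp add: psi_def power2_eq_square algebra_simps)
  finally show ?case .
qed (simp add: phi_def psi_def)

lemma phi_diff:
  "(c + 1) * phi n (c + 1) - (c - 1) * phi n (c - 1) = 2 * (2 * real n + 1) * psi n c"
\<comment> \<open>The argument for the other case cancels a factor \<open>c\<close>.\<close>
proof (cases "c = 0")
  case True
  have zero: "phi n 1 = 0" "psi n 0 = 0" if "n \<noteq> 0"
    using that by (cases n; simp add: phi_def psi_def prod.lessThan_Suc_shift del: prod.lessThan_Suc)+
  show ?thesis
  proof (cases "n = 0")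
    case False
    then show ?thesis using zero True phi_minus[of n 1] by simp
  qed (simp add: phi_def psi_def)
next
  case False
  have 1: "c * phi n (c - 1) = (c - 2 * real n) * psi n c"
    using phi_plus[of "- c" n] phi_minus[of n "c - 1"] psi_minus[of n c] by (simp add: algebra_simps)
  have "c * ((c + 1) * phi n (c + 1) - (c - 1) * phi n (c - 1)) =
      (c + 1) * (c * phi n (c + 1)) - (c - 1) * (c * phi n (c - 1))" by (simp add: algebra_simps)
  also have "\<dots> = c * (2 * (2 * real n + 1) * psi n c)"
    unfolding phi_plus 1 by (simp add: algebra_simps)
  finally show ?thesis using False by simp
qed

text \<open>The vertical bricks above and below a row occupy columns of opposite parity, hence
  \<open>odd (c - p)\<close> for positions between two dents.\<close>

definition gap :: "int \<Rightarrow> int \<Rightarrow> int set" where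
  "gap p q = {c. p < c \<and> c < q \<and> odd (c - p)}"

lemma finite_gap [simp]: "finite (gap p q)"
  by (rule finite_subset[of _ "{p..q}"]) (auto simp: gap_def)

lemma gap_Suc: "gap p (p + 2 * int (Suc n)) = insert (p + 2 * int n + 1) (gap p (p + 2 * int n))"
  by (auto simp: gap_def) presburger+

lemma sum_gap_telescope:
  fixes F :: "real \<Rightarrow> real"
  assumes "p \<le> q" "even (q - p)"
  shows "(\<Sum>c\<in>gap p q. F (real_of_int c + 1) - F (real_of_int c - 1)) = F (real_of_int q) - F (real_of_int p)"
proof -
  define n where "n = nat ((q - p) div 2)"
  have "q = p + 2 * int n" using assms by (simp add: n_def)
  moreover have "(\<Sum>c\<in>gap p (p + 2 * int n). F (real_of_int c + 1) - F (real_of_int c - 1)) =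
      F (real_of_int (p + 2 * int n)) - F (real_of_int p)"
  proof (induction n)
    case 0
    have "gap p p = {}" by (auto simp: gap_def)
    then show ?case by simp
  next
    case (Suc n)
    have "p + 2 * int n + 1 \<notin> gap p (p + 2 * int n)" by (simp add: gap_def)
    then show ?case unfolding gap_Suc using Suc by (simp add: algebra_simps)
  qed
  ultimately show ?thesis by simp
qed

definition vander_fun :: "nat \<Rightarrow> (nat \<Rightarrow> int) \<Rightarrow> real" where
  "vander_fun n d = (\<Prod>j<n. \<Prod>i<j. (real_of_int (d j))\<^sup>2 - (real_of_int (d i))\<^sup>2)"

lemma vander_fun_fdet_newton: "fdet n (\<lambda>i j. poly (newton r j) ((real_of_int (d i))\<^sup>2)) = vander_fun n d"
  unfolding vander_fun_def by (rule vandermonde_poly) (auto simp: degree_newton coeff_newton)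

lemma vander_fun_fdet_newton':
  "fdet n (\<lambda>i j. a i * poly (newton r j) ((real_of_int (d i))\<^sup>2)) = (\<Prod>i<n. a i) * vander_fun n d"
  using fdet_scale[of n a "\<lambda>_. 1" "\<lambda>i j. poly (newton r j) ((real_of_int (d i))\<^sup>2)"]
  by (simp add: vander_fun_fdet_newton)

lemma vander_fun_Suc_shift:
  "vander_fun (Suc n) d = (\<Prod>i<n. (real_of_int (d (Suc i)))\<^sup>2 - (real_of_int (d 0))\<^sup>2) * vander_fun n (\<lambda>i. d (Suc i))"
  unfolding vander_fun_def prod.lessThan_Suc_shift by (simp add: prod.distrib)

text \<open>Expanding the Vandermonde product in the basis \<open>phi\<close> makes every entry
  \<open>c * phi j c\<close> a difference of values of \<open>psi (Suc j)\<close>, by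
  \<open>psi_diff\<close>. The gap sums telescope to row differences, and the \<open>n + 1\<close>
  end points reassemble to a Vandermonde product of size \<open>n + 1\<close>.\<close>

lemma interlace_sum_between:
  fixes d :: "nat \<Rightarrow> int"
  assumes "\<And>j. j < n \<Longrightarrow> d j < d (Suc j)" "\<And>j. j < n \<Longrightarrow> even (d (Suc j) - d j)"
  shows "(\<Sum>v\<in>PiE {..<n} (\<lambda>j. gap (d j) (d (Suc j))). (\<Prod>j<n. real_of_int (v j)) * vander_fun n v) =
    vander_fun (Suc n) d / (\<Prod>j<n. 4 * (real j + 1))"
proof -
  let ?r = "\<lambda>k. (2 * real k + 1)\<^sup>2" and ?s = "\<lambda>k. (2 * real k)\<^sup>2"
  \<comment> \<open>Subtracting the value at \<open>d 0\<close> makes the first row of differences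
    fit the pattern of \<open>fdet_cumulative\<close>.\<close>
  define B where "B = (\<lambda>i j. psi (Suc j) (real_of_int (d (Suc i))) - psi (Suc j) (real_of_int (d 0)))"
  have "(\<Sum>v\<in>PiE {..<n} (\<lambda>j. gap (d j) (d (Suc j))). (\<Prod>j<n. real_of_int (v j)) * vander_fun n v) =
      (\<Sum>v\<in>PiE {..<n} (\<lambda>j. gap (d j) (d (Suc j))). fdet n (\<lambda>i j. real_of_int (v i) * phi j (real_of_int (v i))))"
    by (simp add: phi_poly vander_fun_fdet_newton')
  also have "\<dots> = fdet n (\<lambda>i j. \<Sum>c\<in>gap (d i) (d (Suc i)). real_of_int c * phi j (real_of_int c))"
    by (rule fdet_sum_rows[symmetric]) simp
  also have "\<dots> = fdet n (\<lambda>i j. 1 * (1 / (4 * (real j + 1))) * (B i j - (if i = 0 then 0 else B (i - 1) j)))"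
  proof (rule fdet_cong)
    fix i j assume ij: "i < n" "j < n"
    have "4 * (real j + 1) * (\<Sum>c\<in>gap (d i) (d (Suc i)). real_of_int c * phi j (real_of_int c)) =
        (\<Sum>c\<in>gap (d i) (d (Suc i)). psi (Suc j) (real_of_int c + 1) - psi (Suc j) (real_of_int c - 1))"
      by (simp add: psi_diff sum_distrib_left mult_ac)
    also have "\<dots> = psi (Suc j) (real_of_int (d (Suc i))) - psi (Suc j) (real_of_int (d i))"
      by (rule sum_gap_telescope) (use assms[OF ij(1)] in auto)
    also have "\<dots> = B i j - (if i = 0 then 0 else B (i - 1) j)"
      by (auto simp: B_def)
    finally show "(\<Sum>c\<in>gap (d i) (d (Suc i)). real_of_int c * phi j (real_of_int c)) =
        1 * (1 / (4 * (real j + 1))) * (B i j - (if i = 0 then 0 else B (i - 1) j))"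
      by (simp add: field_simps)
  qed
  also have "\<dots> = (\<Prod>j<n. 1 / (4 * (real j + 1))) * fdet n B"
    unfolding fdet_scale fdet_cumulative by simp
  also have "fdet n B = vander_fun (Suc n) d"
  proof -
    define y where "y = (\<lambda>i. (real_of_int (d i))\<^sup>2)"
    \<comment> \<open>Each column of \<open>B\<close> is divisible by the difference to
      \<open>y 0\<close>. The quotients are again monic of degree \<open>j\<close>, while the
      split-off factors are the pairs of \<open>d 0\<close> with the other end points.\<close>
    define h where "h = (\<lambda>j. synthetic_div (newton ?s (Suc j)) (y 0))"
    have h: "newton ?s (Suc j) = [:- y 0, 1:] * h j + [:poly (newton ?s (Suc j)) (y 0):]" for j
      unfolding h_def by (rule synthetic_div_correct'[symmetric])
    have deg: "degree (h j) = j" for j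
      by (simp add: h_def degree_synthetic_div degree_newton)
    have lead: "coeff (h j) j = 1" for j
    proof -
      have "coeff (newton ?s (Suc j)) (Suc j) = coeff ([:- y 0, 1:] * h j) (Suc j)"
        by (subst h) simp
      also have "\<dots> = coeff (h j) j" using coeff_eq_0[of "h j" "Suc j"] deg[of j] by simp
      finally show ?thesis by (simp add: coeff_newton)
    qed
    have "B i j = (y (Suc i) - y 0) * 1 * poly (h j) (y (Suc i))" for i j
    proof -
      have "poly (newton ?s (Suc j)) t = (t - y 0) * poly (h j) t + poly (newton ?s (Suc j)) (y 0)" for t
        using arg_cong[OF h[of j], of "\<lambda>p. poly p t"] by (simp add: algebra_simps)
      from this[of "y (Suc i)"] have "poly (newton ?s (Suc j)) (y (Suc i)) - poly (newton ?s (Suc j)) (y 0) =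
          (y (Suc i) - y 0) * poly (h j) (y (Suc i))" by linarith
      moreover have "psi (Suc j) (real_of_int (d i)) = poly (newton ?s (Suc j)) (y i)" for i
        unfolding psi_poly y_def ..
      ultimately show ?thesis by (simp add: B_def)
    qed
    then have "fdet n B = fdet n (\<lambda>i j. (y (Suc i) - y 0) * 1 * poly (h j) (y (Suc i)))"
      by (intro fdet_cong)
    also have "\<dots> = (\<Prod>i<n. y (Suc i) - y 0) * (\<Prod>j<n. 1) * fdet n (\<lambda>i j. poly (h j) (y (Suc i)))"
      by (rule fdet_scale)
    also have "fdet n (\<lambda>i j. poly (h j) (y (Suc i))) = vander_fun n (\<lambda>i. d (Suc i))"
      unfolding vander_fun_def by (subst vandermonde_poly) (auto simp: deg lead y_def)
    finally show ?thesis by (simp add: vander_fun_Suc_shift y_def)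
  qed
  finally show ?thesis by (simp add: prod_dividef)
qed

text \<open>Here \<open>d 0\<close> is no dent but the western end of the row.  The weight \<open>\<omega>\<close> accounts for
  column \<open>0\<close>, and \<open>first\<close> says that the sum over the westernmost gap telescopes all the same.\<close>

lemma interlace_sum_below:
  fixes d :: "nat \<Rightarrow> int" and \<omega> :: "int \<Rightarrow> real"
  assumes d: "\<And>j. j < n \<Longrightarrow> d j < d (Suc j)" "\<And>j. j < n \<Longrightarrow> even (d (Suc j) - d j)"
    and \<omega>: "\<And>c. n \<noteq> 0 \<Longrightarrow> d 1 < c \<Longrightarrow> \<omega> c = 1"
    and first: "\<And>j. n \<noteq> 0 \<Longrightarrow> 2 * (2 * real j + 1) * (\<Sum>c\<in>gap (d 0) (d 1). \<omega> c * psi j (real_of_int c)) =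
       real_of_int (d 1) * phi j (real_of_int (d 1))"
  shows "(\<Sum>v\<in>PiE {..<n} (\<lambda>j. gap (d j) (d (Suc j))). (\<Prod>j<n. \<omega> (v j)) * vander_fun n v) =
    (\<Prod>j<n. real_of_int (d (Suc j))) * vander_fun n (\<lambda>j. d (Suc j)) / (\<Prod>j<n. 2 * (2 * real j + 1))"
proof -
  define B where "B = (\<lambda>i j. real_of_int (d (Suc i)) * phi j (real_of_int (d (Suc i))))"
  have "(\<Sum>v\<in>PiE {..<n} (\<lambda>j. gap (d j) (d (Suc j))). (\<Prod>j<n. \<omega> (v j)) * vander_fun n v) =
      (\<Sum>v\<in>PiE {..<n} (\<lambda>j. gap (d j) (d (Suc j))). fdet n (\<lambda>i j. \<omega> (v i) * psi j (real_of_int (v i))))"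
    by (simp add: psi_poly vander_fun_fdet_newton')
  also have "\<dots> = fdet n (\<lambda>i j. \<Sum>c\<in>gap (d i) (d (Suc i)). \<omega> c * psi j (real_of_int c))"
    by (rule fdet_sum_rows[symmetric]) simp
  also have "\<dots> = fdet n (\<lambda>i j. 1 * (1 / (2 * (2 * real j + 1))) * (B i j - (if i = 0 then 0 else B (i - 1) j)))"
  proof (rule fdet_cong)
    fix i j assume ij: "i < n" "j < n"
    have "2 * (2 * real j + 1) * (\<Sum>c\<in>gap (d i) (d (Suc i)). \<omega> c * psi j (real_of_int c)) =
      B i j - (if i = 0 then 0 else B (i - 1) j)"
    \<comment> \<open>Row 0 has nothing to subtract: \<open>first\<close> gives the sum over the
      westernmost gap already without a term from its western end.\<close>
    proof (cases "i = 0")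
      case True
      then show ?thesis using first[of j] ij by (simp add: B_def)
    next
      case False
      have "d 1 \<le> d i"
        using chain_le[of n d 1 i] ij False d(1) by auto
      then have "(\<Sum>c\<in>gap (d i) (d (Suc i)). \<omega> c * psi j (real_of_int c)) =
          (\<Sum>c\<in>gap (d i) (d (Suc i)). psi j (real_of_int c))"
        using \<omega> ij by (intro sum.cong) (auto simp: gap_def)
      then have "2 * (2 * real j + 1) * (\<Sum>c\<in>gap (d i) (d (Suc i)). \<omega> c * psi j (real_of_int c)) =
         (\<Sum>c\<in>gap (d i) (d (Suc i)). (real_of_int c + 1) * phi j (real_of_int c + 1)
            - (real_of_int c - 1) * phi j (real_of_int c - 1))"
        by (simp add: phi_diff sum_distrib_left)
      also have "\<dots> = real_of_int (d (Suc i)) * phi j (real_of_int (d (Suc i))) - real_of_int (d i) * phi j (real_of_int (d i))"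
        by (rule sum_gap_telescope[where F = "\<lambda>c. c * phi j c"]) (use d ij in \<open>auto intro: less_imp_le\<close>)
      finally show ?thesis using False by (simp add: B_def)
    qed
    then show "(\<Sum>c\<in>gap (d i) (d (Suc i)). \<omega> c * psi j (real_of_int c)) =
        1 * (1 / (2 * (2 * real j + 1))) * (B i j - (if i = 0 then 0 else B (i - 1) j))"
      by (simp add: field_simps)
  qed
  also have "\<dots> = (\<Prod>j<n. 1 / (2 * (2 * real j + 1))) * fdet n B"
    unfolding fdet_scale fdet_cumulative by simp
  also have "fdet n B = (\<Prod>j<n. real_of_int (d (Suc j))) * vander_fun n (\<lambda>j. d (Suc j))"
    unfolding B_def phi_poly by (rule vander_fun_fdet_newton')
  finally show ?thesis by (simp add: prod_dividef)
qed

section \<open>Vandermonde products of sets and Andreief's identity\<close>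

definition vander :: "int set \<Rightarrow> real" where
  "vander S = (\<Prod>(p, q)\<in>{(p, q). p \<in> S \<and> q \<in> S \<and> p < q}. (real_of_int q)\<^sup>2 - (real_of_int p)\<^sup>2)"

lemma sorted_enumeration:
  assumes "finite (S :: int set)" "card S = n"
  obtains d where "\<And>i j. i < j \<Longrightarrow> j < n \<Longrightarrow> d i < d j" "d ` {..<n} = S"
proof
  let ?d = "\<lambda>i. sorted_list_of_set S ! i"
  show "?d i < ?d j" if "i < j" "j < n" for i j
    using strict_sorted_list_of_set[of S] that assms by (simp add: sorted_wrt_iff_nth_less)
  show "?d ` {..<n} = S"
    using assms by (metis length_sorted_list_of_set nth_image lessThan_atLeast0 order_refl set_sorted_list_of_set take_all)
qed

lemma enumeration_inj:
  fixes d :: "nat \<Rightarrow> 'a::linorder"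
  assumes "\<And>i j. i < j \<Longrightarrow> j < n \<Longrightarrow> d i < d j"
  shows "inj_on d {..<n}"
  by (rule linorder_inj_onI) (use assms in force)+

lemma vander_enumeration:
  assumes d: "\<And>i j. i < j \<Longrightarrow> j < n \<Longrightarrow> d i < d j"
  shows "vander (d ` {..<n}) = vander_fun n d"
proof -
  have lt: "i < j" if "d i < d j" "i < n" "j < n" for i j
    using d[of j i] that by (cases i j rule: linorder_cases) auto
  have eqi: "i = j" if "d i = d j" "i < n" "j < n" for i j
    using d[of j i] d[of i j] that by (cases i j rule: linorder_cases) auto
  have "vander_fun n d = (\<Prod>(j, i)\<in>Sigma {..<n} (\<lambda>j. {..<j}). (real_of_int (d j))\<^sup>2 - (real_of_int (d i))\<^sup>2)"
    unfolding vander_fun_def by (subst prod.Sigma) auto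
  also have "\<dots> = vander (d ` {..<n})"
  proof -
    have "bij_betw (\<lambda>(j, i). (d i, d j)) (Sigma {..<n} (\<lambda>j. {..<j}))
        {(p, q). p \<in> d ` {..<n} \<and> q \<in> d ` {..<n} \<and> p < q}"
      unfolding bij_betw_def
    proof
      show "inj_on (\<lambda>(j, i). (d i, d j)) (Sigma {..<n} (\<lambda>j. {..<j}))"
        using eqi by (auto simp: inj_on_def)
      show "(\<lambda>(j, i). (d i, d j)) ` Sigma {..<n} (\<lambda>j. {..<j}) = {(p, q). p \<in> d ` {..<n} \<and> q \<in> d ` {..<n} \<and> p < q}"
        using lt d by (auto simp: image_iff Bex_def) (metis order.strict_trans)+
    qed
    from prod.reindex_bij_betw[OF this, of "\<lambda>(p, q). (real_of_int q)\<^sup>2 - (real_of_int p)\<^sup>2"]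
    show ?thesis by (simp add: vander_def split_def)
  qed
  finally show ?thesis ..
qed

text \<open>Each of the two Vandermonde factors may be expanded in a basis of its own. This freedom
  is what the Selberg sum needs, where one basis is adapted to each end of the weight.\<close>

lemma andreief:
  fixes X :: "int set" and w :: "int \<Rightarrow> real" and P Q :: "nat \<Rightarrow> int \<Rightarrow> real"
  assumes X: "finite X"
    and P: "\<And>f. fdet n (\<lambda>i j. P j (f i)) = vander_fun n f"
    and Q: "\<And>f. fdet n (\<lambda>i j. Q j (f i)) = vander_fun n f"
  shows "(\<Sum>S | S \<subseteq> X \<and> card S = n. (vander S)\<^sup>2 * (\<Prod>s\<in>S. w s)) = fdet n (\<lambda>i j. \<Sum>s\<in>X. w s * P i s * Q j s)"
proof -
  define F where "F = PiE {..<n} (\<lambda>_. X)"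
  define G where "G = {f \<in> F. inj_on f {..<n}}"
  \<comment> \<open>One Vandermonde factor is kept whole. The other is present only through a
    diagonal product and becomes a determinant when the orderings of one set are summed with their
    signs.\<close>
  define g where "g = (\<lambda>f. (\<Prod>i<n. w (f i) * P i (f i)) * vander_fun n f)"
  have finF: "finite F" unfolding F_def using X by (intro finite_PiE) auto
  have finG: "finite G" unfolding G_def using finF by simp
  have "fdet n (\<lambda>i j. \<Sum>s\<in>X. w s * P i s * Q j s) = (\<Sum>f\<in>F. fdet n (\<lambda>i j. w (f i) * P i (f i) * Q j (f i)))"
    unfolding F_def by (rule fdet_sum_rows) (use X in auto)
  also have "\<dots> = sum g F"
  proof (rule sum.cong[OF refl])
    fix f
    have "fdet n (\<lambda>i j. w (f i) * P i (f i) * Q j (f i)) = fdet n (\<lambda>i j. (w (f i) * P i (f i)) * 1 * Q j (f i))" by simp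
    also have "\<dots> = (\<Prod>i<n. w (f i) * P i (f i)) * (\<Prod>j<n. 1) * fdet n (\<lambda>i j. Q j (f i))"
      by (rule fdet_scale)
    finally show "fdet n (\<lambda>i j. w (f i) * P i (f i) * Q j (f i)) = g f" by (simp add: Q g_def)
  qed
  also have "\<dots> = sum g G"
  proof (rule sum.mono_neutral_right[OF finF])
    show "\<forall>f\<in>F - G. g f = 0"
    proof
      fix f assume "f \<in> F - G"
      then have "\<not> inj_on f {..<n}" by (simp add: G_def)
      then obtain i j where "i < j" "j < n" "f i = f j"
        unfolding inj_on_def by (metis lessThan_iff linorder_neqE_nat)
      then have z: "(\<Prod>i<j. (real_of_int (f j))\<^sup>2 - (real_of_int (f i))\<^sup>2) = 0"
        using \<open>i < j\<close> \<open>f i = f j\<close> by (intro prod_zero bexI[of _ i]) auto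
      have "vander_fun n f = 0" unfolding vander_fun_def using \<open>j < n\<close> by (intro prod_zero bexI[of _ j] z) auto
      then show "g f = 0" by (simp add: g_def)
    qed
  qed (auto simp: G_def)
  also have "\<dots> = (\<Sum>S | S \<subseteq> X \<and> card S = n. sum g {f \<in> G. f ` {..<n} = S})"
  proof (rule sum.group[symmetric])
    show "(\<lambda>f. f ` {..<n}) ` G \<subseteq> {S. S \<subseteq> X \<and> card S = n}"
    proof
      fix S assume "S \<in> (\<lambda>f. f ` {..<n}) ` G"
      then obtain f where f: "S = f ` {..<n}" "f \<in> PiE {..<n} (\<lambda>_. X)" "inj_on f {..<n}"
        by (auto simp: G_def F_def)
      then show "S \<in> {S. S \<subseteq> X \<and> card S = n}"
        using card_image[OF f(3)] PiE_mem[OF f(2)] by auto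
    qed
  qed (use X finG in auto)
  also have "\<dots> = (\<Sum>S | S \<subseteq> X \<and> card S = n. (vander S)\<^sup>2 * (\<Prod>s\<in>S. w s))"
  proof (rule sum.cong[OF refl])
    fix S assume "S \<in> {S. S \<subseteq> X \<and> card S = n}"
    then have S: "S \<subseteq> X" "card S = n" "finite S" using X finite_subset by auto
    then obtain e where e: "\<And>i j. i < j \<Longrightarrow> j < n \<Longrightarrow> e i < e j" "e ` {..<n} = S"
      using sorted_enumeration by metis
    have inj: "inj_on e {..<n}" using enumeration_inj e(1) by blast
    have bij: "bij_betw e {..<n} S" using inj e(2) by (simp add: bij_betw_def)
    \<comment> \<open>The injections with image \<open>S\<close> are the rearrangements of its
      increasing enumeration \<open>e\<close>; a permutation is recovered by inverting
      \<open>e\<close> and fixing all indices from \<open>n\<close> on.\<close>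
    have "sum g {f \<in> G. f ` {..<n} = S} = (\<Sum>p | p permutes {..<n}. g (restrict (e \<circ> p) {..<n}))"
    proof (rule sum.reindex_bij_witness[where j = "\<lambda>f i. if i < n then inv_into {..<n} e (f i) else i"
          and i = "\<lambda>p. restrict (e \<circ> p) {..<n}"])
      fix f assume "f \<in> {f \<in> G. f ` {..<n} = S}"
      then have f: "f \<in> extensional {..<n}" "inj_on f {..<n}" "f ` {..<n} = S"
        by (auto simp: G_def F_def PiE_def)
      let ?p = "\<lambda>i. if i < n then inv_into {..<n} e (f i) else i"
      have fb: "bij_betw f {..<n} S" using f by (simp add: bij_betw_def)
      have "bij_betw (inv_into {..<n} e \<circ> f) {..<n} {..<n}"
        using bij_betw_trans[OF fb bij_betw_inv_into[OF bij]] .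
      then have "bij_betw ?p {..<n} {..<n}" by (rule bij_betw_cong[THEN iffD1, rotated]) auto
      then have "?p permutes {..<n}" by (rule bij_imp_permutes) simp
      then show "?p \<in> {p. p permutes {..<n}}" by simp
      have "e (?p i) = f i" if "i < n" for i
        using that bij f(3) by (auto simp: bij_betw_def intro!: f_inv_into_f)
      then show "restrict (e \<circ> ?p) {..<n} = f"
        using f(1) by (auto simp: restrict_def extensional_def fun_eq_iff)
      then show "g (restrict (e \<circ> ?p) {..<n}) = g f" by simp
    next
      fix p assume "p \<in> {p. p permutes {..<n}}"
      then have p: "p permutes {..<n}" by simp
      have pi: "p ` {..<n} = {..<n}" "inj_on p {..<n}"
        using permutes_image[OF p] permutes_inj_on[OF p] by auto
      have lt: "p i < n" if "i < n" for i using pi(1) that by blast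
      have "inj_on (e \<circ> p) {..<n}" using comp_inj_on[OF pi(2), of e] inj pi(1) by simp
      moreover have "(e \<circ> p) ` {..<n} = S" unfolding image_comp[symmetric] pi(1) e(2) ..
      ultimately show "restrict (e \<circ> p) {..<n} \<in> {f \<in> G. f ` {..<n} = S}"
        using S(1) by (auto simp: G_def F_def inj_on_def)
      show "(\<lambda>i. if i < n then inv_into {..<n} e (restrict (e \<circ> p) {..<n} i) else i) = p"
        using inj lt permutes_not_in[OF p] by (auto simp: fun_eq_iff inv_into_f_f)
    qed
    also have "\<dots> = (\<Sum>p | p permutes {..<n}. (\<Prod>s\<in>S. w s) * vander_fun n e * (of_int (sign p) * (\<Prod>i<n. P i (e (p i)))))"
    proof (rule sum.cong[OF refl])
      fix p assume "p \<in> {p. p permutes {..<n}}"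
      then have p: "p permutes {..<n}" by simp
      have "(\<Prod>i<n. w (e (p i))) = (\<Prod>i<n. w (e i))"
        using prod.permute[OF p, of "\<lambda>i. w (e i)"] by (simp add: o_def)
      also have "\<dots> = (\<Prod>s\<in>S. w s)"
        using prod.reindex_bij_betw[OF bij] .
      finally have 1: "(\<Prod>i<n. w (e (p i))) = (\<Prod>s\<in>S. w s)" .
      have "vander_fun n (restrict (e \<circ> p) {..<n}) = vander_fun n (\<lambda>i. e (p i))"
        unfolding vander_fun_def by (intro prod.cong) auto
      also have "\<dots> = fdet n (\<lambda>i j. Q j (e (p i)))" by (rule Q[symmetric])
      also have "\<dots> = of_int (sign p) * fdet n (\<lambda>i j. Q j (e i))"
        by (rule fdet_permute_rows[OF p])
      finally have 2: "vander_fun n (restrict (e \<circ> p) {..<n}) = of_int (sign p) * vander_fun n e" by (simp add: Q)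
      show "g (restrict (e \<circ> p) {..<n}) = (\<Prod>s\<in>S. w s) * vander_fun n e * (of_int (sign p) * (\<Prod>i<n. P i (e (p i))))"
        by (simp add: g_def 2 prod.distrib 1)
    qed
    also have "\<dots> = (\<Prod>s\<in>S. w s) * vander_fun n e * fdet n (\<lambda>i j. P i (e j))"
      by (simp add: fdet_leibniz sum_distrib_left)
    also have "fdet n (\<lambda>i j. P i (e j)) = vander_fun n e"
      using fdet_transpose[of n "\<lambda>i j. P j (e i)"] P by simp
    also have "vander_fun n e = vander S" using vander_enumeration[of n e] e by auto
    finally show "sum g {f \<in> G. f ` {..<n} = S} = (vander S)\<^sup>2 * (\<Prod>s\<in>S. w s)"
      by (simp add: power2_eq_square)
  qed
  finally show ?thesis ..
qed

section \<open>A discrete Selberg sum\<close>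

text \<open>The counterpart of \<open>phi\<close> at the eastern end: its nodes are the
  \<open>n\<close> odd numbers following \<open>2 * W\<close>, and the sign is chosen so that the
  factors are positive between the two ends.\<close>

definition chi :: "nat \<Rightarrow> nat \<Rightarrow> real \<Rightarrow> real" where
  "chi W n c = (\<Prod>k<n. (2 * real W + 2 * real k + 1)\<^sup>2 - c\<^sup>2)"

lemma psi_Suc: "psi (Suc n) c = psi n c * (c\<^sup>2 - (2 * real n)\<^sup>2)"
  by (simp add: psi_def)

text \<open>The factors \<open>w - k\<close> and \<open>w + k\<close> line up to one rising
  factorial centred at \<open>w\<close>; the node 0 contributes \<open>w\<close> twice, which leaves
  one extra factor.\<close>

lemma psi_even: "psi (Suc m) (2 * w) = 4 ^ Suc m * (pochhammer (w - real m) (2 * m + 1) * w)"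
proof (induction m)
  case (Suc m)
  have "pochhammer (w - real (Suc m)) (2 * Suc m + 1) =
      (w - real (Suc m)) * pochhammer (w - real m) (Suc (2 * m + 1))"
    by (simp add: pochhammer_rec algebra_simps)
  also have "\<dots> = (w - real (Suc m)) * (w + real (Suc m)) * pochhammer (w - real m) (2 * m + 1)"
    by (simp add: pochhammer_Suc algebra_simps)
  finally have p: "pochhammer (w - real (Suc m)) (2 * Suc m + 1) =
      (w - real (Suc m)) * (w + real (Suc m)) * pochhammer (w - real m) (2 * m + 1)" .
  have "(2 * w)\<^sup>2 - (2 * real (Suc m))\<^sup>2 = 4 * ((w - real (Suc m)) * (w + real (Suc m)))"
    by (simp add: power2_eq_square algebra_simps)
  then show ?case unfolding psi_Suc[of "Suc m"] Suc p by simp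
qed (simp add: psi_def power2_eq_square)

text \<open>Splitting \<open>c\<^sup>2 = (c\<^sup>2 - (2 m + 1)\<^sup>2) + (2 m + 1)\<^sup>2\<close> in the last factor of \<open>chi W (n + 1)\<close>
  expresses the sum for \<open>(m, n + 1)\<close> by those for \<open>(m, n)\<close> and \<open>(m + 1, n)\<close>.\<close>

lemma beta_sum:
  "(\<Sum>c\<in>gap 0 (2 * int W). real_of_int c * phi m (real_of_int c) * chi W n (real_of_int c)) =
    4 ^ (m + n) * fact m * fact n / fact (m + n + 1) *
      pochhammer (real W - real m) (2 * m + n + 1) * pochhammer (real W) (n + 1)"
proof (induction n arbitrary: m)
  case 0
  have "4 * (real m + 1) * (\<Sum>c\<in>gap 0 (2 * int W). real_of_int c * phi m (real_of_int c)) =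
      (\<Sum>c\<in>gap 0 (2 * int W). psi (Suc m) (real_of_int c + 1) - psi (Suc m) (real_of_int c - 1))"
    by (simp add: psi_diff sum_distrib_left mult_ac)
  also have "\<dots> = psi (Suc m) (real_of_int (2 * int W)) - psi (Suc m) (real_of_int 0)"
    by (rule sum_gap_telescope) auto
  also have "\<dots> = 4 ^ Suc m * (pochhammer (real W - real m) (2 * m + 1) * real W)"
    using psi_even[of m "real W"] by (simp add: psi_def prod.lessThan_Suc_shift del: prod.lessThan_Suc)
  finally have "(\<Sum>c\<in>gap 0 (2 * int W). real_of_int c * phi m (real_of_int c)) =
      4 ^ m * (pochhammer (real W - real m) (2 * m + 1) * real W) / (real m + 1)"
    by (simp add: field_simps)
  then show ?case by (simp add: chi_def add.commute)
next
  case (Suc n)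
  let ?I = "\<lambda>m n. \<Sum>c\<in>gap 0 (2 * int W). real_of_int c * phi m (real_of_int c) * chi W n (real_of_int c)"
  have "?I m (Suc n) = ((2 * real W + 2 * real n + 1)\<^sup>2 - (2 * real m + 1)\<^sup>2) * ?I m n - ?I (Suc m) n"
    unfolding sum_distrib_left sum_subtractf[symmetric]
    by (intro sum.cong refl) (simp add: phi_def chi_def algebra_simps)
  also have "(2 * real W + 2 * real n + 1)\<^sup>2 - (2 * real m + 1)\<^sup>2 =
      4 * (real W + real n - real m) * (real W + real n + real m + 1)"
    by (simp add: power2_eq_square algebra_simps)
  finally have rec: "?I m (Suc n) =
      4 * (real W + real n - real m) * (real W + real n + real m + 1) * ?I m n - ?I (Suc m) n" .
  define A where "A = pochhammer (real W - real m) (2 * m + n + 1)"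
  define B where "B = pochhammer (real W) (n + 1)"
  have p1: "pochhammer (real W - real (Suc m)) (2 * Suc m + n + 1) =
      (real W - real m - 1) * (A * (real W + real m + real n + 1))"
  proof -
    have "pochhammer (real W - real (Suc m)) (2 * Suc m + n + 1) =
        (real W - real (Suc m)) * pochhammer (real W - real m) (Suc (2 * m + n + 1))"
      by (simp add: pochhammer_rec algebra_simps)
    then show ?thesis by (simp add: pochhammer_Suc A_def algebra_simps)
  qed
  have p2: "pochhammer (real W - real m) (2 * m + Suc n + 1) = A * (real W + real m + real n + 1)"
    by (simp add: pochhammer_Suc A_def algebra_simps)
  have p3: "pochhammer (real W) (Suc n + 1) = B * (real W + real n + 1)"
    by (simp add: pochhammer_Suc B_def algebra_simps)
  define K where "K = 4 ^ (m + n) * fact m * fact n / fact (m + n + 1) * A * B"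
  have I1: "?I m n = K" using Suc[of m] by (simp add: K_def A_def B_def)
  have I2: "?I (Suc m) n = 4 * (real m + 1) / (real m + real n + 2) * (real W - real m - 1) *
      (real W + real m + real n + 1) * K"
    unfolding Suc[of "Suc m"] p1 B_def[symmetric] K_def
    by (simp add: field_simps)
  have I3: "4 ^ (m + Suc n) * fact m * fact (Suc n) / fact (m + Suc n + 1) *
      pochhammer (real W - real m) (2 * m + Suc n + 1) * pochhammer (real W) (Suc n + 1) =
      4 * (real n + 1) / (real m + real n + 2) * (real W + real m + real n + 1) * (real W + real n + 1) * K"
    unfolding p2 p3 K_def by (simp add: field_simps)
  define D where "D = real m + real n + 2"
  have "D > 0" by (simp add: D_def)
  \<comment> \<open>The common factor of all three terms of the recursion; what remains is the
    polynomial identity verified last.\<close>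
  define E where "E = 4 * (real W + real n + real m + 1) * K / D"
  have comm: "real W + real m + real n + 1 = real W + real n + real m + 1" by simp
  have "4 * (real W + real n - real m) * (real W + real n + real m + 1) * K = E * (D * (real W + real n - real m))"
  proof -
    have "E * D = 4 * (real W + real n + real m + 1) * K" using \<open>D > 0\<close> by (simp add: E_def)
    then have "E * (D * (real W + real n - real m)) =
        4 * (real W + real n + real m + 1) * K * (real W + real n - real m)" by (simp only: mult.assoc[symmetric])
    then show ?thesis by (simp only: mult_ac)
  qed
  moreover have "4 * (real m + 1) / D * (real W - real m - 1) * (real W + real m + real n + 1) * K =
      E * ((real m + 1) * (real W - real m - 1))"
    by (simp only: E_def comm times_divide_eq_left times_divide_eq_right mult_ac)
  moreover have "4 * (real n + 1) / D * (real W + real m + real n + 1) * (real W + real n + 1) * K =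
      E * ((real n + 1) * (real W + real n + 1))"
    by (simp only: E_def comm times_divide_eq_left times_divide_eq_right mult_ac)
  moreover have "(real n + 1) * (real W + real n + 1) =
      D * (real W + real n - real m) - (real m + 1) * (real W - real m - 1)"
    by (simp add: D_def algebra_simps)
  ultimately show ?case
    unfolding I3 rec I1 I2 D_def[symmetric] by (simp only: right_diff_distrib)
qed

lemma fdet_reverse_columns: "\<bar>fdet n (\<lambda>i j. f i (n - 1 - j))\<bar> = \<bar>fdet n f\<bar>"
proof -
  define p where "p = (\<lambda>j. if j < n then n - 1 - j else j)"
  have "bij_betw p {..<n} {..<n}"
    by (rule bij_betw_byWitness[where f' = p]) (auto simp: p_def)
  then have p: "p permutes {..<n}" by (rule bij_imp_permutes) (simp add: p_def)
  have "fdet n (\<lambda>i j. f i (n - 1 - j)) = fdet n (\<lambda>i j. f j (p i))"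
    by (subst fdet_transpose[symmetric], rule fdet_cong) (simp add: p_def)
  also have "\<dots> = of_int (sign p) * fdet n (\<lambda>i j. f j i)" by (rule fdet_permute_rows[OF p])
  also have "\<bar>\<dots>\<bar> = \<bar>fdet n f\<bar>" unfolding fdet_transpose[of n f] by (simp add: abs_mult sign_def)
  finally show ?thesis .
qed

lemma pochhammer_fact_quotient:
  "pochhammer (real (Suc u)) k = fact (u + k) / fact u"
proof (induction k)
  case (Suc k)
  have "pochhammer (real (Suc u)) (Suc k) = fact (u + k) / fact u * real (Suc (u + k))"
    unfolding pochhammer_Suc Suc by simp
  then show ?case by (simp add: mult.commute)
qed simp

text \<open>The Chu-Vandermonde identity splits off a unitriangular matrix.  What remains is, up to row and
  column factors, a matrix of monic polynomials in the row index, of degree \<open>n - 1 - k\<close> in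
  column \<open>k\<close>; the reversed order of the degrees only affects the sign.\<close>

lemma hankel_binomial:
  assumes "n \<le> Suc M"
  shows "\<bar>fdet n (\<lambda>i j. fact (M + Y + i + j) / fact (Y + i + j))\<bar> =
    (\<Prod>i<n. fact i * fact M * fact (M + Y + i) / (fact (Y + i + n - 1) * fact (M - i)))"
proof -
  \<comment> \<open>The quotient of the factorials of \<open>Y + i + n - 1\<close> and
    \<open>Y + i + k\<close> is a rising factorial in \<open>i\<close>. Indexing by its degree,
    \<open>n - 1 - k\<close>, puts its roots where \<open>h\<close> has them.\<close>
  define h where "h = (\<lambda>k. newton (\<lambda>l. - (real Y + real (n - k) + real l)) k)"
  have "fdet n (\<lambda>i j. fact (M + Y + i + j) / fact (Y + i + j)) =
      fdet n (\<lambda>i j. \<Sum>k<n. (fact M * real ((M + Y + i) choose (M - k))) * real (j choose k))"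
  proof (rule fdet_cong)
    fix i j assume "i < n" "j < n"
    have "(j + (M + Y + i)) choose M = (\<Sum>k\<le>M. (j choose k) * ((M + Y + i) choose (M - k)))"
      by (rule vandermonde[symmetric])
    also have "\<dots> = (\<Sum>k<n. (j choose k) * ((M + Y + i) choose (M - k)))"
      using assms \<open>j < n\<close> by (intro sum.mono_neutral_right) auto
    finally have "real ((j + (M + Y + i)) choose M) = (\<Sum>k<n. real (j choose k) * real ((M + Y + i) choose (M - k)))"
      by simp
    moreover have "real ((j + (M + Y + i)) choose M) = fact (M + Y + i + j) / (fact M * fact (Y + i + j))"
      by (subst binomial_fact) (auto simp: algebra_simps)
    ultimately show "fact (M + Y + i + j) / fact (Y + i + j) =
        (\<Sum>k<n. (fact M * real ((M + Y + i) choose (M - k))) * real (j choose k))"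
      by (simp add: sum_distrib_left[symmetric] mult.assoc mult.commute field_simps)
  qed
  also have "\<dots> = fdet n (\<lambda>i k. fact M * real ((M + Y + i) choose (M - k))) * fdet n (\<lambda>k j. real (j choose k))"
    by (rule fdet_mult)
  also have "fdet n (\<lambda>k j. real (j choose k)) = 1" by (subst fdet_upper) auto
  also have "fdet n (\<lambda>i k. fact M * real ((M + Y + i) choose (M - k))) =
      fdet n (\<lambda>i k. (fact M * fact (M + Y + i) / fact (Y + i + n - 1)) * (1 / fact (M - k)) *
         poly (h (n - 1 - k)) (real i))"
  proof (rule fdet_cong)
    fix i k assume ik: "i < n" "k < n"
    have nk: "n - (n - 1 - k) = Suc k" using ik by simp
    have "poly (h (n - 1 - k)) (real i) = pochhammer (real (Suc (Y + i + k))) (n - 1 - k)"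
      unfolding h_def poly_newton nk pochhammer_prod lessThan_atLeast0
      by (intro prod.cong) auto
    also have "\<dots> = fact (Y + i + n - 1) / fact (Y + i + k)"
      unfolding pochhammer_fact_quotient using ik by (simp add: add.assoc)
    finally have 1: "poly (h (n - 1 - k)) (real i) = fact (Y + i + n - 1) / fact (Y + i + k)" .
    have "M + Y + i - (M - k) = Y + i + k" using ik assms by simp
    then have 2: "real ((M + Y + i) choose (M - k)) = fact (M + Y + i) / (fact (M - k) * fact (Y + i + k))"
      by (subst binomial_fact) auto
    show "fact M * real ((M + Y + i) choose (M - k)) =
      (fact M * fact (M + Y + i) / fact (Y + i + n - 1)) * (1 / fact (M - k)) * poly (h (n - 1 - k)) (real i)"
      unfolding 1 2 by simp
  qed
  also have "\<dots> = (\<Prod>i<n. fact M * fact (M + Y + i) / fact (Y + i + n - 1)) * (\<Prod>k<n. 1 / fact (M - k)) *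
      fdet n (\<lambda>i k. poly (h (n - 1 - k)) (real i))"
    by (rule fdet_scale)
  finally have "\<bar>fdet n (\<lambda>i j. fact (M + Y + i + j) / fact (Y + i + j))\<bar> =
      (\<Prod>i<n. fact M * fact (M + Y + i) / fact (Y + i + n - 1)) * (\<Prod>k<n. 1 / fact (M - k)) *
      \<bar>fdet n (\<lambda>i k. poly (h (n - 1 - k)) (real i))\<bar>"
    by (simp add: abs_mult abs_prod)
  also have "\<bar>fdet n (\<lambda>i k. poly (h (n - 1 - k)) (real i))\<bar> = \<bar>fdet n (\<lambda>i k. poly (h k) (real i))\<bar>"
    by (rule fdet_reverse_columns)
  also have "fdet n (\<lambda>i k. poly (h k) (real i)) = (\<Prod>j<n. \<Prod>i<j. real j - real i)"
    by (rule vandermonde_poly) (simp_all add: h_def degree_newton coeff_newton)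
  also have "\<dots> = (\<Prod>j<n. fact j)"
  proof (rule prod.cong[OF refl])
    fix j :: nat
    show "(\<Prod>i<j. real j - real i) = fact j"
      by (induction j) (simp_all add: prod.lessThan_Suc_shift del: prod.lessThan_Suc)
  qed
  finally show ?thesis by (simp add: prod.distrib[symmetric] abs_prod prod_dividef mult_ac)
qed

text \<open>With bases adapted to both ends, the matrix of Andreief's identity has the beta sums at
  \<open>a + i\<close> and \<open>C + j\<close> as entries, up to signs. Their closed form is a row
  factor times a column factor times a quotient of factorials that depends on \<open>i + j\<close>
  only, which is the matrix of \<open>hankel_binomial\<close>.\<close>

lemma selberg_sum:
  fixes N y a C :: nat
  assumes "y \<le> N"
  defines "W \<equiv> a + N"
  shows "(\<Sum>S | S \<subseteq> gap (2 * int a) (2 * int W) \<and> card S = y.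
      (vander S)\<^sup>2 * (\<Prod>s\<in>S. real_of_int s * phi a (real_of_int s) * chi W C (real_of_int s))) =
    (\<Prod>i<y. 4 ^ (a + C + 2 * i) * fact (a + i) * fact (C + i) * fact i * fact (W + C + i) * fact (W + a + C + i) /
       (fact (N - 1 - i) * fact (W - 1 - i) * fact (a + C + y + i)))"
    (is "?Z = _")
\<comment> \<open>For \<open>y = 0\<close> the width \<open>W\<close> may be 0, and then
  \<open>W - 1\<close> is no predecessor.\<close>
proof (cases "y = 0")
  case True
  have "{S. S \<subseteq> gap (2 * int a) (2 * int W) \<and> card S = y} = {{}}"
    using True by (auto dest: finite_subset[OF _ finite_gap])
  then show ?thesis using True by (simp add: vander_def)
next
  case False
  define w where "w = (\<lambda>s. real_of_int s * phi a (real_of_int s) * chi W C (real_of_int s))"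
  define X where "X = gap (2 * int a) (2 * int W)"
  \<comment> \<open>The nodes continue those of \<open>phi a\<close> and of \<open>chi W C\<close>,
    so that multiplying by a basis polynomial just raises the index, up to sign in the second
    case.\<close>
  define rP where "rP = (\<lambda>k. (2 * real (a + k) + 1)\<^sup>2)"
  define rQ where "rQ = (\<lambda>k. (2 * real W + 2 * real (C + k) + 1)\<^sup>2)"
  define I where "I = (\<lambda>m n. \<Sum>c\<in>gap 0 (2 * int W). real_of_int c * phi m (real_of_int c) * chi W n (real_of_int c))"
  have phi_add: "phi a c * poly (newton rP i) (c\<^sup>2) = phi (a + i) c" for c i
    by (induction i) (simp_all add: phi_def rP_def poly_newton mult.assoc[symmetric])
  have chi_add: "chi W C c * poly (newton rQ i) (c\<^sup>2) = (- 1) ^ i * chi W (C + i) c" for c i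
  proof (induction i)
    case (Suc i)
    have "chi W C c * poly (newton rQ (Suc i)) (c\<^sup>2) = (chi W C c * poly (newton rQ i) (c\<^sup>2)) * (c\<^sup>2 - rQ i)"
      by (simp add: poly_newton)
    also have "\<dots> = (- 1) ^ Suc i * (chi W (C + i) c * (rQ i - c\<^sup>2))" unfolding Suc by (simp add: algebra_simps)
    also have "chi W (C + i) c * (rQ i - c\<^sup>2) = chi W (C + Suc i) c" by (simp add: chi_def rQ_def)
    finally show ?case .
  qed (simp add: poly_newton)
  have "?Z = fdet y (\<lambda>i j. \<Sum>s\<in>X. w s * poly (newton rP i) ((real_of_int s)\<^sup>2) * poly (newton rQ j) ((real_of_int s)\<^sup>2))"
    unfolding X_def[symmetric] w_def[symmetric]
    by (rule andreief) (simp_all add: X_def vander_fun_fdet_newton)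
  also have "\<dots> = fdet y (\<lambda>i j. 1 * (- 1) ^ j * I (a + i) (C + j))"
  proof (rule fdet_cong)
    fix i j
    have "(\<Sum>s\<in>X. w s * poly (newton rP i) ((real_of_int s)\<^sup>2) * poly (newton rQ j) ((real_of_int s)\<^sup>2)) =
        (\<Sum>s\<in>X. (- 1) ^ j * (real_of_int s * phi (a + i) (real_of_int s) * chi W (C + j) (real_of_int s)))"
    proof (rule sum.cong[OF refl])
      fix s
      have "A * B * D * p * q = A * (B * p) * (D * q)" for A B D p q :: real by simp
      then show "w s * poly (newton rP i) ((real_of_int s)\<^sup>2) * poly (newton rQ j) ((real_of_int s)\<^sup>2) =
          (- 1) ^ j * (real_of_int s * phi (a + i) (real_of_int s) * chi W (C + j) (real_of_int s))"
        unfolding w_def phi_add[symmetric] using chi_add[of "real_of_int s" j] by simp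
    qed
    \<comment> \<open>The range may be extended to the west because the added odd numbers are nodes
      of \<open>phi a\<close>.\<close>
    also have "\<dots> = (\<Sum>s\<in>gap 0 (2 * int W). (- 1) ^ j * (real_of_int s * phi (a + i) (real_of_int s) * chi W (C + j) (real_of_int s)))"
    proof (rule sum.mono_neutral_left)
      show "X \<subseteq> gap 0 (2 * int W)" by (auto simp: X_def gap_def)
      show "\<forall>s\<in>gap 0 (2 * int W) - X. (- 1) ^ j * (real_of_int s * phi (a + i) (real_of_int s) * chi W (C + j) (real_of_int s)) = 0"
      proof
        fix s assume "s \<in> gap 0 (2 * int W) - X"
        then have s: "0 < s" "odd s" "s \<le> 2 * int a" by (auto simp: X_def gap_def)
        then obtain k where k: "s = 2 * k + 1" by (auto elim: oddE)
        then have "0 \<le> k" "k < int a" using s by auto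
        then have "nat k < a + i" "s = 2 * int (nat k) + 1" using k by auto
        then have "phi (a + i) (real_of_int s) = 0"
          unfolding phi_def by (intro prod_zero) (auto intro!: bexI[of _ "nat k"])
        then show "(- 1) ^ j * (real_of_int s * phi (a + i) (real_of_int s) * chi W (C + j) (real_of_int s)) = 0"
          by simp
      qed
    qed simp
    finally show "(\<Sum>s\<in>X. w s * poly (newton rP i) ((real_of_int s)\<^sup>2) * poly (newton rQ j) ((real_of_int s)\<^sup>2)) =
        1 * (- 1) ^ j * I (a + i) (C + j)" by (simp add: I_def sum_distrib_left)
  qed
  also have "\<dots> = (\<Prod>i<y. 1) * (\<Prod>j<y. (- 1) ^ j) * fdet y (\<lambda>i j. I (a + i) (C + j))"
    by (rule fdet_scale)
  finally have Z1: "\<bar>?Z\<bar> = \<bar>fdet y (\<lambda>i j. I (a + i) (C + j))\<bar>"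
    by (simp add: abs_mult abs_prod)
  \<comment> \<open>The signs from \<open>chi_add\<close> and from reversing the columns are dropped
    under absolute values; positivity of the weight justifies this.\<close>
  have "w s \<ge> 0" if "s \<in> X" for s
  proof -
    have s: "2 * int a < s" "s < 2 * int W" using that by (auto simp: X_def gap_def)
    have "phi a (real_of_int s) \<ge> 0"
      unfolding phi_def
    proof (intro prod_nonneg)
      fix k assume "k \<in> {..<a}"
      then have "2 * real k + 1 \<le> real_of_int s" using s by auto
      then show "0 \<le> (real_of_int s)\<^sup>2 - (2 * real k + 1)\<^sup>2" by (simp add: power_mono)
    qed
    moreover have "chi W C (real_of_int s) \<ge> 0"
      unfolding chi_def
    proof (intro prod_nonneg)
      fix k
      have "0 \<le> real_of_int s" "real_of_int s \<le> 2 * real W + 2 * real k + 1" using s by auto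
      then show "0 \<le> (2 * real W + 2 * real k + 1)\<^sup>2 - (real_of_int s)\<^sup>2" by (simp add: power_mono)
    qed
    ultimately show ?thesis using s by (simp add: w_def)
  qed
  then have "?Z \<ge> 0"
    unfolding X_def[symmetric] w_def[symmetric]
    by (intro sum_nonneg mult_nonneg_nonneg prod_nonneg) auto
  with Z1 have Z2: "?Z = \<bar>fdet y (\<lambda>i j. I (a + i) (C + j))\<bar>" by simp
  have N: "0 < N" "W > 0" using False assms by auto
  \<comment> \<open>\<open>M\<close> is the lower factorial in the rising factorial from
    \<open>W\<close>, and \<open>Y\<close> the offset in \<open>fact (m + n + 1)\<close> of
    \<open>beta_sum\<close>.\<close>
  define M where "M = W - 1"
  have M: "W = Suc M" using N by (simp add: M_def)
  define Y where "Y = a + C + 1"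
  define rr where "rr = (\<lambda>i. 4 ^ (a + i) * fact (a + i) / fact (N - 1 - i) :: real)"
  define ss where "ss = (\<lambda>j. 4 ^ (C + j) * fact (C + j) * fact (W + C + j) / fact M :: real)"
  have "fdet y (\<lambda>i j. I (a + i) (C + j)) = fdet y (\<lambda>i j. rr i * ss j * (fact (M + Y + i + j) / fact (Y + i + j)))"
  proof (rule fdet_cong)
    fix i j assume ij: "i < y" "j < y"
    have "real W - real (a + i) = real (Suc (N - 1 - i))"
      using ij assms by (auto simp: W_def)
    then have "pochhammer (real W - real (a + i)) (2 * (a + i) + (C + j) + 1) =
        fact (N - 1 - i + (2 * (a + i) + (C + j) + 1)) / fact (N - 1 - i)"
      by (simp only: pochhammer_fact_quotient)
    also have "N - 1 - i + (2 * (a + i) + (C + j) + 1) = M + Y + i + j"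
      using ij assms by (simp add: M_def Y_def W_def)
    finally have p1: "pochhammer (real W - real (a + i)) (2 * (a + i) + (C + j) + 1) =
        fact (M + Y + i + j) / fact (N - 1 - i)" .
    have p2: "pochhammer (real W) (C + j + 1) = fact (W + C + j) / fact M"
      unfolding M pochhammer_fact_quotient by (simp add: add.assoc)
    have Yij: "a + i + (C + j) + 1 = Y + i + j" "a + i + (C + j) = (a + i) + (C + j)" by (simp_all add: Y_def)
    show "I (a + i) (C + j) = rr i * ss j * (fact (M + Y + i + j) / fact (Y + i + j))"
      unfolding I_def beta_sum p1 p2 Yij(1) rr_def ss_def power_add by (simp add: field_simps)
  qed
  also have "\<dots> = (\<Prod>i<y. rr i) * (\<Prod>j<y. ss j) * fdet y (\<lambda>i j. fact (M + Y + i + j) / fact (Y + i + j))"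
    by (rule fdet_scale)
  finally have "?Z = (\<Prod>i<y. rr i) * (\<Prod>j<y. ss j) * \<bar>fdet y (\<lambda>i j. fact (M + Y + i + j) / fact (Y + i + j))\<bar>"
    unfolding Z2 by (simp add: abs_mult abs_prod rr_def ss_def)
  also have "\<bar>fdet y (\<lambda>i j. fact (M + Y + i + j) / fact (Y + i + j))\<bar> =
      (\<Prod>i<y. fact i * fact M * fact (M + Y + i) / (fact (Y + i + y - 1) * fact (M - i)))"
    by (rule hankel_binomial) (use assms M in auto)
  finally show ?thesis
    unfolding prod.distrib[symmetric]
  proof (elim trans, intro prod.cong refl)
    fix i
    have e: "M + Y + i = W + a + C + i" "Y + i + y - 1 = a + C + y + i" "M - i = W - 1 - i"
      by (auto simp: M_def Y_def N)
    show "rr i * ss i * (fact i * fact M * fact (M + Y + i) / (fact (Y + i + y - 1) * fact (M - i))) =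
      4 ^ (a + C + 2 * i) * fact (a + i) * fact (C + i) * fact i * fact (W + C + i) * fact (W + a + C + i) /
       (fact (N - 1 - i) * fact (W - 1 - i) * fact (a + C + y + i))"
      unfolding e rr_def ss_def by (simp add: power_add power_mult field_simps power2_eq_square)
  qed
qed

section \<open>Trapezoids with unit dents\<close>

lemma brick_weight_vertical: "brick_weight {(k, c), (k + 1, c)} = (if c = 0 then 1 / 2 else 1)"
  by (auto simp: brick_weight_def doubleton_eq_iff)

lemma brick_weight_horizontal: "brick_weight {(k, c), (k, c + 1)} = 1"
  by (auto simp: brick_weight_def doubleton_eq_iff)

lemma vertical_brick: "{(k, c), (k + 1, c)} \<in> bricks \<longleftrightarrow> even (c - k)"
  by (simp add: brick_iff)

lemma prod_half: "finite V \<Longrightarrow> (\<Prod>c\<in>V. if c = (0::int) then 1 / 2 else 1 :: real) = (if 0 \<in> V then 1 / 2 else 1)"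
  by (simp add: prod.If_cases)

lemma brickE:
  assumes "l \<in> bricks"
  obtains (horizontal) k c where "l = {(k, c), (k, c + 1)}"
    | (vertical) k c where "l = {(k, c), (k + 1, c)}" "even (c - k)"
  using assms unfolding bricks_def by blast

text \<open>Crossing bricks lie in distinct columns and are therefore disjoint, as
  \<open>matching_sum_cut\<close> requires. At most one of them lies in column 0, so their weights
  multiply to 1/2 or 1.\<close>

lemma matching_sum_cut_rows:
  assumes fin: "finite A" "finite B"
    and A: "\<And>p. p \<in> A \<Longrightarrow> fst p \<le> k" and B: "\<And>p. p \<in> B \<Longrightarrow> k + 1 \<le> fst p"
  shows "brick_sum (A \<union> B) =
    (\<Sum>V\<in>Pow {c. even (c - k) \<and> (k, c) \<in> A \<and> (k + 1, c) \<in> B}.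
       (if 0 \<in> V then 1 / 2 else 1) * brick_sum (A - {k} \<times> V) * brick_sum (B - {k + 1} \<times> V))"
proof -
  define v where "v = (\<lambda>c. {(k, c), (k + 1, c)} :: (int \<times> int) set)"
  define U where "U = {c. even (c - k) \<and> (k, c) \<in> A \<and> (k + 1, c) \<in> B}"
  have finU: "finite U"
  proof (rule finite_subset)
    show "U \<subseteq> snd ` A" by (force simp: U_def)
  qed (use fin in simp)
  have AB: "A \<inter> B = {}" using A B by force
  have injv: "inj v" by (auto simp: v_def inj_def doubleton_eq_iff)
  have cross: "\<exists>c. l = v c \<and> even (c - k) \<and> (k, c) \<in> A \<and> (k + 1, c) \<in> B"
    if l: "l \<in> bricks" "l \<inter> A \<noteq> {}" "l \<inter> B \<noteq> {}" for l
  proof -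
    obtain a where a: "a \<in> l" "a \<in> A" using l(2) by auto
    obtain b where b: "b \<in> l" "b \<in> B" using l(3) by auto
    note ab = a b
    have "fst a \<le> k" "k + 1 \<le> fst b" using A B ab by auto
    with l(1) ab show ?thesis by (cases l rule: brickE) (auto simp: v_def)
  qed
  have C1: "{l \<in> bricks. l \<subseteq> A \<union> B \<and> l \<inter> A \<noteq> {} \<and> l \<inter> B \<noteq> {}} = v ` U" (is "?C = _")
  proof (intro equalityI subsetI)
    fix l assume "l \<in> ?C"
    then show "l \<in> v ` U" using cross[of l] by (auto simp: U_def)
  next
    fix l assume "l \<in> v ` U"
    then show "l \<in> ?C" by (auto simp: U_def v_def vertical_brick)
  qed
  have dis: "disjoint {l \<in> bricks. l \<inter> A \<noteq> {} \<and> l \<inter> B \<noteq> {}}"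
    unfolding disjoint_def
  proof (intro ballI impI)
    fix l l' assume l: "l \<in> {l \<in> bricks. l \<inter> A \<noteq> {} \<and> l \<inter> B \<noteq> {}}"
      "l' \<in> {l \<in> bricks. l \<inter> A \<noteq> {} \<and> l \<inter> B \<noteq> {}}" "l \<noteq> l'"
    then obtain c c' where "l = v c" "l' = v c'" using cross by blast
    then show "l \<inter> l' = {}" using l(3) by (auto simp: v_def)
  qed
  have injI: "inj_on ((`) v) (Pow U)"
    by (rule inj_on_image_Pow) (use injv in \<open>auto intro: inj_on_subset\<close>)
  have "brick_sum (A \<union> B) =
    (\<Sum>X\<in>(`) v ` Pow U. (\<Prod>l\<in>X. brick_weight l) * brick_sum (A - \<Union>X) * brick_sum (B - \<Union>X))"
    unfolding matching_sum_cut[OF fin AB dis] C1 image_Pow_surj[OF refl, of v U] ..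
  also have "\<dots> = (\<Sum>V\<in>Pow U. (\<Prod>l\<in>v ` V. brick_weight l) * brick_sum (A - \<Union>(v ` V)) * brick_sum (B - \<Union>(v ` V)))"
    by (subst sum.reindex[OF injI]) simp
  also have "\<dots> = (\<Sum>V\<in>Pow U. (if 0 \<in> V then 1 / 2 else 1) * brick_sum (A - {k} \<times> V) * brick_sum (B - {k + 1} \<times> V))"
  proof (rule sum.cong[OF refl])
    fix V assume "V \<in> Pow U"
    then have V: "V \<subseteq> U" "finite V" using finU finite_subset by auto
    have "(\<Prod>l\<in>v ` V. brick_weight l) = (\<Prod>c\<in>V. brick_weight (v c))"
      using injv by (subst prod.reindex) (auto intro: inj_on_subset)
    also have "\<dots> = (if 0 \<in> V then 1 / 2 else 1)"
      using prod_half[OF V(2)] by (simp add: v_def brick_weight_vertical)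
    finally have 1: "(\<Prod>l\<in>v ` V. brick_weight l) = (if 0 \<in> V then 1 / 2 else 1)" .
    have 2: "A - \<Union>(v ` V) = A - {k} \<times> V" using A by (fastforce simp: v_def)
    have 3: "B - \<Union>(v ` V) = B - {k + 1} \<times> V" using B by (fastforce simp: v_def)
    show "(\<Prod>l\<in>v ` V. brick_weight l) * brick_sum (A - \<Union>(v ` V)) * brick_sum (B - \<Union>(v ` V)) =
      (if 0 \<in> V then 1 / 2 else 1) * brick_sum (A - {k} \<times> V) * brick_sum (B - {k + 1} \<times> V)"
      unfolding 1 2 3 ..
  qed
  finally show ?thesis by (simp add: U_def)
qed

section \<open>Matchings of a single row\<close>

lemma matching_sum_row_interval: "brick_sum ({k} \<times> {a..<a + 2 * int n}) = 1"
proof (induction n arbitrary: a)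
  case (Suc n)
  let ?S = "{k} \<times> {a..<a + 2 * int (Suc n)}" and ?l = "{(k, a), (k, a + 1)}"
  have "brick_sum ?S = brick_weight ?l * brick_sum (?S - ?l)"
  proof (rule matching_sum_forced[where f = "(k, a)"])
    fix l' assume "l' \<in> bricks" "l' \<subseteq> ?S" "(k, a) \<in> l'"
    then show "l' = ?l"
      by (cases l' rule: brickE) auto
  qed (auto simp: brick_iff)
  also have "?S - ?l = {k} \<times> {(a + 2)..<(a + 2) + 2 * int n}" by auto
  finally show ?case using Suc.IH[of "a + 2"] by (simp add: brick_weight_horizontal)
qed simp

lemma matching_sum_row_union:
  assumes "finite F" "finite G" "\<And>c d. c \<in> F \<Longrightarrow> d \<in> G \<Longrightarrow> c + 2 \<le> d"
  shows "brick_sum ({k} \<times> (F \<union> G)) = brick_sum ({k} \<times> F) * brick_sum ({k} \<times> G)"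
proof -
  have "brick_sum ({k} \<times> F \<union> {k} \<times> G) = brick_sum ({k} \<times> F) * brick_sum ({k} \<times> G)"
  proof (rule matching_sum_union)
    show "{k} \<times> F \<inter> {k} \<times> G = {}" using assms(3) by fastforce
    fix l assume "l \<in> bricks"
    then show "l \<inter> {k} \<times> F = {} \<or> l \<inter> {k} \<times> G = {}"
      by (cases l rule: brickE) (use assms(3) in \<open>fastforce+\<close>)
  qed (use assms in auto)
  then show ?thesis by (simp add: Sigma_Un_distrib2)
qed

definition parity_sign :: "int \<Rightarrow> int" where "parity_sign c = (if even c then 1 else - 1)"

lemma sum_parity_sign_interval: "(\<Sum>c\<in>{a..<a + 2 * int n}. parity_sign c) = 0"
proof (induction n arbitrary: a)
  case (Suc n)
  have "{a..<a + 2 * int (Suc n)} = {a, a + 1} \<union> {(a + 2)..<(a + 2) + 2 * int n}" by auto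
  also have "(\<Sum>c\<in>\<dots>. parity_sign c) = (\<Sum>c\<in>{a, a + 1}. parity_sign c) + (\<Sum>c\<in>{(a + 2)..<(a + 2) + 2 * int n}. parity_sign c)"
    by (rule sum.union_disjoint) auto
  finally show ?case using Suc.IH[of "a + 2"] by (simp add: parity_sign_def)
qed simp

lemma matching_sum_row_unbalanced:
  assumes "finite F" "(\<Sum>c\<in>F. parity_sign c) \<noteq> 0"
  shows "brick_sum ({k} \<times> F) = 0"
\<comment> \<open>Colouring by the parity of \<open>c + k\<close> separates the two cells of every
  brick, horizontal or vertical.\<close>
proof (rule matching_sum_unbalanced[where s = "\<lambda>(k, c). parity_sign (c + k)"])
  show "finite ({k} \<times> F)" using assms by simp
  show "sum (\<lambda>(k, c). parity_sign (c + k)) l = 0" if "l \<in> bricks" for l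
    using that by (auto simp: bricks_def parity_sign_def)
  have "sum (\<lambda>(k, c). parity_sign (c + k)) ({k} \<times> F) = (\<Sum>c\<in>F. parity_sign (c + k))"
    by (simp flip: sum.cartesian_product)
  also have "\<dots> = parity_sign k * (\<Sum>c\<in>F. parity_sign c)"
    unfolding sum_distrib_left by (rule sum.cong) (auto simp: parity_sign_def)
  finally show "sum (\<lambda>(k, c). parity_sign (c + k)) ({k} \<times> F) \<noteq> 0"
    using assms by (auto simp: parity_sign_def)
qed

lemma sum_parity_sign_diff:
  assumes "finite F" "V \<subseteq> F" "\<And>c. c \<in> V \<Longrightarrow> parity_sign c = s"
  shows "(\<Sum>c\<in>F - V. parity_sign c) = (\<Sum>c\<in>F. parity_sign c) - s * int (card V)"
  using assms by (simp add: sum_diff)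

lemma even_interval:
  fixes a b :: int
  assumes "a \<le> b" "even (b - a)"
  obtains n where "b = a + 2 * int n"
proof
  show "b = a + 2 * int (nat ((b - a) div 2))" using assms by simp
qed

text \<open>The interval is balanced and all removed cells have one colour, so any removal destroys
  the balance.\<close>

lemma matching_sum_row_even:
  assumes "a \<le> b" "even (b - a)" "\<And>c. c \<in> V \<Longrightarrow> even (c - e)"
  shows "brick_sum ({k} \<times> ({a..<b} - V)) = of_bool (V \<inter> {a..<b} = {})"
proof -
  obtain n where b: "b = a + 2 * int n" using even_interval assms by blast
  show ?thesis
  proof (cases "V \<inter> {a..<b} = {}")
    case True
    then have "{a..<b} - V = {a..<b}" by auto
    then show ?thesis using True matching_sum_row_interval by (simp add: b)
  next
    case False
    have "(\<Sum>c\<in>{a..<b} - V \<inter> {a..<b}. parity_sign c) = (\<Sum>c\<in>{a..<b}. parity_sign c) - parity_sign e * int (card (V \<inter> {a..<b}))"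
      by (rule sum_parity_sign_diff) (use assms in \<open>auto simp: parity_sign_def\<close>)
    also have "\<dots> \<noteq> 0"
      using False sum_parity_sign_interval[of a n] by (auto simp: b parity_sign_def[of e])
    finally show ?thesis using False matching_sum_row_unbalanced[of "{a..<b} - V \<inter> {a..<b}" k]
      by (simp add: Diff_Int_distrib2 Diff_Int)
  qed
qed

text \<open>The open gap has one surplus cell, of the colour to which \<open>V\<close> belongs.
  Hence exactly one cell has to leave it by a vertical brick, and any single removal leaves two
  intervals of even length. This is the source of interlacing.\<close>

lemma matching_sum_row_gap:
  assumes "p < q" "even (q - p)" "\<And>c. c \<in> V \<Longrightarrow> odd (c - p)"
  shows "brick_sum ({k} \<times> ({p<..<q} - V)) = of_bool (card (V \<inter> {p<..<q}) = 1)"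
proof (cases "card (V \<inter> {p<..<q}) = 1")
  case True
  then obtain v where v: "V \<inter> {p<..<q} = {v}" by (auto simp: card_1_singleton_iff)
  then have pv: "p < v" "v < q" "odd (v - p)" using assms(3)[of v] by auto
  obtain m where m: "v = (p + 1) + 2 * int m" using even_interval[of "p + 1" v] pv by auto
  obtain n where n: "q = (v + 1) + 2 * int n" using even_interval[of "v + 1" q] pv assms(2) by auto
  have "x \<in> V \<inter> {p<..<q} \<longleftrightarrow> x \<in> {v}" for x by (simp only: v)
  then have iff: "x \<in> V \<and> p < x \<and> x < q \<longleftrightarrow> x = v" for x by simp
  have "x \<in> {p<..<q} - V \<longleftrightarrow> x \<in> {p + 1..<v} \<union> {v + 1..<q}" for x
    using iff[of x] pv by (cases "x = v") auto
  then have "{p<..<q} - V = {p + 1..<v} \<union> {v + 1..<q}" by (rule Set.set_eqI)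
  then have "brick_sum ({k} \<times> ({p<..<q} - V)) =
      brick_sum ({k} \<times> {p + 1..<v}) * brick_sum ({k} \<times> {v + 1..<q})"
    by (simp only:) (rule matching_sum_row_union, auto)
  also have "\<dots> = 1"
    using matching_sum_row_interval[of k "p + 1" m] matching_sum_row_interval[of k "v + 1" n] by (simp flip: m n)
  finally show ?thesis using True by simp
next
  case False
  obtain n where n: "q = (p + 2) + 2 * int n"
  proof (rule even_interval)
    show "p + 2 \<le> q" "even (q - (p + 2))" using assms(1,2) by presburger+
  qed
  have "{p<..<q} = insert (p + 1) {p + 2..<q}" using n by auto
  then have s: "(\<Sum>c\<in>{p<..<q}. parity_sign c) = parity_sign (p + 1)"
    using sum_parity_sign_interval[of "p + 2" n] by (simp flip: n)
  have "(\<Sum>c\<in>{p<..<q} - V \<inter> {p<..<q}. parity_sign c) = (\<Sum>c\<in>{p<..<q}. parity_sign c) - parity_sign (p + 1) * int (card (V \<inter> {p<..<q}))"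
    by (rule sum_parity_sign_diff) (use assms in \<open>auto simp: parity_sign_def\<close>)
  also have "\<dots> \<noteq> 0" unfolding s using False by (auto simp: parity_sign_def)
  finally show ?thesis using False matching_sum_row_unbalanced[of "{p<..<q} - V \<inter> {p<..<q}" k]
    by (simp add: Diff_Int_distrib2 Diff_Int)
qed

lemma matching_sum_row_prefix:
  fixes d :: "nat \<Rightarrow> int"
  assumes d: "\<And>j. j < n \<Longrightarrow> d j < d (Suc j)" "\<And>j. j \<le> n \<Longrightarrow> odd (d j - k)"
    and lo: "lo \<le> d 0" "odd (lo - k)" and V: "\<And>c. c \<in> V \<Longrightarrow> even (c - k)"
  shows "brick_sum ({k} \<times> ({lo..d n} - d ` {..n} - V)) =
    of_bool (V \<inter> {lo..<d 0} = {} \<and> (\<forall>j<n. card (V \<inter> {d j<..<d (Suc j)}) = 1))"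
  using d
proof (induction n)
  case 0
  have "{lo..d 0} - d ` {..0} - V = {lo..<d 0} - V" by auto
  then show ?case using matching_sum_row_even[of lo "d 0" V k] lo V 0 by simp
next
  case (Suc n)
  have le: "d j \<le> d n" if "j \<le> n" for j
    using chain_le[of n d j n] that Suc.prems(1) by auto
  have eq: "{lo..d (Suc n)} - d ` {..Suc n} - V =
      ({lo..d n} - d ` {..n} - V) \<union> ({d n<..<d (Suc n)} - V)"
    using Suc.prems(1)[of n] le lo(1) le[of 0] by (force simp: atMost_Suc)
  have "brick_sum ({k} \<times> ({lo..d (Suc n)} - d ` {..Suc n} - V)) =
      brick_sum ({k} \<times> ({lo..d n} - d ` {..n} - V)) * brick_sum ({k} \<times> ({d n<..<d (Suc n)} - V))"
    unfolding eq by (rule matching_sum_row_union) force+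
  also have "brick_sum ({k} \<times> ({lo..d n} - d ` {..n} - V)) =
      of_bool (V \<inter> {lo..<d 0} = {} \<and> (\<forall>j<n. card (V \<inter> {d j<..<d (Suc j)}) = 1))"
    using Suc by simp
  also have "brick_sum ({k} \<times> ({d n<..<d (Suc n)} - V)) = of_bool (card (V \<inter> {d n<..<d (Suc n)}) = 1)"
  proof (rule matching_sum_row_gap)
    have o: "odd (d n - k)" "odd (d (Suc n) - k)" using Suc.prems(2) by auto
    show "even (d (Suc n) - d n)" using o by presburger
    show "odd (c - d n)" if "c \<in> V" for c using V[OF that] o by presburger
  qed (use Suc.prems in simp)
  finally show ?case by (auto simp: less_Suc_eq)
qed

text \<open>The dents cut the row into pieces that no horizontal brick joins. The gaps between dents
  must lose exactly one cell each, while the two end pieces have even length and must lose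
  none.\<close>

lemma matching_sum_row_interlace:
  fixes d :: "nat \<Rightarrow> int"
  assumes d: "\<And>j. j < n \<Longrightarrow> d j < d (Suc j)" "\<And>j. j \<le> n \<Longrightarrow> odd (d j - k)"
    and lo: "lo \<le> d 0" "odd (lo - k)" and hi: "d n \<le> hi" "odd (hi - k)"
    and V: "\<And>c. c \<in> V \<Longrightarrow> even (c - k)"
  shows "brick_sum ({k} \<times> ({lo..hi} - d ` {..n} - V)) =
    of_bool (V \<inter> {lo..<d 0} = {} \<and> (\<forall>j<n. card (V \<inter> {d j<..<d (Suc j)}) = 1) \<and> V \<inter> {d n + 1..<hi + 1} = {})"
proof -
  have le: "d j \<le> d n" if "j \<le> n" for j
    using chain_le[of n d j n] that d(1) by auto
  have eq: "{lo..hi} - d ` {..n} - V = ({lo..d n} - d ` {..n} - V) \<union> ({d n + 1..<hi + 1} - V)"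
    using le lo(1) le[of 0] hi by force
  have "brick_sum ({k} \<times> ({lo..hi} - d ` {..n} - V)) =
      brick_sum ({k} \<times> ({lo..d n} - d ` {..n} - V)) * brick_sum ({k} \<times> ({d n + 1..<hi + 1} - V))"
    unfolding eq by (rule matching_sum_row_union) force+
  also have "brick_sum ({k} \<times> ({d n + 1..<hi + 1} - V)) = of_bool (V \<inter> {d n + 1..<hi + 1} = {})"
  proof (rule matching_sum_row_even[where e = k])
    have "odd (d n - k)" using d by simp
    then show "even (hi + 1 - (d n + 1))" using hi(2) by presburger
  qed (use hi V in auto)
  also have "brick_sum ({k} \<times> ({lo..d n} - d ` {..n} - V)) =
    of_bool (V \<inter> {lo..<d 0} = {} \<and> (\<forall>j<n. card (V \<inter> {d j<..<d (Suc j)}) = 1))"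
    using matching_sum_row_prefix[OF d lo V] by simp
  finally show ?thesis by auto
qed

section \<open>The recursion from one row of a trapezoid to the next\<close>

definition trapezoid :: "int \<Rightarrow> int \<Rightarrow> int \<Rightarrow> nat \<Rightarrow> (int \<times> int) set" where
  "trapezoid lo k H W = {(k', c). k \<le> k' \<and> k' < H \<and> lo \<le> c \<and> c \<le> 2 * int W - k' - 1}"

lemma finite_trapezoid [simp]: "finite (trapezoid lo k H W)"
  by (rule finite_subset[of _ "{k..H} \<times> {lo..2 * int W - k}"]) (auto simp: trapezoid_def)

lemma trapezoid_row:
  assumes "k < H"
  shows "trapezoid lo k H W - {k} \<times> D = {k} \<times> ({lo..2 * int W - k - 1} - D) \<union> trapezoid lo (k + 1) H W"
  using assms by (auto simp: trapezoid_def)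

lemma trapezoid_cut:
  assumes "k < H"
  shows "brick_sum (trapezoid lo k H W - {k} \<times> D) =
    (\<Sum>V\<in>Pow {c. even (c - k) \<and> lo \<le> c \<and> c \<le> 2 * int W - k - 2 \<and> k + 1 < H \<and> c \<notin> D}.
       (if 0 \<in> V then 1 / 2 else 1) * brick_sum ({k} \<times> ({lo..2 * int W - k - 1} - D - V)) *
       brick_sum (trapezoid lo (k + 1) H W - {k + 1} \<times> V))"
proof -
  let ?A = "{k} \<times> ({lo..2 * int W - k - 1} - D)" and ?B = "trapezoid lo (k + 1) H W"
  have 1: "{c. even (c - k) \<and> (k, c) \<in> ?A \<and> (k + 1, c) \<in> ?B} =
      {c. even (c - k) \<and> lo \<le> c \<and> c \<le> 2 * int W - k - 2 \<and> k + 1 < H \<and> c \<notin> D}"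
    by (auto simp: trapezoid_def)
  have 2: "?A - {k} \<times> V = {k} \<times> ({lo..2 * int W - k - 1} - D - V)" for V by auto
  have "brick_sum (?A \<union> ?B) = (\<Sum>V\<in>Pow {c. even (c - k) \<and> (k, c) \<in> ?A \<and> (k + 1, c) \<in> ?B}.
       (if 0 \<in> V then 1 / 2 else 1) * brick_sum (?A - {k} \<times> V) * brick_sum (?B - {k + 1} \<times> V))"
    by (rule matching_sum_cut_rows) (simp, simp, (auto simp: trapezoid_def)[2])
  then show ?thesis unfolding trapezoid_row[OF assms] 1 2 .
qed

lemma matching_sum_row_odd:
  assumes "a \<le> b" "even (b - a)" "\<And>c. c \<in> V \<Longrightarrow> odd (c - a)"
  shows "brick_sum ({k} \<times> ({a..b} - V)) = 0"
proof -
  obtain n where n: "b = a + 2 * int n" using even_interval[OF assms(1,2)] .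
  have "{a..b} = insert a {a + 1..<(a + 1) + 2 * int n}" using n by auto
  then have s: "(\<Sum>c\<in>{a..b}. parity_sign c) = parity_sign a"
    using sum_parity_sign_interval[of "a + 1" n] by simp
  have "(\<Sum>c\<in>{a..b} - V \<inter> {a..b}. parity_sign c) = (\<Sum>c\<in>{a..b}. parity_sign c) - parity_sign (a + 1) * int (card (V \<inter> {a..b}))"
    by (rule sum_parity_sign_diff) (use assms in \<open>auto simp: parity_sign_def\<close>)
  also have "\<dots> \<noteq> 0" unfolding s by (auto simp: parity_sign_def)
  finally show ?thesis using matching_sum_row_unbalanced[of "{a..b} - V \<inter> {a..b}" k]
    by (simp add: Diff_Int_distrib2 Diff_Int)
qed

text \<open>The bottom row has odd length, with a surplus of the colour that vertical bricks to the
  next row do not touch; removing cells of the other colour only increases it.\<close>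

lemma trapezoid_no_dents:
  assumes "k < H" "odd (lo - k)" "lo \<le> 2 * int W - k - 1"
  shows "brick_sum (trapezoid lo k H W - {k} \<times> {}) = 0"
  unfolding trapezoid_cut[OF assms(1)]
proof (rule sum.neutral, rule ballI)
  fix V assume V: "V \<in> Pow {c. even (c - k) \<and> lo \<le> c \<and> c \<le> 2 * int W - k - 2 \<and> k + 1 < H \<and> c \<notin> {}}"
  have "even (2 * int W - k - 1 - lo)" using assms(2) by presburger
  moreover have "odd (c - lo)" if "c \<in> V" for c
  proof -
    have "even (c - k)" using V that by auto
    with assms(2) show ?thesis by presburger
  qed
  ultimately have "brick_sum ({k} \<times> ({lo..2 * int W - k - 1} - V)) = 0"
    by (rule matching_sum_row_odd[OF assms(3)])
  then show "(if 0 \<in> V then 1 / 2 else 1) * brick_sum ({k} \<times> ({lo..2 * int W - k - 1} - {} - V)) *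
       brick_sum (trapezoid lo (k + 1) H W - {k + 1} \<times> V) = 0" by simp
qed

lemma chain_between:
  fixes d :: "nat \<Rightarrow> 'a::linorder"
  assumes "d 0 < c" "c < d n" "c \<notin> d ` {..n}"
  shows "\<exists>j<n. d j < c \<and> c < d (Suc j)"
  using assms
proof (induction n)
  case (Suc n)
  then have "c \<noteq> d n" by auto
  then show ?case
  proof (cases "c < d n")
    case True
    moreover have "c \<notin> d ` {..n}" using Suc.prems by auto
    ultimately have "\<exists>j<n. d j < c \<and> c < d (Suc j)" using Suc by blast
    then show ?thesis using less_SucI by blast
  next
    case False
    then show ?thesis using Suc.prems \<open>c \<noteq> d n\<close> by (intro exI[of _ n]) auto
  qed
qed auto

text \<open>If the westernmost gap of the row lies to the west of all dents, then \<open>lo' = lo - 1\<close> and \<open>d 0 = lo - 1\<close>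
  is an artificial dent just outside the row; otherwise \<open>lo' = lo\<close> and all \<open>d j\<close> are dents.\<close>

lemma trapezoid_step:
  fixes d :: "nat \<Rightarrow> int"
  assumes kH: "k + 1 < H"
    and d: "\<And>j. j < n \<Longrightarrow> d j < d (Suc j)" "\<And>j. j \<le> n \<Longrightarrow> odd (d j - k)"
    and lo: "lo' \<le> d 0" "odd (lo' - k)" "lo' \<le> lo" "lo \<le> lo' + 1" and hi: "d n \<le> 2 * int W - k - 1"
    and D: "{lo..2 * int W - k - 1} - D = {lo'..2 * int W - k - 1} - d ` {..n}"
  shows "brick_sum (trapezoid lo k H W - {k} \<times> D) =
    (\<Sum>v\<in>PiE {..<n} (\<lambda>j. gap (d j) (d (Suc j))).
       (if 0 \<in> v ` {..<n} then 1 / 2 else 1) * brick_sum (trapezoid lo (k + 1) H W - {k + 1} \<times> v ` {..<n}))"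
proof -
  define hi where "hi = 2 * int W - k - 1"
  define U where "U = {c. even (c - k) \<and> lo \<le> c \<and> c \<le> 2 * int W - k - 2 \<and> k + 1 < H \<and> c \<notin> D}"
  define f where "f = (\<lambda>V. (if 0 \<in> V then 1 / 2 else 1) * brick_sum (trapezoid lo (k + 1) H W - {k + 1} \<times> V))"
  define Q where "Q = (\<lambda>V. V \<inter> {lo'..<d 0} = {} \<and> (\<forall>j<n. card (V \<inter> {d j<..<d (Suc j)}) = 1) \<and> V \<inter> {d n + 1..<hi + 1} = {})"
  have finU: "finite U"
    by (rule finite_subset[of _ "{lo..2 * int W - k}"]) (auto simp: U_def)
  have notd: "c \<notin> d ` {..n}" if "even (c - k)" for c
    using d(2) that by fastforce
  have U_iff: "c \<in> U \<longleftrightarrow> even (c - k) \<and> lo \<le> c \<and> c < hi" for c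
  proof
    assume "even (c - k) \<and> lo \<le> c \<and> c < hi"
    moreover from this have "c \<in> {lo'..hi} - d ` {..n}" using notd[of c] lo(3) by auto
    ultimately show "c \<in> U" using D kH by (auto simp: U_def hi_def)
  qed (auto simp: U_def hi_def)
  have dn: "d j \<le> d n" if "j \<le> n" for j using chain_le[of n d j n] that d(1) by auto
  have d0: "d 0 \<le> d j" if "j \<le> n" for j using chain_le[of n d 0 j] that d(1) by auto
  have "brick_sum (trapezoid lo k H W - {k} \<times> D) = (\<Sum>V\<in>Pow U. of_bool (Q V) * f V)"
    unfolding U_def
  proof (subst trapezoid_cut, use kH in simp, rule sum.cong[OF refl], fold U_def)
    fix V assume V: "V \<in> Pow U"
    have "brick_sum ({k} \<times> ({lo..hi} - D - V)) = of_bool (Q V)"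
      unfolding hi_def D unfolding hi_def[symmetric] Q_def
      by (rule matching_sum_row_interlace[OF d lo(1,2)])
        (use hi V U_iff in \<open>auto simp: hi_def\<close>)
    then show "(if 0 \<in> V then 1 / 2 else 1) * brick_sum ({k} \<times> ({lo..2 * int W - k - 1} - D - V)) *
       brick_sum (trapezoid lo (k + 1) H W - {k + 1} \<times> V) = of_bool (Q V) * f V"
      by (simp add: f_def hi_def)
  qed
  also have "\<dots> = (\<Sum>V\<in>{V \<in> Pow U. Q V}. f V)"
    using finU by (intro sum.mono_neutral_cong_right) auto
  also have "\<dots> = (\<Sum>v\<in>PiE {..<n} (\<lambda>j. gap (d j) (d (Suc j))). f (v ` {..<n}))"
  \<comment> \<open>A set with one element in each gap and none elsewhere amounts to the function
    that lists these elements.\<close>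
  proof (rule sum.reindex_bij_witness[where i = "\<lambda>v. v ` {..<n}"
        and j = "\<lambda>V. \<lambda>j\<in>{..<n}. the_elem (V \<inter> {d j<..<d (Suc j)})"])
    fix V assume "V \<in> {V \<in> Pow U. Q V}"
    then have V: "V \<subseteq> U" "Q V" by auto
    define v where "v = (\<lambda>j\<in>{..<n}. the_elem (V \<inter> {d j<..<d (Suc j)}))"
    have v: "V \<inter> {d j<..<d (Suc j)} = {v j}" if "j < n" for j
    proof -
      have "card (V \<inter> {d j<..<d (Suc j)}) = 1" using V(2) that by (simp add: Q_def)
      then obtain x where "V \<inter> {d j<..<d (Suc j)} = {x}" by (auto simp: card_1_singleton_iff)
      then show ?thesis using that by (simp add: v_def)
    qed
    have vV: "v j \<in> V" "d j < v j" "v j < d (Suc j)" if "j < n" for j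
      using v[OF that] by auto
    have "v j \<in> gap (d j) (d (Suc j))" if "j < n" for j
    proof -
      have "even (v j - k)" using vV(1)[OF that] V(1) U_iff by blast
      moreover have "odd (d j - k)" using d(2) that by simp
      ultimately have "odd (v j - d j)" by presburger
      then show ?thesis using vV[OF that] by (simp add: gap_def)
    qed
    then have vP: "v \<in> PiE {..<n} (\<lambda>j. gap (d j) (d (Suc j)))"
      by (auto simp: v_def PiE_def extensional_def)
    have "V \<subseteq> v ` {..<n}"
    proof
      fix c assume c: "c \<in> V"
      then have cU: "even (c - k)" "lo \<le> c" "c < hi" using V(1) U_iff by auto
      have nd: "c \<notin> d ` {..n}" using notd cU by blast
      have "\<not> c < d 0" using V(2) c cU lo(3) by (auto simp: Q_def)
      moreover have "\<not> d n < c" using V(2) c cU by (auto simp: Q_def)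
      moreover have "c \<noteq> d 0" "c \<noteq> d n" using nd by auto
      ultimately obtain j where j: "j < n" "d j < c" "c < d (Suc j)"
        using chain_between[of d c n] nd by fastforce
      then have "c \<in> V \<inter> {d j<..<d (Suc j)}" using c by simp
      then have "c \<in> {v j}" unfolding v[OF j(1)] .
      then show "c \<in> v ` {..<n}" using j by auto
    qed
    then have Vv: "v ` {..<n} = V" using vV(1) by auto
    show "(\<lambda>j\<in>{..<n}. the_elem (V \<inter> {d j<..<d (Suc j)})) ` {..<n} = V"
      using Vv by (simp only: v_def)
    show "(\<lambda>j\<in>{..<n}. the_elem (V \<inter> {d j<..<d (Suc j)})) \<in> PiE {..<n} (\<lambda>j. gap (d j) (d (Suc j)))"
      using vP by (simp only: v_def)
    show "f ((\<lambda>j\<in>{..<n}. the_elem (V \<inter> {d j<..<d (Suc j)})) ` {..<n}) = f V"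
      using Vv by (simp only: v_def)
  next
    fix v assume v: "v \<in> PiE {..<n} (\<lambda>j. gap (d j) (d (Suc j)))"
    have vg: "d j < v j" "v j < d (Suc j)" "odd (v j - d j)" if "j < n" for j
      using PiE_mem[OF v, of j] that by (auto simp: gap_def)
    have vk: "even (v j - k)" if "j < n" for j
      using vg(3)[OF that] d(2)[of j] that by presburger
    have vr: "d 0 < v j" "v j < d n" if "j < n" for j
      using vg[OF that] d0[of j] dn[of "Suc j"] that by linarith+
    have one: "v ` {..<n} \<inter> {d j<..<d (Suc j)} = {v j}" if "j < n" for j
    proof -
      have uniq: "i = j" if "i < n" "d j < v i" "v i < d (Suc j)" for i
      proof (rule ccontr)
        assume "i \<noteq> j"
        then consider "i < j" | "j < i" by linarith
        then show False
        proof cases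
          case 1
          have "d (Suc i) \<le> d j" using chain_le[of n d "Suc i" j] 1 \<open>j < n\<close> d(1) by auto
          then show ?thesis using vg(2)[OF that(1)] that(2) by simp
        next
          case 2
          have "d (Suc j) \<le> d i" using chain_le[of n d "Suc j" i] 2 that(1) d(1) by auto
          then show ?thesis using vg(1)[OF that(1)] that(3) by simp
        qed
      qed
      show ?thesis
      proof
        show "v ` {..<n} \<inter> {d j<..<d (Suc j)} \<subseteq> {v j}"
        proof
          fix c assume "c \<in> v ` {..<n} \<inter> {d j<..<d (Suc j)}"
          then obtain i where "i < n" "c = v i" "d j < v i" "v i < d (Suc j)" by auto
          then show "c \<in> {v j}" using uniq[of i] by simp
        qed
      qed (use vg[OF that] that in auto)
    qed
    have Qv: "Q (v ` {..<n})"
      unfolding Q_def using one vr by force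
    have "v ` {..<n} \<subseteq> U"
    proof
      fix c assume "c \<in> v ` {..<n}"
      then obtain j where j: "j < n" "c = v j" by auto
      then show "c \<in> U" using vk[OF j(1)] vr[OF j(1)] lo hi by (auto simp: U_iff hi_def)
    qed
    then show "v ` {..<n} \<in> {V \<in> Pow U. Q V}" using Qv by simp
    show "(\<lambda>j\<in>{..<n}. the_elem (v ` {..<n} \<inter> {d j<..<d (Suc j)})) = v"
    proof
      fix j
      show "(\<lambda>j\<in>{..<n}. the_elem (v ` {..<n} \<inter> {d j<..<d (Suc j)})) j = v j"
        using one[of j] PiE_arb[OF v, of j] by (cases "j < n") auto
    qed
  qed
  finally show ?thesis by (simp add: f_def)
qed

lemma interlaced_chain:
  assumes "v \<in> PiE {..<n} (\<lambda>j. gap (d j) (d (Suc j)))" "i < j" "j < n"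
  shows "v i < v j"
  using assms(2,3)
proof (induction j)
  case (Suc j)
  have "v j < d (Suc j)" "d (Suc j) < v (Suc j)"
    using PiE_mem[OF assms(1), of j] PiE_mem[OF assms(1), of "Suc j"] Suc.prems by (auto simp: gap_def)
  then show ?case using Suc by (cases "i = j") auto
qed simp

lemma chain_card:
  fixes v :: "nat \<Rightarrow> int"
  assumes "\<And>i j. i < j \<Longrightarrow> j < n \<Longrightarrow> v i < v j"
  shows "card (v ` {..<n}) = n" "(\<Prod>c\<in>v ` {..<n}. real_of_int c) = (\<Prod>j<n. real_of_int (v j))"
    "(\<Prod>c\<in>v ` {..<n}. \<omega> c) = (\<Prod>j<n. \<omega> (v j) :: real)"
  using enumeration_inj[of n v] assms by (auto simp: card_image prod.reindex)

text \<open>The rows alternate between two normal forms: a plain Vandermonde product, and one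
  multiplied by the product of the positions. Here the western end of the row has the parity of the
  dents, so the positions above are strictly between dents and number one fewer; the plain form
  results from the other.\<close>

lemma trapezoid_step_between:
  assumes kH: "k + 1 < H" and lo: "odd (lo - k)" "0 \<le> lo" "lo \<le> 2 * int W - k - 1"
    and next_row: "\<And>V. V \<subseteq> {c. lo + 1 \<le> c \<and> c \<le> 2 * int W - k - 2 \<and> even (c - k)} \<Longrightarrow>
      brick_sum (trapezoid lo (k + 1) H W - {k + 1} \<times> V) = of_bool (card V = i) * K * ((\<Prod>c\<in>V. real_of_int c) * vander V)"
    and D: "D \<subseteq> {c. lo \<le> c \<and> c \<le> 2 * int W - k - 1 \<and> odd (c - k)}"
  shows "brick_sum (trapezoid lo k H W - {k} \<times> D) =
    of_bool (card D = Suc i) * (K / (\<Prod>j<i. 4 * (real j + 1))) * vander D"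
proof (cases "D = {}")
  case True
  then show ?thesis using trapezoid_no_dents[of k H lo W] kH lo by simp
next
  case False
  have finD: "finite D" by (rule finite_subset[of _ "{lo..2 * int W - k}"]) (use D in auto)
  then obtain n where n: "card D = Suc n" using False by (metis card_eq_0_iff not0_implies_Suc)
  obtain d where d: "\<And>i j. i < j \<Longrightarrow> j < Suc n \<Longrightarrow> d i < d j" "d ` {..<Suc n} = D"
    using sorted_enumeration[OF finD n] by blast
  have dD: "d j \<in> D" if "j \<le> n" for j using d(2) that by auto
  have dk: "odd (d j - k)" "lo \<le> d j" "d j \<le> 2 * int W - k - 1" if "j \<le> n" for j
    using dD[OF that] D by auto
  have eqD: "d ` {..n} = D" using d(2) by (simp add: lessThan_Suc_atMost)
  define P where "P = PiE {..<n} (\<lambda>j. gap (d j) (d (Suc j)))"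
  have term_eq: "(if 0 \<in> v ` {..<n} then 1 / 2 else 1) * brick_sum (trapezoid lo (k + 1) H W - {k + 1} \<times> v ` {..<n}) =
      of_bool (n = i) * K * ((\<Prod>j<n. real_of_int (v j)) * vander_fun n v)" if v: "v \<in> P" for v
  proof -
    have ch: "v i < v j" if "i < j" "j < n" for i j
      using interlaced_chain v that unfolding P_def by blast
    have g: "lo + 1 \<le> v j" "v j \<le> 2 * int W - k - 2" "even (v j - k)" if "j < n" for j
    proof -
      have vj: "d j < v j" "v j < d (Suc j)" "odd (v j - d j)"
        using PiE_mem[OF v[unfolded P_def], of j] that by (auto simp: gap_def)
      then show "lo + 1 \<le> v j" "v j \<le> 2 * int W - k - 2" using dk[of j] dk[of "Suc j"] that by auto
      show "even (v j - k)" using vj(3) dk(1)[of j] that by presburger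
    qed
    have "v ` {..<n} \<subseteq> {c. lo + 1 \<le> c \<and> c \<le> 2 * int W - k - 2 \<and> even (c - k)}" using g by auto
    from next_row[OF this] have "brick_sum (trapezoid lo (k + 1) H W - {k + 1} \<times> v ` {..<n}) =
        of_bool (n = i) * K * ((\<Prod>j<n. real_of_int (v j)) * vander_fun n v)"
      using chain_card[of n v] ch vander_enumeration[of n v] by simp
    moreover have "0 \<notin> v ` {..<n}" using g(1) lo(2) by fastforce
    ultimately show ?thesis by simp
  qed
  have "brick_sum (trapezoid lo k H W - {k} \<times> D) =
    (\<Sum>v\<in>P. (if 0 \<in> v ` {..<n} then 1 / 2 else 1) * brick_sum (trapezoid lo (k + 1) H W - {k + 1} \<times> v ` {..<n}))"
    unfolding P_def by (rule trapezoid_step[OF kH, where lo' = lo]) (use d dk eqD lo in auto)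
  also have "\<dots> = (\<Sum>v\<in>P. of_bool (n = i) * K * ((\<Prod>j<n. real_of_int (v j)) * vander_fun n v))"
    by (rule sum.cong[OF refl], rule term_eq)
  also have "\<dots> = of_bool (n = i) * K * (vander_fun (Suc n) d / (\<Prod>j<n. 4 * (real j + 1)))"
  proof -
    have "(\<Sum>v\<in>P. (\<Prod>j<n. real_of_int (v j)) * vander_fun n v) = vander_fun (Suc n) d / (\<Prod>j<n. 4 * (real j + 1))"
      unfolding P_def
    proof (rule interlace_sum_between)
      fix j assume "j < n"
      then show "d j < d (Suc j)" using d by simp
      have "odd (d j - k)" "odd (d (Suc j) - k)" using dk(1) \<open>j < n\<close> by auto
      then show "even (d (Suc j) - d j)" by presburger
    qed
    then show ?thesis by (simp flip: sum_distrib_left)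
  qed
  also have "vander_fun (Suc n) d = vander D" using vander_enumeration[of "Suc n" d] d by auto
  finally show ?thesis using n by auto
qed

text \<open>Here the western end of the row has the parity of the positions above, so there is one
  more gap to the west of all dents. The numbers agree and the plain form turns into the other
  one.\<close>

lemma trapezoid_step_below:
  assumes kH: "k + 1 < H" and lo: "even (lo - k)" "lo = 0 \<or> lo = 1"
    and next_row: "\<And>V. V \<subseteq> {c. lo \<le> c \<and> c \<le> 2 * int W - k - 2 \<and> even (c - k)} \<Longrightarrow>
      brick_sum (trapezoid lo (k + 1) H W - {k + 1} \<times> V) = of_bool (card V = i) * K * vander V"
    and D: "D \<subseteq> {c. lo + 1 \<le> c \<and> c \<le> 2 * int W - k - 1 \<and> odd (c - k)}" and W: "lo \<le> 2 * int W - k"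
  shows "brick_sum (trapezoid lo k H W - {k} \<times> D) =
    of_bool (card D = i) * (K / (\<Prod>j<i. 2 * (2 * real j + 1))) * ((\<Prod>c\<in>D. real_of_int c) * vander D)"
proof -
  have finD: "finite D" by (rule finite_subset[of _ "{lo..2 * int W - k}"]) (use D in auto)
  define n where "n = card D"
  obtain e where e: "\<And>i j. i < j \<Longrightarrow> j < n \<Longrightarrow> e i < e j" "e ` {..<n} = D"
    using sorted_enumeration[OF finD n_def[symmetric]] by blast
  define d where "d = (\<lambda>j. case j of 0 \<Rightarrow> lo - 1 | Suc j \<Rightarrow> e j)"
  have d0: "d 0 = lo - 1" and dS: "d (Suc j) = e j" for j by (simp_all add: d_def)
  have eD: "e j \<in> D" if "j < n" for j using e(2) that by auto
  have ek: "odd (e j - k)" "lo + 1 \<le> e j" "e j \<le> 2 * int W - k - 1" if "j < n" for j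
    using eD[OF that] D by auto
  have dk: "odd (d j - k)" if "j \<le> n" for j
    using that ek(1) lo(1) by (cases j) (auto simp: d0 dS)
  have dlt: "d j < d (Suc j)" if "j < n" for j
    using that ek(2)[of 0] e(1) by (cases j) (auto simp: d0 dS)
  have deven: "even (d (Suc j) - d j)" if "j < n" for j
  proof -
    have "odd (d j - k)" "odd (d (Suc j) - k)" using dk that by auto
    then show ?thesis by presburger
  qed
  have dle: "d 0 \<le> d j" if "j \<le> n" for j using chain_le[of n d 0 j] that dlt by auto
  have dhi: "d n \<le> 2 * int W - k - 1"
    using ek(3) W by (cases n) (auto simp: d0 dS)
  have rows: "{lo..2 * int W - k - 1} - D = {lo - 1..2 * int W - k - 1} - d ` {..n}"
  proof -
    have "d ` {..n} = insert (lo - 1) (e ` {..<n})"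
      by (simp add: d0 atMost_Suc_eq_insert_0 lessThan_Suc_eq_insert_0 image_image dS
          lessThan_Suc_atMost[symmetric] image_Un)
    then show ?thesis using e(2) D by auto
  qed
  define P where "P = PiE {..<n} (\<lambda>j. gap (d j) (d (Suc j)))"
  define \<omega> where "\<omega> = (\<lambda>c::int. if c = 0 then 1 / 2 else 1 :: real)"
  have term_eq: "(if 0 \<in> v ` {..<n} then 1 / 2 else 1) * brick_sum (trapezoid lo (k + 1) H W - {k + 1} \<times> v ` {..<n}) =
      of_bool (n = i) * K * ((\<Prod>j<n. \<omega> (v j)) * vander_fun n v)" if v: "v \<in> P" for v
  proof -
    have ch: "v i < v j" if "i < j" "j < n" for i j
      using interlaced_chain v that unfolding P_def by blast
    have g: "lo \<le> v j" "v j \<le> 2 * int W - k - 2" "even (v j - k)" if "j < n" for j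
    proof -
      have vj: "d j < v j" "v j < d (Suc j)" "odd (v j - d j)"
        using PiE_mem[OF v[unfolded P_def], of j] that by (auto simp: gap_def)
      then show "lo \<le> v j" using dle[of j] that by (simp add: d0)
      show "v j \<le> 2 * int W - k - 2" using vj(2) ek(3)[of j] that by (simp add: dS)
      show "even (v j - k)" using vj(3) dk[of j] that by presburger
    qed
    have "v ` {..<n} \<subseteq> {c. lo \<le> c \<and> c \<le> 2 * int W - k - 2 \<and> even (c - k)}" using g by auto
    from next_row[OF this] have "brick_sum (trapezoid lo (k + 1) H W - {k + 1} \<times> v ` {..<n}) =
        of_bool (n = i) * K * vander_fun n v"
      using chain_card[of n v] ch vander_enumeration[of n v] by simp
    moreover have "(if 0 \<in> v ` {..<n} then 1 / 2 else 1) = (\<Prod>j<n. \<omega> (v j))"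
      using prod_half[of "v ` {..<n}"] chain_card(3)[of n v \<omega>] ch by (simp add: \<omega>_def)
    ultimately show ?thesis by simp
  qed
  have "brick_sum (trapezoid lo k H W - {k} \<times> D) =
    (\<Sum>v\<in>P. (if 0 \<in> v ` {..<n} then 1 / 2 else 1) * brick_sum (trapezoid lo (k + 1) H W - {k + 1} \<times> v ` {..<n}))"
    unfolding P_def by (rule trapezoid_step[OF kH, where lo' = "lo - 1"]) (use dlt dk rows lo dhi in \<open>auto simp: d0\<close>)
  also have "\<dots> = (\<Sum>v\<in>P. of_bool (n = i) * K * ((\<Prod>j<n. \<omega> (v j)) * vander_fun n v))"
    by (rule sum.cong[OF refl], rule term_eq)
  also have "\<dots> = of_bool (n = i) * K * ((\<Prod>j<n. real_of_int (d (Suc j))) * vander_fun n (\<lambda>j. d (Suc j)) / (\<Prod>j<n. 2 * (2 * real j + 1)))"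
  proof -
    have "(\<Sum>v\<in>P. (\<Prod>j<n. \<omega> (v j)) * vander_fun n v) =
        (\<Prod>j<n. real_of_int (d (Suc j))) * vander_fun n (\<lambda>j. d (Suc j)) / (\<Prod>j<n. 2 * (2 * real j + 1))"
      unfolding P_def
    proof (rule interlace_sum_below)
      fix j assume "j < n"
      then show "d j < d (Suc j)" "even (d (Suc j) - d j)" using dlt deven by auto
    next
      fix c assume "n \<noteq> 0" "d 1 < c"
      then have "0 < c" using ek(2)[of 0] lo(2) by (auto simp: d_def)
      then show "\<omega> c = 1" by (simp add: \<omega>_def)
    next
      fix j assume "n \<noteq> 0"
      have d1: "lo + 1 \<le> d 1" "even (d 1 - d 0)" using ek(2)[of 0] deven[of 0] \<open>n \<noteq> 0\<close> by (auto simp: d_def)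
      define F where "F = (\<lambda>c. c * phi j c)"
      have tel: "2 * (2 * real j + 1) * (\<Sum>c\<in>gap p (d 1). psi j (real_of_int c)) = F (real_of_int (d 1)) - F (real_of_int p)"
        if "p \<le> d 1" "even (d 1 - p)" for p
        using sum_gap_telescope[OF that, of F] by (simp add: phi_diff F_def sum_distrib_left)
      show "2 * (2 * real j + 1) * (\<Sum>c\<in>gap (d 0) (d 1). \<omega> c * psi j (real_of_int c)) =
          real_of_int (d 1) * phi j (real_of_int (d 1))"
      \<comment> \<open>With column 0 present the gap starts at -1. Telescoping from 1 leaves
        \<open>- F 1\<close>, and the term at 0 with its weight 1/2 is worth exactly
        \<open>F 1\<close>, by \<open>phi_diff\<close> at 0 and the symmetry of \<open>phi\<close>.
        Without column 0 the gap starts at 0, where \<open>F\<close> vanishes. So both boundaries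
        give the same result.\<close>
      proof (cases "lo = 0")
        case True
        have odd: "odd (d 1)" using d1(2) True by (simp add: d0)
        have eq: "gap (- 1) (d 1) = insert 0 (gap 1 (d 1))"
          using d1 True by (auto simp: gap_def; presburger)
        have "(\<Sum>c\<in>gap 1 (d 1). \<omega> c * psi j (real_of_int c)) = (\<Sum>c\<in>gap 1 (d 1). psi j (real_of_int c))"
          by (rule sum.cong) (auto simp: \<omega>_def gap_def)
        moreover have "(\<Sum>c\<in>gap (d 0) (d 1). \<omega> c * psi j (real_of_int c)) =
            \<omega> 0 * psi j 0 + (\<Sum>c\<in>gap 1 (d 1). \<omega> c * psi j (real_of_int c))"
        proof -
          have "0 \<notin> gap 1 (d 1)" by (simp add: gap_def)
          then show ?thesis unfolding d0 True using eq by simp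
        qed
        ultimately have "2 * (2 * real j + 1) * (\<Sum>c\<in>gap (d 0) (d 1). \<omega> c * psi j (real_of_int c)) =
            (2 * (2 * real j + 1) * psi j 0) / 2 + 2 * (2 * real j + 1) * (\<Sum>c\<in>gap 1 (d 1). psi j (real_of_int c))"
          by (simp only: distrib_left) (simp add: \<omega>_def)
        also have "2 * (2 * real j + 1) * psi j 0 = 2 * phi j 1"
          using phi_diff[of 0 j] phi_minus[of j 1] by simp
        also have "2 * (2 * real j + 1) * (\<Sum>c\<in>gap 1 (d 1). psi j (real_of_int c)) = F (real_of_int (d 1)) - F 1"
          using tel[of 1] d1 True odd by (simp add: d0)
        finally show ?thesis by (simp add: F_def)
      next
        case False
        then have "lo = 1" using lo by simp
        have "(\<Sum>c\<in>gap 0 (d 1). \<omega> c * psi j (real_of_int c)) = (\<Sum>c\<in>gap 0 (d 1). psi j (real_of_int c))"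
          by (rule sum.cong) (auto simp: \<omega>_def gap_def)
        then show ?thesis using tel[of 0] d1 \<open>lo = 1\<close> by (simp add: d0 F_def)
      qed
    qed
    then show ?thesis by (simp flip: sum_distrib_left)
  qed
  also have "(\<Prod>j<n. real_of_int (d (Suc j))) = (\<Prod>c\<in>D. real_of_int c)"
    using chain_card(2)[of n e] e by (auto simp: dS)
  also have "vander_fun n (\<lambda>j. d (Suc j)) = vander D"
    using vander_enumeration[of n e] e by (auto simp: dS)
  finally show ?thesis by (auto simp: n_def)
qed

section \<open>Product formulas for trapezoids with unit dents\<close>

lemma trapezoid_last:
  assumes lo: "odd (lo - k)" "lo \<le> 2 * int W - k - 1"
    and D: "D \<subseteq> {c. lo \<le> c \<and> c \<le> 2 * int W - k - 1 \<and> odd (c - k)}"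
  shows "brick_sum (trapezoid lo k (k + 1) W - {k} \<times> D) = of_bool (card D = 1)"
proof (cases "D = {}")
  case True
  then show ?thesis using trapezoid_no_dents[of k "k + 1" lo W] lo by simp
next
  case False
  have finD: "finite D" by (rule finite_subset[of _ "{lo..2 * int W - k}"]) (use D in auto)
  then obtain n where n: "card D = Suc n" using False by (metis card_eq_0_iff not0_implies_Suc)
  obtain d where d: "\<And>i j. i < j \<Longrightarrow> j < Suc n \<Longrightarrow> d i < d j" "d ` {..<Suc n} = D"
    using sorted_enumeration[OF finD n] by blast
  have dD: "d j \<in> D" if "j \<le> n" for j using d(2) that by auto
  have dk: "odd (d j - k)" "lo \<le> d j" "d j \<le> 2 * int W - k - 1" if "j \<le> n" for j
    using dD[OF that] D by auto
  have eqD: "d ` {..n} = D" using d(2) by (simp add: lessThan_Suc_atMost)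
  have "trapezoid lo k (k + 1) W - {k} \<times> D = {k} \<times> ({lo..2 * int W - k - 1} - d ` {..n} - {})"
    unfolding eqD by (auto simp: trapezoid_def)
  then have "brick_sum (trapezoid lo k (k + 1) W - {k} \<times> D) =
      of_bool ({} \<inter> {lo..<d 0} = {} \<and> (\<forall>j<n. card ({} \<inter> {d j<..<d (Suc j)}) = 1) \<and>
        {} \<inter> {d n + 1..<2 * int W - k - 1 + 1} = {})"
    by (simp only:) (rule matching_sum_row_interlace, use d dk lo in auto)
  then show ?thesis using n by auto
qed

text \<open>Collects the denominators of the double steps from the top row down; the factor for
  \<open>m = 0\<close> is 1 and stands for the top row itself.\<close>

definition east_coeff :: "nat \<Rightarrow> real" where
  "east_coeff n = (\<Prod>m<n. 1 / (4 ^ m * fact (2 * m)))"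

lemma prod_odd_even: "(\<Prod>j<i. 2 * (2 * real j + 1)) * (\<Prod>j<i. 4 * (real j + 1)) = 4 ^ i * fact (2 * i)"
proof (induction i)
  case (Suc i)
  have "fact (2 * Suc i) = (2 * real i + 2) * ((2 * real i + 1) * fact (2 * i))"
    by (simp add: algebra_simps)
  then show ?case using Suc by (simp add: field_simps)
qed simp

text \<open>Downward induction from the top, two rows at a time. The region has
  \<open>2 * i - 1\<close> rows, and since only every second step adds a dent, its bottom row must
  have \<open>i\<close> of them.\<close>

lemma trapezoid_formula:
  assumes lo: "lo = 0 \<or> lo = 1" and WH: "lo + H \<le> 2 * int W" and oddH: "even (lo - H)"
    and i: "1 \<le> i" and D: "D \<subseteq> {c. lo \<le> c \<and> c \<le> 2 * int W - (H + 1 - 2 * int i) - 1 \<and> odd (c - (H + 1 - 2 * int i))}"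
  shows "brick_sum (trapezoid lo (H + 1 - 2 * int i) H W - {H + 1 - 2 * int i} \<times> D) =
    of_bool (card D = i) * east_coeff i * vander D"
  using i D
proof (induction i arbitrary: D rule: dec_induct)
  case base
  have "vander D = 1" if "card D = 1"
    using that unfolding vander_def by (intro prod.neutral) (auto simp: card_1_singleton_iff)
  moreover have "brick_sum (trapezoid lo (H - 1) (H - 1 + 1) W - {H - 1} \<times> D) = of_bool (card D = 1)"
  proof (rule trapezoid_last)
    show "odd (lo - (H - 1))" using oddH by presburger
    show "lo \<le> 2 * int W - (H - 1) - 1" using WH by simp
    show "D \<subseteq> {c. lo \<le> c \<and> c \<le> 2 * int W - (H - 1) - 1 \<and> odd (c - (H - 1))}" using base by simp
  qed
  ultimately show ?case by (simp add: east_coeff_def)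
next
  case (step i)
  define k where "k = H + 1 - 2 * int (Suc i)"
  have k: "k + 1 + 1 = H + 1 - 2 * int i" by (simp add: k_def)
  have odd: "odd (lo - k)" "even (lo - (k + 1))" using oddH unfolding k_def by presburger+
  have kH: "k + 1 + 1 < H" using step.hyps(1) by (simp add: k_def)
  have "brick_sum (trapezoid lo k H W - {k} \<times> D) =
      of_bool (card D = Suc i) * ((east_coeff i / (\<Prod>j<i. 2 * (2 * real j + 1))) / (\<Prod>j<i. 4 * (real j + 1))) * vander D"
  proof (rule trapezoid_step_between)
    fix V :: "int set"
    assume V: "V \<subseteq> {c. lo + 1 \<le> c \<and> c \<le> 2 * int W - k - 2 \<and> even (c - k)}"
    show "brick_sum (trapezoid lo (k + 1) H W - {k + 1} \<times> V) =
      of_bool (card V = i) * (east_coeff i / (\<Prod>j<i. 2 * (2 * real j + 1))) * ((\<Prod>c\<in>V. real_of_int c) * vander V)"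
    proof (rule trapezoid_step_below)
      fix U assume "U \<subseteq> {c. lo \<le> c \<and> c \<le> 2 * int W - (k + 1) - 2 \<and> even (c - (k + 1))}"
      then have "U \<subseteq> {c. lo \<le> c \<and> c \<le> 2 * int W - (H + 1 - 2 * int i) - 1 \<and> odd (c - (H + 1 - 2 * int i))}"
        unfolding k_def by (auto; presburger)
      from step.IH[OF this] show "brick_sum (trapezoid lo (k + 1 + 1) H W - {k + 1 + 1} \<times> U) =
          of_bool (card U = i) * east_coeff i * vander U" unfolding k .
    next
      show "V \<subseteq> {c. lo + 1 \<le> c \<and> c \<le> 2 * int W - (k + 1) - 1 \<and> odd (c - (k + 1))}" using V by auto
    qed (use lo odd kH WH in auto)
  qed (use odd kH lo WH step.prems in \<open>auto simp: k_def\<close>)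
  also have "(east_coeff i / (\<Prod>j<i. 2 * (2 * real j + 1))) / (\<Prod>j<i. 4 * (real j + 1)) = east_coeff (Suc i)"
    using prod_odd_even[of i] by (simp add: east_coeff_def field_simps)
  finally show ?case by (simp add: k_def)
qed

lemma trapezoid_east:
  assumes "1 \<le> J" "J \<le> W" "D \<subseteq> {c. 1 \<le> c \<and> c \<le> 2 * int W - 1 \<and> odd c}"
  shows "brick_sum (trapezoid 1 0 (2 * int J - 1) W - {0} \<times> D) = of_bool (card D = J) * east_coeff J * vander D"
  using trapezoid_formula[of 1 "2 * int J - 1" W J D] assms by simp

text \<open>An even number of rows is one row more than \<open>trapezoid_formula\<close> covers. The
  additional step of the second kind brings in the product of the positions.\<close>

lemma trapezoid_west:
  assumes "1 \<le> J" "J \<le> W" "D \<subseteq> {c. 1 \<le> c \<and> c \<le> 2 * int W - 1 \<and> odd c}"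
  shows "brick_sum (trapezoid 0 0 (2 * int J) W - {0} \<times> D) =
    of_bool (card D = J) * (east_coeff J / (\<Prod>j<J. 2 * (2 * real j + 1))) * ((\<Prod>c\<in>D. real_of_int c) * vander D)"
proof (rule trapezoid_step_below)
  fix V :: "int set" assume "V \<subseteq> {c. 0 \<le> c \<and> c \<le> 2 * int W - 0 - 2 \<and> even (c - 0)}"
  then show "brick_sum (trapezoid 0 (0 + 1) (2 * int J) W - {0 + 1} \<times> V) = of_bool (card V = J) * east_coeff J * vander V"
    using trapezoid_formula[of 0 "2 * int J" W J V] assms by auto
qed (use assms in auto)

section \<open>Forced lozenges\<close>

text \<open>A cell of row \<open>k\<close> without horizontal neighbours can only be matched
  upwards.\<close>

lemma forced_row:
  assumes S: "finite S" and T: "finite T"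
    and forced: "\<And>c. c \<in> T \<Longrightarrow> even (c - k) \<and> (k, c) \<in> S \<and> (k + 1, c) \<in> S \<and> (k, c - 1) \<notin> S \<and> (k, c + 1) \<notin> S"
  shows "brick_sum S = (if 0 \<in> T then 1 / 2 else 1) * brick_sum (S - {k, k + 1} \<times> T)"
  using T forced
proof (induction T rule: finite_induct)
  case (insert c T)
  let ?S = "S - {k, k + 1} \<times> T" and ?l = "{(k, c), (k + 1, c)}"
  have c: "even (c - k)" "(k, c) \<in> S" "(k + 1, c) \<in> S" "(k, c - 1) \<notin> S" "(k, c + 1) \<notin> S"
    using insert.prems by auto
  have "brick_sum ?S = brick_weight ?l * brick_sum (?S - ?l)"
  proof (rule matching_sum_forced[where f = "(k, c)"])
    fix l' assume l': "l' \<in> bricks" "l' \<subseteq> ?S" "(k, c) \<in> l'"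
    from l'(1) show "l' = ?l"
    proof (cases l' rule: brickE)
      case (horizontal k' c')
      then have "(k, c - 1) \<in> l' \<or> (k, c + 1) \<in> l'" using l'(3) by auto
      then show ?thesis using l'(2) c by auto
    next
      case (vertical k' c')
      then show ?thesis using l'(3) c(1) by auto
    qed
  qed (use S c insert.hyps in \<open>auto simp: vertical_brick\<close>)
  also have "?S - ?l = S - {k, k + 1} \<times> insert c T" by auto
  finally show ?case using insert by (auto simp: brick_weight_vertical)
qed simp

definition cell_tri :: "int \<Rightarrow> int \<Rightarrow> int \<Rightarrow> (int \<times> int) set" where
  "cell_tri k l r = {(k', c). k \<le> k' \<and> l + (k' - k) \<le> c \<and> c \<le> r - (k' - k)}"

text \<open>The cells between the unit dents in the bottom row can only be matched upwards, which
  reproduces the situation one row higher with one dent fewer.\<close>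

lemma matching_sum_cell_tri:
  assumes "finite S" "odd (l - k)" "odd (r - k)" "0 \<le> l" "cell_tri k l r \<subseteq> S"
  shows "brick_sum (S - cell_tri k l r) = brick_sum (S - {k} \<times> {c. l \<le> c \<and> c \<le> r \<and> odd (c - k)})"
  using assms
proof (induction "nat (r - l + 1)" arbitrary: S k l r rule: less_induct)
  case less
  show ?case
  proof (cases "l \<le> r")
    case False
    then have 1: "cell_tri k l r = {}" and 2: "{c. l \<le> c \<and> c \<le> r \<and> odd (c - k)} = {}"
      by (auto simp: cell_tri_def)
    show ?thesis unfolding 1 2 by simp
  next
    case True
    define S1 where "S1 = S - {k} \<times> {c. l \<le> c \<and> c \<le> r \<and> odd (c - k)}"
    define S' where "S' = S - {k} \<times> {l..r}"
    define T where "T = {c. l < c \<and> c < r \<and> even (c - k)}"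
    have mem: "(k, c) \<in> S" if "l \<le> c" "c \<le> r" for c
      using less.prems(5) that by (auto simp: cell_tri_def)
    have mem1: "(k + 1, c) \<in> S" if "l < c" "c < r" for c
      using less.prems(5) that by (auto simp: cell_tri_def)
    have "finite T" by (rule finite_subset[of _ "{l..r}"]) (auto simp: T_def)
    then have "brick_sum S1 = (if 0 \<in> T then 1 / 2 else 1) * brick_sum (S1 - {k, k + 1} \<times> T)"
    proof (rule forced_row[rotated])
      show "finite S1" using less.prems by (simp add: S1_def)
      fix c assume "c \<in> T"
      then show "even (c - k) \<and> (k, c) \<in> S1 \<and> (k + 1, c) \<in> S1 \<and> (k, c - 1) \<notin> S1 \<and> (k, c + 1) \<notin> S1"
        using mem mem1 by (auto simp: T_def S1_def)
    qed
    also have "S1 - {k, k + 1} \<times> T = S' - {k + 1} \<times> {c. l + 1 \<le> c \<and> c \<le> r - 1 \<and> odd (c - (k + 1))}"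
    proof -
      have "c = l \<or> c = r \<or> l < c \<and> c < r" if "l \<le> c" "c \<le> r" for c :: int using that by auto
      then show ?thesis using less.prems(2,3) by (fastforce simp: S1_def S'_def T_def)
    qed
    also have "brick_sum \<dots> = brick_sum (S' - cell_tri (k + 1) (l + 1) (r - 1))"
    proof (rule less.hyps[symmetric])
      show "nat (r - 1 - (l + 1) + 1) < nat (r - l + 1)" using True by simp
      show "cell_tri (k + 1) (l + 1) (r - 1) \<subseteq> S'"
        using less.prems(5) by (auto simp: cell_tri_def S'_def)
    qed (use less.prems in \<open>auto simp: S'_def\<close>)
    also have "S' - cell_tri (k + 1) (l + 1) (r - 1) = S - cell_tri k l r"
      by (force simp: cell_tri_def S'_def)
    \<comment> \<open>\<open>0 \<le> l\<close> keeps column 0 out of \<open>T\<close>, so the forced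
      bricks have weight 1.\<close>
    finally show ?thesis using less.prems(4) by (simp add: S1_def T_def)
  qed
qed

definition half_tri :: "int \<Rightarrow> nat \<Rightarrow> (int \<times> int) set" where
  "half_tri k n = {(k', c). k \<le> k' \<and> 0 \<le> c \<and> c \<le> 2 * int n - 1 - (k' - k)}"

text \<open>Unit dents at the western end isolate the even cells of row \<open>k\<close>, then the
  odd cells of the next row. After these two rows the picture recurs with one dent fewer. Exactly
  one forced brick of each round lies in column 0, whence the powers of 1/2.\<close>

lemma matching_sum_half_tri:
  assumes "finite S" "even k" "\<And>k'. (k', - 1) \<notin> S" "half_tri k n \<subseteq> S"
  shows "brick_sum (S - {k} \<times> {c. 0 \<le> c \<and> c \<le> 2 * int n - 1 \<and> odd c}) =
    (1 / 2) ^ n * brick_sum (S - half_tri k n)"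
  using assms
proof (induction n arbitrary: S k)
  case 0
  have 1: "half_tri k 0 = {}" and 2: "{c::int. 0 \<le> c \<and> c \<le> 2 * int 0 - 1 \<and> odd c} = {}"
    by (auto simp: half_tri_def)
  show ?case unfolding 1 2 by simp
next
  case (Suc n)
  define S1 where "S1 = S - {k} \<times> {c. 0 \<le> c \<and> c \<le> 2 * int (Suc n) - 1 \<and> odd c}"
  define T1 where "T1 = {c. 0 \<le> c \<and> c \<le> 2 * int n \<and> even c}"
  define S2 where "S2 = S1 - {k, k + 1} \<times> T1"
  define T2 where "T2 = {c. 1 \<le> c \<and> c \<le> 2 * int n - 1 \<and> odd c}"
  define S' where "S' = S - {k} \<times> {0..2 * int n + 1} - {k + 1} \<times> {0..2 * int n}"
  have fin: "finite T1" "finite T2"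
    by (rule finite_subset[of _ "{0..2 * int n}"]; auto simp: T1_def T2_def)+
  have mem: "(k, c) \<in> S" if "0 \<le> c" "c \<le> 2 * int n + 1" for c
    using Suc.prems(4) that by (auto simp: half_tri_def)
  have mem1: "(k + 1, c) \<in> S" if "0 \<le> c" "c \<le> 2 * int n" for c
    using Suc.prems(4) that by (auto simp: half_tri_def)
  have mem2: "(k + 1 + 1, c) \<in> S" if "0 \<le> c" "c \<le> 2 * int n - 1" for c
    using Suc.prems(4) that by (auto simp: half_tri_def)
  have "brick_sum S1 = (if 0 \<in> T1 then 1 / 2 else 1) * brick_sum (S1 - {k, k + 1} \<times> T1)"
  proof (rule forced_row)
    fix c assume c: "c \<in> T1"
    have "(k, c - 1) \<notin> S1"
      using c Suc.prems(3)[of k] by (cases "c = 0") (auto simp: T1_def S1_def)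
    then show "even (c - k) \<and> (k, c) \<in> S1 \<and> (k + 1, c) \<in> S1 \<and> (k, c - 1) \<notin> S1 \<and> (k, c + 1) \<notin> S1"
      using c mem mem1 Suc.prems(2) by (auto simp: T1_def S1_def)
  qed (use fin Suc.prems in \<open>auto simp: S1_def\<close>)
  also have "brick_sum (S1 - {k, k + 1} \<times> T1) =
      (if 0 \<in> T2 then 1 / 2 else 1) * brick_sum (S2 - {k + 1, k + 1 + 1} \<times> T2)"
    unfolding S2_def[symmetric]
  proof (rule forced_row)
    fix c assume c: "c \<in> T2"
    then show "even (c - (k + 1)) \<and> (k + 1, c) \<in> S2 \<and> (k + 1 + 1, c) \<in> S2 \<and> (k + 1, c - 1) \<notin> S2 \<and> (k + 1, c + 1) \<notin> S2"
      using mem1 mem2 Suc.prems(2) by (auto simp: T1_def T2_def S1_def S2_def)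
  qed (use fin Suc.prems in \<open>auto simp: S1_def S2_def\<close>)
  also have "S2 - {k + 1, k + 1 + 1} \<times> T2 = S' - {k + 2} \<times> {c. 0 \<le> c \<and> c \<le> 2 * int n - 1 \<and> odd c}"
  proof (rule Set.set_eqI)
    fix p :: "int \<times> int"
    obtain k' c where p: "p = (k', c)" by (cases p)
    consider "k' = k" | "k' = k + 1" | "k' = k + 2" | "k' \<noteq> k" "k' \<noteq> k + 1" "k' \<noteq> k + 2" by blast
    then show "p \<in> S2 - {k + 1, k + 1 + 1} \<times> T2 \<longleftrightarrow>
        p \<in> S' - {k + 2} \<times> {c. 0 \<le> c \<and> c \<le> 2 * int n - 1 \<and> odd c}"
    proof cases
      case 1
      have "0 \<le> c \<and> c \<le> 2 * int n + 1 \<longleftrightarrow> (0 \<le> c \<and> c \<le> 2 * int (Suc n) - 1 \<and> odd c) \<or> c \<in> T1"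
        by (auto simp: T1_def; presburger)
      then show ?thesis using 1 by (auto simp: p S2_def S1_def S'_def)
    next
      case 2
      have "0 \<le> c \<and> c \<le> 2 * int n \<longleftrightarrow> c \<in> T1 \<or> c \<in> T2"
        by (auto simp: T1_def T2_def; presburger)
      then show ?thesis using 2 by (auto simp: p S2_def S1_def S'_def)
    next
      case 3
      have "c \<in> T2 \<longleftrightarrow> 0 \<le> c \<and> c \<le> 2 * int n - 1 \<and> odd c" by (auto simp: T2_def; presburger)
      then show ?thesis using 3 by (auto simp: p S2_def S1_def S'_def)
    next
      case 4
      then show ?thesis by (auto simp: p S2_def S1_def S'_def)
    qed
  qed
  also have "brick_sum \<dots> = (1 / 2) ^ n * brick_sum (S' - half_tri (k + 2) n)"
  proof (rule Suc.IH)
    show "half_tri (k + 2) n \<subseteq> S'" using Suc.prems(4) by (auto simp: half_tri_def S'_def)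
  qed (use Suc.prems in \<open>auto simp: S'_def\<close>)
  also have "S' - half_tri (k + 2) n = S - half_tri k (Suc n)"
  proof (rule Set.set_eqI)
    fix p :: "int \<times> int"
    obtain k' c where p: "p = (k', c)" by (cases p)
    consider "k' < k" | "k' = k" | "k' = k + 1" | "k' \<ge> k + 2" by linarith
    then show "p \<in> S' - half_tri (k + 2) n \<longleftrightarrow> p \<in> S - half_tri k (Suc n)"
      by cases (auto simp: p S'_def half_tri_def)
  qed
  finally show ?case by (simp add: S1_def T1_def T2_def)
qed

section \<open>Dents of arbitrary size as rows of unit dents\<close>

definition dent_tri :: "nat \<times> nat \<Rightarrow> (int \<times> int) set" where
  "dent_tri = (\<lambda>(p, q). cell_tri 0 (2 * int p + 1) (2 * int q - 1))"

definition dent_pos :: "(nat \<times> nat) set \<Rightarrow> nat set" where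
  "dent_pos I = (\<Union>(p, q)\<in>I. {p..<q})"

text \<open>The brick coordinate of the middle of the unit segment from \<open>x\<close> to
  \<open>x + 1\<close>.\<close>

definition centre :: "nat \<Rightarrow> int" where
  "centre x = 2 * int x + 1"

lemma inj_centre: "inj centre"
  by (auto simp: inj_def centre_def)

lemma centre_interval: "centre ` {p..<q} = {c. 2 * int p + 1 \<le> c \<and> c \<le> 2 * int q - 1 \<and> odd c}"
proof (intro equalityI subsetI)
  fix c assume "c \<in> {c. 2 * int p + 1 \<le> c \<and> c \<le> 2 * int q - 1 \<and> odd c}"
  then obtain k where "c = 2 * k + 1" "2 * int p + 1 \<le> c" "c \<le> 2 * int q - 1" by (auto elim: oddE)
  then have "nat k \<in> {p..<q}" "c = centre (nat k)" by (auto simp: centre_def)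
  then show "c \<in> centre ` {p..<q}" by blast
qed (auto simp: centre_def)

lemma matching_sum_dent_tris:
  assumes I: "finite I" and S: "finite S"
    and dis: "\<And>i j. i \<in> I \<Longrightarrow> j \<in> I \<Longrightarrow> i \<noteq> j \<Longrightarrow> {fst i..<snd i} \<inter> {fst j..<snd j} = {}"
    and sub: "\<And>i. i \<in> I \<Longrightarrow> dent_tri i \<subseteq> S"
  shows "brick_sum (S - (\<Union>i\<in>I. dent_tri i)) = brick_sum (S - {0} \<times> centre ` dent_pos I)"
  using I S dis sub
proof (induction I arbitrary: S rule: finite_induct)
  case empty
  then show ?case by (simp add: dent_pos_def)
next
  case (insert i I)
  obtain p q where i: "i = (p, q)" by (cases i)
  have disj: "dent_tri i \<inter> dent_tri j = {}" if "j \<in> I" for j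
  proof -
    obtain p' q' where j: "j = (p', q')" by (cases j)
    have "{p..<q} \<inter> {p'..<q'} = {}" using insert.prems(2)[of i j] insert.hyps that i j by auto
    then have "q \<le> p \<or> q' \<le> p' \<or> q \<le> p' \<or> q' \<le> p"
      by auto
    then show ?thesis by (auto simp: i j dent_tri_def cell_tri_def)
  qed
  have "S - (\<Union>j\<in>insert i I. dent_tri j) = (S - (\<Union>j\<in>I. dent_tri j)) - dent_tri i" by auto
  also have "brick_sum \<dots> = brick_sum ((S - (\<Union>j\<in>I. dent_tri j)) - {0} \<times> centre ` {p..<q})"
  proof -
    have "dent_tri i \<subseteq> S - (\<Union>j\<in>I. dent_tri j)"
      using insert.prems(3)[of i] disj by auto
    then have "cell_tri 0 (2 * int p + 1) (2 * int q - 1) \<subseteq> S - (\<Union>j\<in>I. dent_tri j)"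
      by (simp add: i dent_tri_def)
    from matching_sum_cell_tri[OF _ _ _ _ this] show ?thesis
      using insert.prems(1) unfolding centre_interval i dent_tri_def prod.case by simp
  qed
  also have "(S - (\<Union>j\<in>I. dent_tri j)) - {0} \<times> centre ` {p..<q} = (S - {0} \<times> centre ` {p..<q}) - (\<Union>j\<in>I. dent_tri j)"
    by auto
  also have "brick_sum \<dots> = brick_sum ((S - {0} \<times> centre ` {p..<q}) - {0} \<times> centre ` dent_pos I)"
  proof (rule insert.IH)
    fix j assume j: "j \<in> I"
    have "{0} \<times> centre ` {p..<q} \<subseteq> dent_tri i"
      by (auto simp: i dent_tri_def cell_tri_def centre_interval)
    then show "dent_tri j \<subseteq> S - {0} \<times> centre ` {p..<q}" using disj[OF j] insert.prems(3)[of j] j by auto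
  qed (use insert.prems in auto)
  also have "(S - {0} \<times> centre ` {p..<q}) - {0} \<times> centre ` dent_pos I = S - {0} \<times> centre ` dent_pos (insert i I)"
    by (auto simp: dent_pos_def i)
  finally show ?case .
qed

lemma dent_cell_tri_trapezoid:
  assumes "lo \<le> 1" "{p..<q} \<subseteq> {..<W}" "p < q \<Longrightarrow> int (q - p) \<le> H"
  shows "dent_tri (p, q) \<subseteq> trapezoid lo 0 H W"
proof (cases "p < q")
  case True
  then have "q - 1 \<in> {p..<q}" by auto
  then have "q - 1 \<in> {..<W}" using assms(2) by blast
  then have "q \<le> W" using True by auto
  then show ?thesis using assms True by (auto simp: dent_tri_def cell_tri_def trapezoid_def)
qed (auto simp: dent_tri_def cell_tri_def)

text \<open>The bound on the number of dents makes every dent triangle fit under the north side, so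
  that it can be traded for unit dents.\<close>

lemma east_region:
  assumes I: "finite I" "\<And>i j. i \<in> I \<Longrightarrow> j \<in> I \<Longrightarrow> i \<noteq> j \<Longrightarrow> {fst i..<snd i} \<inter> {fst j..<snd j} = {}"
      "dent_pos I \<subseteq> {..<W}" "card (dent_pos I) \<le> J"
    and V: "V \<subseteq> {..<W}" "V \<inter> dent_pos I = {}" and J: "J \<le> W" "J = 0 \<Longrightarrow> V = {}"
  shows "brick_sum (trapezoid 1 0 (2 * int J - 1) W - (\<Union>i\<in>I. dent_tri i) - {0} \<times> centre ` V) =
    of_bool (card (dent_pos I \<union> V) = J) * east_coeff J * vander (centre ` (dent_pos I \<union> V))"
\<comment> \<open>Now the region has height -1 and no cell, and the hypotheses leave neither dents
  nor crossing positions.\<close>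
proof (cases "J = 0")
  case True
  have "finite (dent_pos I)" using I(3) finite_subset by blast
  then have "dent_pos I = {}" using I(4) True by simp
  moreover have "trapezoid 1 0 (2 * int J - 1) W = {}" using True by (auto simp: trapezoid_def)
  ultimately show ?thesis using True J by (simp add: east_coeff_def vander_def)
next
  case False
  let ?S = "trapezoid 1 0 (2 * int J - 1) W - {0} \<times> centre ` V"
  have fin: "finite (dent_pos I)" "finite V" using I(3) V(1) finite_subset by blast+
  have "trapezoid 1 0 (2 * int J - 1) W - (\<Union>i\<in>I. dent_tri i) - {0} \<times> centre ` V = ?S - (\<Union>i\<in>I. dent_tri i)" by auto
  also have "brick_sum \<dots> = brick_sum (?S - {0} \<times> centre ` dent_pos I)"
  proof (rule matching_sum_dent_tris[OF I(1) _ I(2)])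
    fix i assume i: "i \<in> I"
    obtain p q where pq: "i = (p, q)" by (cases i)
    have sub: "{p..<q} \<subseteq> dent_pos I" using i pq by (auto simp: dent_pos_def)
    have "q - p \<le> J" using card_mono[OF fin(1) sub] I(4) by simp
    then have "dent_tri i \<subseteq> trapezoid 1 0 (2 * int J - 1) W"
      using sub I(3) False unfolding pq by (intro dent_cell_tri_trapezoid) auto
    moreover have "dent_tri i \<inter> {0} \<times> centre ` V = {}"
    proof -
      have "centre v \<notin> centre ` {p..<q}" if "v \<in> V" for v
        using that V(2) sub inj_centre by (auto simp: inj_image_mem_iff)
      moreover have "odd (centre v)" for v by (simp add: centre_def)
      ultimately show ?thesis unfolding centre_interval by (force simp: pq dent_tri_def cell_tri_def)
    qed
    ultimately show "dent_tri i \<subseteq> ?S" by auto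
  qed auto
  also have "?S - {0} \<times> centre ` dent_pos I = trapezoid 1 0 (2 * int J - 1) W - {0} \<times> centre ` (dent_pos I \<union> V)" by auto
  also have "brick_sum \<dots> = of_bool (card (centre ` (dent_pos I \<union> V)) = J) * east_coeff J * vander (centre ` (dent_pos I \<union> V))"
    by (rule trapezoid_east) (use False J I(3) V(1) in \<open>auto simp: centre_def\<close>)
  also have "card (centre ` (dent_pos I \<union> V)) = card (dent_pos I \<union> V)"
    using inj_centre by (intro card_image) (auto intro: inj_on_subset)
  finally show ?thesis .
qed

definition west_coeff :: "nat \<Rightarrow> real" where
  "west_coeff n = east_coeff n / (\<Prod>j<n. 2 * (2 * real j + 1))"

text \<open>\<open>matching_sum_half_tri\<close> is solved for the region with the half triangle cut
  off, which gives \<open>2 ^ n\<close>. The other dents lie to the east of that triangle, so the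
  two replacements do not interfere.\<close>

lemma west_region:
  assumes I: "finite I" "\<And>i j. i \<in> I \<Longrightarrow> j \<in> I \<Longrightarrow> i \<noteq> j \<Longrightarrow> {fst i..<snd i} \<inter> {fst j..<snd j} = {}"
      "dent_pos I \<subseteq> {n..<W}"
    and D: "D = {..<n} \<union> dent_pos I" "card D \<le> J" "n \<le> W"
    and V: "V \<subseteq> {..<W}" "V \<inter> D = {}" and J: "J \<le> W" "J = 0 \<Longrightarrow> V = {}"
  shows "brick_sum (trapezoid 0 0 (2 * int J) W - half_tri 0 n - (\<Union>i\<in>I. dent_tri i) - {0} \<times> centre ` V) =
    2 ^ n * (of_bool (card (D \<union> V) = J) * west_coeff J * ((\<Prod>c\<in>centre ` (D \<union> V). real_of_int c) * vander (centre ` (D \<union> V))))"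
proof (cases "J = 0")
  case True
  have "finite D" using D(1) I(3) by (auto intro: finite_subset)
  then have "D = {}" using D(2) True by simp
  moreover from this have "n = 0" using D(1) by auto
  moreover have "trapezoid 0 0 (2 * int J) W = {}" using True by (auto simp: trapezoid_def)
  ultimately show ?thesis using True J by (simp add: west_coeff_def east_coeff_def vander_def)
next
  case False
  let ?R = "trapezoid 0 0 (2 * int J) W"
  define S0 where "S0 = ?R - (\<Union>i\<in>I. dent_tri i) - {0} \<times> centre ` V"
  let ?S = "?R - {0} \<times> centre ` ({..<n} \<union> V)"
  have finD: "finite D" using D(1) I(3) by (auto intro: finite_subset)
  have nJ: "n \<le> J" using card_mono[OF finD, of "{..<n}"] D by auto
  have tri_hi: "dent_tri i \<inter> {(k, c). c \<le> 2 * int n - 1} = {}" if "i \<in> I" for i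
  proof -
    obtain p q where pq: "i = (p, q)" by (cases i)
    have "{p..<q} \<subseteq> dent_pos I" using that pq by (auto simp: dent_pos_def)
    then have "{p..<q} \<subseteq> {n..<W}" using I(3) by blast
    moreover have "p < q \<Longrightarrow> p \<in> {p..<q}" by auto
    ultimately have "p < q \<Longrightarrow> n \<le> p" by auto
    then show ?thesis by (cases "p < q") (auto simp: pq dent_tri_def cell_tri_def)
  qed
  have odd_ctr: "odd (centre v)" for v by (simp add: centre_def)
  have half: "centre ` {..<n} = {c. 0 \<le> c \<and> c \<le> 2 * int n - 1 \<and> odd c}"
    unfolding lessThan_atLeast0 centre_interval by (rule Collect_cong, presburger)
  have "brick_sum (S0 - {0} \<times> centre ` {..<n}) = (1 / 2) ^ n * brick_sum (S0 - half_tri 0 n)"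
    unfolding half
  proof (rule matching_sum_half_tri)
    show "(k', - 1) \<notin> S0" for k' by (auto simp: S0_def trapezoid_def)
    have "half_tri 0 n \<subseteq> ?R" using nJ D(3) by (auto simp: half_tri_def trapezoid_def)
    moreover have "half_tri 0 n \<inter> {0} \<times> centre ` V = {}"
    proof -
      have "centre v \<notin> centre ` {..<n}" if "v \<in> V" for v
        using that V(2) D(1) inj_centre by (auto simp: inj_image_mem_iff)
      then show ?thesis using odd_ctr unfolding half by (force simp: half_tri_def)
    qed
    moreover have "half_tri 0 n \<inter> dent_tri i = {}" if "i \<in> I" for i
      using tri_hi[OF that] by (auto simp: half_tri_def)
    ultimately show "half_tri 0 n \<subseteq> S0" unfolding S0_def by blast
  qed (auto simp: S0_def)
  moreover have "brick_sum (S0 - {0} \<times> centre ` {..<n}) =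
      of_bool (card (D \<union> V) = J) * west_coeff J * ((\<Prod>c\<in>centre ` (D \<union> V). real_of_int c) * vander (centre ` (D \<union> V)))"
  proof -
    have "S0 - {0} \<times> centre ` {..<n} = ?S - (\<Union>i\<in>I. dent_tri i)" by (auto simp: S0_def)
    also have "brick_sum \<dots> = brick_sum (?S - {0} \<times> centre ` dent_pos I)"
    proof (rule matching_sum_dent_tris[OF I(1) _ I(2)])
      fix i assume i: "i \<in> I"
      obtain p q where pq: "i = (p, q)" by (cases i)
      have sub: "{p..<q} \<subseteq> dent_pos I" using i pq by (auto simp: dent_pos_def)
      have subD: "{p..<q} \<subseteq> D" using sub D(1) by auto
      have "q - p \<le> J" using card_mono[OF finD subD] D(2) by simp
      then have "dent_tri i \<subseteq> ?R"
        using sub I(3) False unfolding pq by (intro dent_cell_tri_trapezoid) auto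
      moreover have "dent_tri i \<inter> {0} \<times> centre ` ({..<n} \<union> V) = {}"
      proof -
        have "v \<notin> {p..<q}" if "v \<in> {..<n} \<union> V" for v
        proof -
          have "v \<notin> dent_pos I" using that V(2) D(1) I(3) by (auto simp: subset_iff)
          then show ?thesis using sub by blast
        qed
        then have "centre v \<notin> centre ` {p..<q}" if "v \<in> {..<n} \<union> V" for v
          using that inj_centre by (metis inj_image_mem_iff)
        then show ?thesis using odd_ctr unfolding centre_interval by (force simp: pq dent_tri_def cell_tri_def)
      qed
      ultimately show "dent_tri i \<subseteq> ?S" by auto
    qed auto
    also have "?S - {0} \<times> centre ` dent_pos I = ?R - {0} \<times> centre ` (D \<union> V)" by (auto simp: D(1))
    also have "brick_sum \<dots> = of_bool (card (centre ` (D \<union> V)) = J) * west_coeff J *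
        ((\<Prod>c\<in>centre ` (D \<union> V). real_of_int c) * vander (centre ` (D \<union> V)))"
      unfolding west_coeff_def
    proof (rule trapezoid_west)
      have "D \<union> V \<subseteq> {..<W}" using D I(3) V(1) by auto
      then show "centre ` (D \<union> V) \<subseteq> {c. 1 \<le> c \<and> c \<le> 2 * int W - 1 \<and> odd c}" by (auto simp: centre_def)
    qed (use False J in auto)
    also have "card (centre ` (D \<union> V)) = card (D \<union> V)"
      using inj_centre by (intro card_image) (auto intro: inj_on_subset)
    finally show ?thesis .
  qed
  moreover have "?R - half_tri 0 n - (\<Union>i\<in>I. dent_tri i) - {0} \<times> centre ` V = S0 - half_tri 0 n" by (auto simp: S0_def)
  ultimately show ?thesis by (simp add: power_one_over field_simps)
qed

section \<open>Dent sequences\<close>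

lemma psum_0 [simp]: "psum xs 0 = 0"
  by (simp add: psum_def)

lemma psum_Suc: "psum xs (Suc k) = psum xs k + entry xs (Suc k)"
  by (simp add: psum_def)

lemma psum_mono: "i \<le> j \<Longrightarrow> psum xs i \<le> psum xs j"
  unfolding psum_def by (intro sum_mono2) auto

lemma psum_take: "psum xs k = sum_list (take k xs)"
proof (induction k)
  case (Suc k)
  then show ?case
    by (cases "k < length xs") (auto simp: psum_Suc entry_def take_Suc_conv_app_nth)
qed simp

lemma psum_all: "length xs \<le> k \<Longrightarrow> psum xs k = sum_list xs"
  by (simp add: psum_take)

lemma psum_le: "psum xs k \<le> sum_list xs"
  using psum_mono[of k "max k (length xs)" xs] psum_all[of xs "max k (length xs)"] by simp

lemma psum_Cons: "psum (x # xs) (Suc k) = x + psum xs k"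
  by (simp add: psum_take)

lemma psum_pred: "1 \<le> i \<Longrightarrow> psum xs i = psum xs (i - 1) + entry xs i"
  using psum_Suc[of xs "i - 1"] by simp

text \<open>Positions number the unit segments of the line from the west (\<open>seg_pos\<close>) or, for the second
  sequence, with blocks counted from the point \<open>L\<close> in the east (\<open>refl_pos\<close>).  Indices beyond the
  length of the sequence contribute nothing.\<close>

definition seg_pos :: "(nat \<Rightarrow> bool) \<Rightarrow> nat list \<Rightarrow> nat set" where
  "seg_pos par xs = {x. \<exists>i\<ge>1. par i \<and> psum xs (i - 1) \<le> x \<and> x < psum xs i}"

definition refl_pos :: "(nat \<Rightarrow> bool) \<Rightarrow> nat \<Rightarrow> nat list \<Rightarrow> nat set" where
  "refl_pos par L xs = {x. \<exists>j\<ge>1. par j \<and> L - psum xs j \<le> x \<and> x < L - psum xs (j - 1)}"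

lemma seg_pos_lt: "seg_pos par xs \<subseteq> {..<sum_list xs}"
  using psum_le by (force simp: seg_pos_def intro: less_le_trans)

lemma refl_pos_bounds: "refl_pos par L xs \<subseteq> {L - sum_list xs..<L}"
proof
  fix x assume "x \<in> refl_pos par L xs"
  then obtain j where j: "L - psum xs j \<le> x" "x < L - psum xs (j - 1)" by (auto simp: refl_pos_def)
  have "L - sum_list xs \<le> L - psum xs j" using psum_le[of xs j] by simp
  then show "x \<in> {L - sum_list xs..<L}" using j by auto
qed

lemma psum_between_unique:
  assumes "psum xs (i - 1) \<le> x" "x < psum xs i" "psum xs (j - 1) \<le> x" "x < psum xs j"
  shows "i = j"
proof (rule ccontr)
  assume "i \<noteq> j"
  then consider "i < j" | "j < i" by linarith
  then show False
  proof cases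
    case 1
    then have "i \<le> j - 1" by linarith
    from psum_mono[OF this, of xs] show False using assms by linarith
  next
    case 2
    then have "j \<le> i - 1" by linarith
    from psum_mono[OF this, of xs] show False using assms by linarith
  qed
qed

lemma psum_between_exists: "x < psum xs k \<Longrightarrow> \<exists>i\<ge>1. psum xs (i - 1) \<le> x \<and> x < psum xs i"
proof (induction k)
  case (Suc k)
  then show ?case by (cases "x < psum xs k") (auto intro: exI[of _ "Suc k"])
qed simp

text \<open>Counting blocks from the east is reflecting the unit segments by
  \<open>L - 1 - x\<close>, which transfers the facts about \<open>seg_pos\<close>.\<close>

lemma refl_pos_reflect:
  assumes "sum_list xs \<le> L"
  shows "refl_pos par L xs = (\<lambda>x. L - 1 - x) ` seg_pos par xs"
proof (intro equalityI subsetI)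
  fix x assume "x \<in> refl_pos par L xs"
  then obtain j where j: "j \<ge> 1" "par j" "L - psum xs j \<le> x" "x < L - psum xs (j - 1)" by (auto simp: refl_pos_def)
  then have "L - 1 - x \<in> seg_pos par xs"
    using psum_le[of xs j] assms by (auto simp: seg_pos_def intro!: exI[of _ j])
  moreover have "x = L - 1 - (L - 1 - x)" using j by auto
  ultimately show "x \<in> (\<lambda>x. L - 1 - x) ` seg_pos par xs" by blast
next
  fix y assume "y \<in> (\<lambda>x. L - 1 - x) ` seg_pos par xs"
  then obtain x j where j: "y = L - 1 - x" "j \<ge> 1" "par j" "psum xs (j - 1) \<le> x" "x < psum xs j"
    by (auto simp: seg_pos_def)
  then show "y \<in> refl_pos par L xs"
    using psum_le[of xs j] assms by (auto simp: refl_pos_def intro!: exI[of _ j])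
qed

lemma inj_on_reflect: "(A :: nat set) \<subseteq> {..<L} \<Longrightarrow> inj_on (\<lambda>x. L - 1 - x) A"
proof (intro inj_onI)
  fix x y assume "A \<subseteq> {..<L}" "x \<in> A" "y \<in> A" and eq: "L - 1 - x = L - 1 - y"
  then have "x < L" "y < L" by auto
  then show "x = y" using eq by linarith
qed

lemma seg_pos_union: "seg_pos par xs \<union> seg_pos (\<lambda>i. \<not> par i) xs = {..<sum_list xs}"
proof
  show "{..<sum_list xs} \<subseteq> seg_pos par xs \<union> seg_pos (\<lambda>i. \<not> par i) xs"
  proof
    fix x assume "x \<in> {..<sum_list xs}"
    then have "x < psum xs (length xs)" by (simp add: psum_all)
    then obtain i where "i \<ge> 1" "psum xs (i - 1) \<le> x" "x < psum xs i"
      using psum_between_exists by blast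
    then show "x \<in> seg_pos par xs \<union> seg_pos (\<lambda>i. \<not> par i) xs"
      by (cases "par i") (auto simp: seg_pos_def)
  qed
qed (use seg_pos_lt in auto)

lemma seg_pos_disjoint: "seg_pos par xs \<inter> seg_pos (\<lambda>i. \<not> par i) xs = {}"
proof -
  have False if x: "x \<in> seg_pos par xs" "x \<in> seg_pos (\<lambda>i. \<not> par i) xs" for x
  proof -
    obtain i where i: "par i" "psum xs (i - 1) \<le> x" "x < psum xs i" using x(1) by (auto simp: seg_pos_def)
    obtain j where j: "\<not> par j" "psum xs (j - 1) \<le> x" "x < psum xs j" using x(2) by (auto simp: seg_pos_def)
    show False using psum_between_unique[OF i(2,3) j(2,3)] i(1) j(1) by simp
  qed
  then show ?thesis by blast
qed

lemma card_seg_pos: "card (seg_pos par xs) = (\<Sum>i | i \<in> {1..length xs} \<and> par i. entry xs i)"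
proof -
  have "seg_pos par xs = (\<Union>i\<in>{i \<in> {1..length xs}. par i}. {psum xs (i - 1)..<psum xs i})"
  proof (intro equalityI subsetI)
    fix x assume "x \<in> seg_pos par xs"
    then obtain i where i: "i \<ge> 1" "par i" "psum xs (i - 1) \<le> x" "x < psum xs i" by (auto simp: seg_pos_def)
    have "i \<le> length xs"
    proof (rule ccontr)
      assume "\<not> i \<le> length xs"
      then have "length xs \<le> i - 1" "length xs \<le> i" by linarith+
      then show False using i by (simp add: psum_all)
    qed
    then show "x \<in> (\<Union>i\<in>{i \<in> {1..length xs}. par i}. {psum xs (i - 1)..<psum xs i})" using i by auto
  qed (auto simp: seg_pos_def)
  also have "card \<dots> = (\<Sum>i\<in>{i \<in> {1..length xs}. par i}. card {psum xs (i - 1)..<psum xs i})"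
  proof (rule card_UN_disjoint)
    show "\<forall>i\<in>{i \<in> {1..length xs}. par i}. \<forall>j\<in>{i \<in> {1..length xs}. par i}. i \<noteq> j \<longrightarrow>
        {psum xs (i - 1)..<psum xs i} \<inter> {psum xs (j - 1)..<psum xs j} = {}"
    proof (intro ballI impI)
      fix i j :: nat assume "i \<noteq> j"
      have False if "x \<in> {psum xs (i - 1)..<psum xs i}" "x \<in> {psum xs (j - 1)..<psum xs j}" for x
        using psum_between_unique[of xs i x j] that \<open>i \<noteq> j\<close> by simp
      then show "{psum xs (i - 1)..<psum xs i} \<inter> {psum xs (j - 1)..<psum xs j} = {}" by blast
    qed
  qed auto
  also have "\<dots> = (\<Sum>i | i \<in> {1..length xs} \<and> par i. entry xs i)"
    by (intro sum.cong) (auto simp: psum_pred)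
  finally show ?thesis .
qed

lemma card_seg_pos_even: "card (seg_pos even xs) = esum xs" and card_seg_pos_odd: "card (seg_pos odd xs) = osum xs"
  by (simp_all add: card_seg_pos esum_def osum_def)

lemma card_refl_pos: "sum_list xs \<le> L \<Longrightarrow> card (refl_pos par L xs) = card (seg_pos par xs)"
  unfolding refl_pos_reflect
  by (rule card_image, rule inj_on_reflect) (use seg_pos_lt[of par xs] in auto)

lemma refl_pos_union:
  assumes "sum_list xs \<le> L"
  shows "refl_pos par L xs \<union> refl_pos (\<lambda>i. \<not> par i) L xs = {L - sum_list xs..<L}"
proof -
  have "(\<lambda>x. L - 1 - x) ` {..<n} = {L - n..<L}" if "n \<le> L" for n
  proof (intro equalityI subsetI)
    fix x assume "x \<in> {L - n..<L}"
    then have "x = L - 1 - (L - 1 - x)" "L - 1 - x \<in> {..<n}" by auto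
    then show "x \<in> (\<lambda>x. L - 1 - x) ` {..<n}" by blast
  qed (use that in auto)
  from this[OF assms] show ?thesis
    using assms by (simp add: refl_pos_reflect image_Un[symmetric] seg_pos_union)
qed

lemma refl_pos_disjoint:
  assumes "sum_list xs \<le> L"
  shows "refl_pos par L xs \<inter> refl_pos (\<lambda>i. \<not> par i) L xs = {}"
proof -
  have "inj_on (\<lambda>x. L - 1 - x) {..<sum_list xs}"
    by (rule inj_on_reflect) (use assms in auto)
  then have "(\<lambda>x. L - 1 - x) ` (seg_pos par xs \<inter> seg_pos (\<lambda>i. \<not> par i) xs) =
      (\<lambda>x. L - 1 - x) ` seg_pos par xs \<inter> (\<lambda>x. L - 1 - x) ` seg_pos (\<lambda>i. \<not> par i) xs"
    by (rule inj_on_image_Int) (use seg_pos_lt in auto)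
  then show ?thesis using assms by (simp add: refl_pos_reflect seg_pos_disjoint)
qed

text \<open>The leading 0 of \<open>t_minus\<close> shifts all places by one, so that the dents at
  odd places of the first sequence become the dents of the quartered hexagon.\<close>

lemma seg_pos_Cons_0: "seg_pos even (0 # xs) = seg_pos odd xs"
proof -
  have "x \<in> seg_pos even (0 # xs) \<longleftrightarrow> x \<in> seg_pos odd xs" for x
  proof
    assume "x \<in> seg_pos even (0 # xs)"
    then obtain i where i: "i \<ge> 1" "even i" "psum (0 # xs) (i - 1) \<le> x" "x < psum (0 # xs) i"
      by (auto simp: seg_pos_def)
    then obtain k where k: "i = Suc (Suc k)" by (metis even_Suc not0_implies_Suc not_one_le_zero odd_one One_nat_def)
    then show "x \<in> seg_pos odd xs" using i by (auto simp: seg_pos_def psum_Cons intro!: exI[of _ "Suc k"])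
  next
    assume "x \<in> seg_pos odd xs"
    then obtain i where i: "i \<ge> 1" "odd i" "psum xs (i - 1) \<le> x" "x < psum xs i" by (auto simp: seg_pos_def)
    then obtain k where "i = Suc k" by (cases i) auto
    then show "x \<in> seg_pos even (0 # xs)" using i by (auto simp: seg_pos_def psum_Cons intro!: exI[of _ "Suc i"])
  qed
  then show ?thesis by blast
qed

text \<open>The last entry \<open>z\<close> of \<open>t_minus\<close> is a block to the east of
  \<open>L\<close>; as the first block counted from the east it also exchanges the parities of the
  second sequence.\<close>

lemma refl_pos_Cons:
  "refl_pos odd (L + z) (z # xs) = {L..<L + z} \<union> refl_pos even L xs"
proof -
  have "x \<in> refl_pos odd (L + z) (z # xs) \<longleftrightarrow> x \<in> {L..<L + z} \<union> refl_pos even L xs" for x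
  proof
    assume "x \<in> refl_pos odd (L + z) (z # xs)"
    then obtain i where i: "i \<ge> 1" "odd i" "L + z - psum (z # xs) i \<le> x" "x < L + z - psum (z # xs) (i - 1)"
      by (auto simp: refl_pos_def)
    show "x \<in> {L..<L + z} \<union> refl_pos even L xs"
    proof (cases "i = 1")
      case True
      then show ?thesis using i by (simp add: psum_Cons[of z xs 0, simplified])
    next
      case False
      then have "i = Suc (Suc (i - 2))" using i(1) by linarith
      then obtain k where k: "i = Suc (Suc k)" by blast
      then show ?thesis using i by (auto simp: refl_pos_def psum_Cons intro!: exI[of _ "Suc k"])
    qed
  next
    assume "x \<in> {L..<L + z} \<union> refl_pos even L xs"
    then consider "x \<in> {L..<L + z}" | "x \<in> refl_pos even L xs" by blast
    then show "x \<in> refl_pos odd (L + z) (z # xs)"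
    proof cases
      case 1
      then show ?thesis using psum_Cons[of z xs 0] by (auto simp: refl_pos_def intro!: exI[of _ 1])
    next
      case 2
      then obtain i where i: "i \<ge> 1" "even i" "L - psum xs i \<le> x" "x < L - psum xs (i - 1)" by (auto simp: refl_pos_def)
      then obtain k where "i = Suc k" by (cases i) auto
      then show ?thesis using i by (auto simp: refl_pos_def psum_Cons intro!: exI[of _ "Suc i"])
    qed
  qed
  then show ?thesis by blast
qed

section \<open>The common form of the sequences t^+ and t^-\<close>

definition mid_list :: "nat list \<Rightarrow> nat list \<Rightarrow> nat \<Rightarrow> nat \<Rightarrow> nat \<Rightarrow> nat list" where
  "mid_list A B N m r = map (entry A) [1..<m + 1] @ [entry A (m + 1) + N + entry B (r + 1)]
     @ map (entry B) (rev [1..<r + 1])"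

lemma length_mid_list: "length (mid_list A B N m r) = m + 1 + r"
  by (simp add: mid_list_def)

lemma sum_list_entries: "sum_list (map (entry A) [1..<m + 1]) = psum A m"
  by (simp add: psum_def interv_sum_list_conv_sum_set_nat atLeastLessThanSuc_atLeastAtMost del: upt_Suc)

lemma sum_list_mid_list:
  assumes "length A \<le> m + 1" "length B \<le> r + 1"
  shows "sum_list (mid_list A B N m r) = sum_list A + N + sum_list B"
proof -
  have "sum_list (map (entry B) (rev [1..<r + 1])) = psum B r"
    using sum_list_entries[of B r] by (simp add: rev_map[symmetric] sum_list_rev del: upt_Suc)
  then have "sum_list (mid_list A B N m r) = psum A (m + 1) + N + psum B (r + 1)"
    using sum_list_entries[of A m] by (simp add: mid_list_def psum_Suc del: upt_Suc)
  then show ?thesis using assms by (simp add: psum_all)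
qed

lemma psum_mid_list_low:
  assumes "k \<le> m"
  shows "psum (mid_list A B N m r) k = psum A k"
proof -
  have "entry (mid_list A B N m r) i = entry A i" if "i \<in> {1..k}" for i
  proof -
    have "entry (mid_list A B N m r) i = mid_list A B N m r ! (i - 1)"
      using that assms by (simp add: entry_def length_mid_list)
    also have "i - 1 < m" using that assms by auto
    then have "mid_list A B N m r ! (i - 1) = entry A i"
      using that by (simp add: mid_list_def nth_append del: upt_Suc)
    finally show ?thesis .
  qed
  then show ?thesis unfolding psum_def by (intro sum.cong) auto
qed

lemma psum_mid_list_high:
  assumes "length A \<le> m + 1" "length B \<le> r + 1" "j \<le> r"
  shows "psum (mid_list A B N m r) (m + 1 + r - j) = sum_list A + N + sum_list B - psum B j"
  using assms(3)
proof (induction j)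
  case 0
  then show ?case using assms by (simp add: psum_all length_mid_list sum_list_mid_list)
next
  case (Suc j)
  let ?t = "mid_list A B N m r"
  have "psum ?t (Suc (m + 1 + r - Suc j)) = psum ?t (m + 1 + r - Suc j) + entry ?t (Suc (m + 1 + r - Suc j))"
    by (rule psum_Suc)
  moreover have "Suc (m + 1 + r - Suc j) = m + 1 + r - j" using Suc.prems by simp
  moreover have "entry ?t (m + 1 + r - j) = entry B (Suc j)"
  proof -
    have "entry ?t (m + 1 + r - j) = ?t ! (m + 1 + (r - 1 - j))"
    proof -
      have "1 \<le> m + 1 + r - j" "m + 1 + r - j \<le> length ?t" "m + 1 + r - j - 1 = m + 1 + (r - 1 - j)"
        using Suc.prems by (auto simp: length_mid_list)
      then show ?thesis by (simp add: entry_def)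
    qed
    also have "\<dots> = map (entry B) (rev [1..<r + 1]) ! (r - 1 - j)"
      by (simp add: mid_list_def nth_append del: upt_Suc)
    also have "\<dots> = entry B (Suc j)"
    proof -
      have "rev [1..<r + 1] ! (r - 1 - j) = Suc j"
        using Suc.prems by (subst rev_nth) (simp_all del: upt_Suc)
      then show ?thesis using Suc.prems by (simp del: upt_Suc)
    qed
    finally show ?thesis .
  qed
  ultimately show ?case using Suc psum_Suc[of B j] by simp
qed

text \<open>Since \<open>m\<close> is even, the merged entry has the odd number \<open>m + 1\<close>
  and is no dent. Entry \<open>j\<close> of \<open>B\<close> stands at place
  \<open>m + 2 + r - j\<close>, which for odd \<open>r\<close> is even iff \<open>j\<close> is
  odd.\<close>

lemma seg_pos_mid_list:
  assumes "length A \<le> m + 1" "length B \<le> r + 1" "even m" "odd r"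
  shows "seg_pos even (mid_list A B N m r) = seg_pos even A \<union> refl_pos odd (sum_list A + N + sum_list B) B"
    (is "seg_pos even ?t = _ \<union> refl_pos odd ?L B")
proof (rule Set.set_eqI)
  fix x
  show "x \<in> seg_pos even ?t \<longleftrightarrow> x \<in> seg_pos even A \<union> refl_pos odd ?L B"
  proof
    assume "x \<in> seg_pos even ?t"
    then obtain i where i: "i \<ge> 1" "even i" "psum ?t (i - 1) \<le> x" "x < psum ?t i" by (auto simp: seg_pos_def)
    have le: "i \<le> m + 1 + r"
    proof (rule ccontr)
      assume "\<not> i \<le> m + 1 + r"
      then have "length ?t \<le> i - 1" "length ?t \<le> i" unfolding length_mid_list by linarith+
      then show False using i by (simp add: psum_all)
    qed
    show "x \<in> seg_pos even A \<union> refl_pos odd ?L B"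
    proof (cases "i \<le> m")
      case True
      then show ?thesis using i psum_mid_list_low[of i m A B N r] psum_mid_list_low[of "i - 1" m A B N r]
        by (auto simp: seg_pos_def)
    next
      case False
      have "i \<noteq> m + 1" using i(2) assms(3) by auto
      define j where "j = m + 2 + r - i"
      have j: "1 \<le> j" "j \<le> r" "i = m + 1 + r - (j - 1)" "i - 1 = m + 1 + r - j"
        using False \<open>i \<noteq> m + 1\<close> le by (auto simp: j_def)
      have "odd j" using i(2) assms(3,4) le by (simp add: j_def)
      moreover have "psum ?t (i - 1) = ?L - psum B j" "psum ?t i = ?L - psum B (j - 1)"
        using psum_mid_list_high[OF assms(1,2), of j N] psum_mid_list_high[OF assms(1,2), of "j - 1" N] j by auto
      ultimately show ?thesis using i j by (auto simp: refl_pos_def)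
    qed
  next
    assume "x \<in> seg_pos even A \<union> refl_pos odd ?L B"
    then consider "x \<in> seg_pos even A" | "x \<in> refl_pos odd ?L B" by blast
    then show "x \<in> seg_pos even ?t"
    proof cases
      case 1
      then obtain i where i: "i \<ge> 1" "even i" "psum A (i - 1) \<le> x" "x < psum A i" by (auto simp: seg_pos_def)
      have "i \<le> length A"
      proof (rule ccontr)
        assume "\<not> i \<le> length A"
        then have "length A \<le> i - 1" "length A \<le> i" by linarith+
        then show False using i by (simp add: psum_all)
      qed
      then have "i \<le> m" using assms(1,3) i(2) by (metis Suc_eq_plus1 even_Suc le_SucE le_trans)
      then show ?thesis using i psum_mid_list_low[of i m A B N r] psum_mid_list_low[of "i - 1" m A B N r]
        by (auto simp: seg_pos_def)
    next
      case 2
      then obtain j where j: "j \<ge> 1" "odd j" "?L - psum B j \<le> x" "x < ?L - psum B (j - 1)" by (auto simp: refl_pos_def)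
      have "j \<le> length B"
      proof (rule ccontr)
        assume "\<not> j \<le> length B"
        then have "length B \<le> j - 1" "length B \<le> j" by linarith+
        then show False using j by (simp add: psum_all)
      qed
      then have "j \<le> r" using assms(2,4) j(2) by (metis Suc_eq_plus1 even_Suc le_SucE le_trans)
      define i where "i = m + 2 + r - j"
      have i: "1 \<le> i" "even i" "i = m + 1 + r - (j - 1)" "i - 1 = m + 1 + r - j"
        using \<open>j \<le> r\<close> j(1,2) assms(3,4) by (auto simp: i_def)
      have "psum ?t (i - 1) = ?L - psum B j" "psum ?t i = ?L - psum B (j - 1)"
        unfolding i(4) by (rule psum_mid_list_high[OF assms(1,2) \<open>j \<le> r\<close>])
          (subst i(3), rule psum_mid_list_high[OF assms(1,2)], use \<open>j \<le> r\<close> in simp)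
      then show ?thesis using i j by (auto simp: seg_pos_def)
    qed
  qed
qed

lemma floor_half: "nat \<lfloor>(real n + 1) / 2\<rfloor> = (n + 1) div 2"
proof -
  have "\<lfloor>(real n + 1) / 2\<rfloor> = int ((n + 1) div 2)"
    using floor_divide_of_nat_eq[of "n + 1" 2, where 'a = real] by (simp add: add.commute)
  then show ?thesis by simp
qed

lemma ceiling_half: "1 \<le> n \<Longrightarrow> nat \<lceil>(real n - 1) / 2\<rceil> = n div 2"
proof -
  assume "1 \<le> n"
  have "\<lceil>(real n - 1) / 2\<rceil> = int (n div 2)"
  proof (rule ceiling_unique)
    define q where "q = n div 2"
    have "n = 2 * q \<or> n = 2 * q + 1" unfolding q_def by presburger
    then show "real_of_int (int (n div 2)) - 1 < (real n - 1) / 2" "(real n - 1) / 2 \<le> real_of_int (int (n div 2))"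
      unfolding q_def[symmetric] by auto
  qed
  then show ?thesis by simp
qed

lemma seq_length_pos: "1 \<le> seq_length xs" "length xs \<le> seq_length xs"
  by (auto simp: seq_length_def) (metis One_nat_def Suc_leI length_greater_0_conv)

lemma t_plus_mid: "t_plus x y a b = mid_list a b (x + y) (mu' a) (mu b - 1)"
  "even (mu' a)" "odd (mu b - 1)" "length a \<le> mu' a + 1" "length b \<le> mu b - 1 + 1"
proof -
  have mu: "mu b = 2 * ((seq_length b + 1) div 2)" "mu' a = 2 * (seq_length a div 2)"
    using floor_half[of "seq_length b"] ceiling_half[of "seq_length a"] seq_length_pos[of a]
    by (simp_all add: mu_def mu'_def)
  have pos: "mu b \<ge> 1" "mu b - 1 + 1 = mu b" using mu(1) seq_length_pos[of b] by auto
  show "t_plus x y a b = mid_list a b (x + y) (mu' a) (mu b - 1)"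
    unfolding t_plus_def mid_list_def pos(2) by (simp add: add.assoc)
  show "even (mu' a)" using mu(2) by simp
  show "odd (mu b - 1)" using mu(1) pos(1) by simp
  show "length a \<le> mu' a + 1" "length b \<le> mu b - 1 + 1"
    unfolding pos(2) mu using seq_length_pos[of a] seq_length_pos[of b] by presburger+
qed

lemma entry_Cons: "entry (x # xs) (Suc k) = (if k = 0 then x else entry xs k)"
  by (auto simp: entry_def nth_Cons')

text \<open>Absorbing the outer entries 0 and \<open>z\<close> into the two sequences gives
  \<open>t_minus\<close> the same form as \<open>t_plus\<close>, with the parities that
  \<open>seg_pos_mid_list\<close> asks for.\<close>

lemma t_minus_mid: "t_minus x y z a b = mid_list (0 # a) (z # b) (x + y) (mu a) (mu' b + 1)"
  "even (mu a)" "odd (mu' b + 1)" "length (0 # a) \<le> mu a + 1" "length (z # b) \<le> mu' b + 1 + 1"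
proof -
  have mu: "mu a = 2 * ((seq_length a + 1) div 2)" "mu' b = 2 * (seq_length b div 2)"
    using floor_half[of "seq_length a"] ceiling_half[of "seq_length b"] seq_length_pos[of b]
    by (simp_all add: mu_def mu'_def)
  have pos: "mu a \<ge> 1" using mu(1) seq_length_pos[of a] by auto
  have shift: "map (entry (v # c)) [1..<n + 1] = v # map (entry c) [1..<n]" if "1 \<le> n" for v c n
    using that
  proof (induction n rule: dec_induct)
    case base
    show ?case by (simp add: entry_Cons[of v c 0, simplified])
  next
    case (step n)
    then show ?case by (simp add: entry_Cons)
  qed
  have 1: "map (entry (0 # a)) [1..<mu a + 1] = [0] @ map (entry a) [1..<mu a]"
    using shift[of "mu a" 0 a] pos by simp
  have 2: "map (entry (z # b)) (rev [1..<mu' b + 1 + 1]) = map (entry b) (rev [1..<mu' b + 1]) @ [z]"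
    using shift[of "mu' b + 1" z b] by (simp add: rev_map[symmetric] del: upt_Suc)
  have 3: "entry (0 # a) (mu a + 1) = entry a (mu a)" "entry (z # b) (mu' b + 1 + 1) = entry b (mu' b + 1)"
    using pos by (simp_all add: entry_Cons)
  show "t_minus x y z a b = mid_list (0 # a) (z # b) (x + y) (mu a) (mu' b + 1)"
    unfolding t_minus_def mid_list_def 1 2 3 by (simp add: add.assoc)
  show "even (mu a)" "odd (mu' b + 1)" using mu by auto
  show "length (0 # a) \<le> mu a + 1" "length (z # b) \<le> mu' b + 1 + 1"
    unfolding mu using seq_length_pos[of a] seq_length_pos[of b] by (simp; presburger)+
qed

section \<open>Dents as disjoint segments\<close>

definition dent_segments :: "(nat \<Rightarrow> bool) \<Rightarrow> nat list \<Rightarrow> (nat \<times> nat) set" where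
  "dent_segments par xs = (\<lambda>i. (psum xs (i - 1), psum xs i)) ` {i \<in> {1..length xs}. par i}"

definition refl_segments :: "(nat \<Rightarrow> bool) \<Rightarrow> nat \<Rightarrow> nat list \<Rightarrow> (nat \<times> nat) set" where
  "refl_segments par L xs = (\<lambda>j. (L - psum xs j, L - psum xs (j - 1))) ` {j \<in> {1..length xs}. par j}"

lemma psum_const_beyond:
  assumes "\<not> i \<le> length xs"
  shows "psum xs (i - 1) = psum xs i"
proof -
  have "length xs \<le> i - 1" "length xs \<le> i" using assms by linarith+
  then show ?thesis by (simp add: psum_all)
qed

lemma dent_pos_dent_segments: "dent_pos (dent_segments par xs) = seg_pos par xs"
proof (intro equalityI subsetI)
  fix x assume "x \<in> seg_pos par xs"
  then obtain i where i: "i \<ge> 1" "par i" "psum xs (i - 1) \<le> x" "x < psum xs i" by (auto simp: seg_pos_def)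
  then have "i \<le> length xs" using psum_const_beyond[of i xs] by (metis leD)
  then show "x \<in> dent_pos (dent_segments par xs)" using i by (auto simp: dent_pos_def dent_segments_def)
qed (auto simp: dent_pos_def dent_segments_def seg_pos_def)

lemma dent_pos_refl_segments: "dent_pos (refl_segments par L xs) = refl_pos par L xs"
proof (intro equalityI subsetI)
  fix x assume "x \<in> refl_pos par L xs"
  then obtain i where i: "i \<ge> 1" "par i" "L - psum xs i \<le> x" "x < L - psum xs (i - 1)" by (auto simp: refl_pos_def)
  then have "i \<le> length xs" using psum_const_beyond[of i xs] by (metis leD)
  then show "x \<in> dent_pos (refl_segments par L xs)" using i by (auto simp: dent_pos_def refl_segments_def)
qed (auto simp: dent_pos_def refl_segments_def refl_pos_def)

lemma dent_pos_Un: "dent_pos (I \<union> J) = dent_pos I \<union> dent_pos J"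
  by (auto simp: dent_pos_def)

lemma finite_dent_segments: "finite (dent_segments par xs)" "finite (refl_segments par L xs)"
  by (simp_all add: dent_segments_def refl_segments_def)

lemma dent_segments_disjoint:
  assumes "s \<in> dent_segments par xs" "t \<in> dent_segments par xs" "s \<noteq> t"
  shows "{fst s..<snd s} \<inter> {fst t..<snd t} = {}"
proof -
  obtain i j where ij: "s = (psum xs (i - 1), psum xs i)" "t = (psum xs (j - 1), psum xs j)"
    using assms(1,2) by (auto simp: dent_segments_def)
  then have "i \<noteq> j" using assms(3) by auto
  have False if "x \<in> {fst s..<snd s}" "x \<in> {fst t..<snd t}" for x
    using psum_between_unique[of xs i x j] that \<open>i \<noteq> j\<close> by (simp add: ij)
  then show ?thesis by blast
qed

lemma refl_segments_disjoint:
  assumes "s \<in> refl_segments par L xs" "t \<in> refl_segments par L xs" "s \<noteq> t" "sum_list xs \<le> L"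
  shows "{fst s..<snd s} \<inter> {fst t..<snd t} = {}"
proof -
  obtain i j where ij: "s = (L - psum xs i, L - psum xs (i - 1))" "t = (L - psum xs j, L - psum xs (j - 1))"
    using assms(1,2) by (auto simp: refl_segments_def)
  then have "i \<noteq> j" using assms(3) by auto
  have False if "x \<in> {fst s..<snd s}" "x \<in> {fst t..<snd t}" for x
  proof -
    have x: "L - psum xs i \<le> x" "x < L - psum xs (i - 1)" "L - psum xs j \<le> x" "x < L - psum xs (j - 1)"
      using that by (auto simp: ij)
    have "x < L" using x(2) by linarith
    have "psum xs (i - 1) \<le> L - 1 - x" using x(2) by linarith
    moreover have "psum xs (j - 1) \<le> L - 1 - x" using x(4) by linarith
    moreover have "L - 1 - x < psum xs i" using x(1) \<open>x < L\<close> by linarith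
    moreover have "L - 1 - x < psum xs j" using x(3) \<open>x < L\<close> by linarith
    ultimately
    show False using psum_between_unique[of xs i "L - 1 - x" j] \<open>i \<noteq> j\<close> by blast
  qed
  then show ?thesis by blast
qed

lemma dents_disjoint_Un:
  assumes I: "\<And>i j. i \<in> I \<Longrightarrow> j \<in> I \<Longrightarrow> i \<noteq> j \<Longrightarrow> {fst i..<snd i} \<inter> {fst j..<snd j} = {}"
    and J: "\<And>i j. i \<in> J \<Longrightarrow> j \<in> J \<Longrightarrow> i \<noteq> j \<Longrightarrow> {fst i..<snd i} \<inter> {fst j..<snd j} = {}"
    and IJ: "dent_pos I \<inter> dent_pos J = {}"
    and ij: "i \<in> I \<union> J" "j \<in> I \<union> J" "i \<noteq> j"
  shows "{fst i..<snd i} \<inter> {fst j..<snd j} = {}"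
proof -
  have sub: "{fst i..<snd i} \<subseteq> dent_pos K" if "i \<in> K" for i K
    using that by (force simp: dent_pos_def)
  have sep: "A \<inter> B = {}" if "A \<subseteq> dent_pos I" "B \<subseteq> dent_pos J" for A B
    using that IJ by auto
  consider "i \<in> I" "j \<in> I" | "i \<in> J" "j \<in> J" | "i \<in> I" "j \<in> J" | "i \<in> J" "j \<in> I"
    using ij by auto
  then show ?thesis
  proof cases
    case 1
    then show ?thesis using I ij(3) by simp
  next
    case 2
    then show ?thesis using J ij(3) by simp
  next
    case 3
    then show ?thesis using sep[OF sub sub] by simp
  next
    case 4
    then show ?thesis using sep[OF sub sub, of j i] by (simp add: Int_commute)
  qed
qed

section \<open>Reflection in the line and the weight of column 0\<close>

lemma cell_image_diff: "cell ` (R - S) = cell ` R - cell ` S"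
  by (rule image_set_diff[OF inj_cell])

lemma cell_up_triangle: "cell ` up_triangle (real p) (real q) = dent_tri (p, q)"
  unfolding cells_up_triangle by (auto simp: dent_tri_def cell_tri_def)

text \<open>Row \<open>k\<close> lies between the heights \<open>k\<close> and \<open>k + 1\<close>,
  so reflection in height 0 exchanges rows \<open>k\<close> and \<open>- 1 - k\<close>. It lets the
  lower part be treated as a region with its dents at the bottom.\<close>

definition reflect :: "int \<times> int \<Rightarrow> int \<times> int" where
  "reflect = (\<lambda>(k, c). (- 1 - k, c))"

lemma reflect_reflect [simp]: "reflect (reflect p) = p"
  by (simp add: reflect_def split_def)

lemma inj_reflect: "inj reflect"
  by (metis reflect_reflect injI)

lemma reflect_image_iff: "p \<in> reflect ` S \<longleftrightarrow> reflect p \<in> S"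
  by (metis reflect_reflect image_iff)

lemma reflect_bricks:
  assumes "l \<in> bricks"
  shows "reflect ` l \<in> bricks"
  using assms
proof (cases l rule: brickE)
  case (horizontal k c)
  then show ?thesis by (simp add: reflect_def brick_iff)
next
  case (vertical k c)
  then have "even (c - (- 2 - k))" by presburger
  then show ?thesis using vertical by (simp add: reflect_def brick_iff)
qed

lemma reflect_image_reflect: "reflect ` reflect ` l = l"
  by (simp add: image_image)

lemma brick_weight_reflect: "brick_weight (reflect ` l) = brick_weight l"
proof -
  have "\<exists>k. reflect ` l = {(k, 0), (k + 1, 0)}" if l: "\<exists>k. l = {(k, 0), (k + 1, 0)}" for l :: "(int \<times> int) set"
  proof -
    obtain k where "l = {(k, 0), (k + 1, 0)}" using l by blast
    then have "reflect ` l = {(- 2 - k, 0), (- 2 - k + 1, 0)}" by (auto simp: reflect_def)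
    then show ?thesis by blast
  qed
  from this[of l] this[of "reflect ` l"] show ?thesis
    unfolding reflect_image_reflect by (auto simp: brick_weight_def)
qed

lemma matching_sum_reflect: "brick_sum (reflect ` S) = brick_sum S"
proof (rule matching_sum_image)
  show "reflect ` l \<in> bricks \<longleftrightarrow> l \<in> bricks" for l
    using reflect_bricks[of l] reflect_bricks[of "reflect ` l"] unfolding reflect_image_reflect by blast
qed (use inj_reflect brick_weight_reflect in \<open>auto intro: inj_on_subset\<close>)

lemma cell_down_triangle: "cell ` down_triangle (real p) (real q) = reflect ` dent_tri (p, q)"
  unfolding cells_down_triangle
proof (rule Set.set_eqI)
  fix p' :: "int \<times> int"
  show "p' \<in> {(k, c). k < 0 \<and> 2 * int p - k \<le> c \<and> c \<le> 2 * int q + k} \<longleftrightarrow> p' \<in> reflect ` dent_tri (p, q)"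
    unfolding reflect_image_iff by (cases p') (auto simp: reflect_def dent_tri_def cell_tri_def)
qed

lemma curve_edge_iff:
  "height w = height v + 1 \<Longrightarrow> {v, w} \<in> curve_edges c lo hi \<longleftrightarrow>
     lo \<le> height v \<and> height w \<le> hi \<and> xcoord v = c (height v) \<and> xcoord w = c (height w)"
  (is "_ \<Longrightarrow> _ \<longleftrightarrow> ?P v w")
proof
  assume h: "height w = height v + 1" and "{v, w} \<in> curve_edges c lo hi"
  then obtain v' w' where "{v, w} = {v', w'}" "height w' = height v' + 1" "?P v' w'"
    unfolding curve_edges_def by blast
  moreover from this h have "v' = v" "w' = w" by (auto simp: doubleton_eq_iff)
  ultimately show "?P v w" by simp
next
  assume "height w = height v + 1" "?P v w"
  then show "{v, w} \<in> curve_edges c lo hi" unfolding curve_edges_def by blast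
qed

text \<open>A vertical lozenge with both western sides on the zigzag has its western vertex at
  abscissa -1/2, hence its centres in column 0. The hypothesis on \<open>R\<close> guarantees that
  the sides of any lozenge of column 0 belong to the given stretch of the zigzag.\<close>

lemma half_weight_brick_weight:
  assumes R: "\<And>k. (k, 0) \<in> cell ` R \<Longrightarrow> lo \<le> k \<and> k < hi" and l: "l \<subseteq> R" "is_lozenge l"
  shows "brick_weight (cell ` l) = half_weight (curve_edges zig_west lo hi) l"
proof -
  let ?Z = "curve_edges zig_west lo hi"
  let ?P = "\<exists>k. cell ` l = {(k, 0), (k + 1, 0)}"
  let ?Q = "\<exists>i k. l = {Up i k, Down i k} \<and> {(i, k), (i, k + 1)} \<in> ?Z \<and> {(i, k), (i + 1, k - 1)} \<in> ?Z"
  have e1: "{(i, k), (i, k + 1)} \<in> ?Z \<longleftrightarrow> lo \<le> k \<and> k + 1 \<le> hi \<and> xcoord (i, k) = zig_west k \<and> xcoord (i, k + 1) = zig_west (k + 1)"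
    for i k using curve_edge_iff[of "(i, k + 1)" "(i, k)"] by simp
  have e2: "{(i, k), (i + 1, k - 1)} \<in> ?Z \<longleftrightarrow> lo \<le> k - 1 \<and> k \<le> hi \<and> xcoord (i + 1, k - 1) = zig_west (k - 1) \<and> xcoord (i, k) = zig_west k"
    for i k using curve_edge_iff[of "(i, k)" "(i + 1, k - 1)"] by (simp add: insert_commute)
  have "?P \<longleftrightarrow> ?Q"
  proof
    assume ?P
    then obtain k where k: "cell ` l = {(k, 0), (k + 1, 0)}" by blast
    have ev: "even k" using l(2) k by (simp add: is_lozenge_iff brick_iff)
    then obtain j where j: "k = 2 * j" by (auto elim: evenE)
    have "cell ` {Up (- j - 1) (k + 1), Down (- j - 1) (k + 1)} = cell ` l"
      unfolding k using j by auto
    then have leq: "l = {Up (- j - 1) (k + 1), Down (- j - 1) (k + 1)}"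
      using inj_image_eq_iff[OF inj_cell] by metis
    have "(k, 0) \<in> cell ` R" "(k + 1, 0) \<in> cell ` R" using l(1) k by blast+
    then have b: "lo \<le> k" "k + 1 < hi" using R by blast+
    have x: "xcoord (- j - 1, k + 1) = zig_west (k + 1)" "xcoord (- j - 1, k + 1 + 1) = zig_west (k + 1 + 1)"
      "xcoord (- j - 1 + 1, k + 1 - 1) = zig_west (k + 1 - 1)"
      using j by (auto simp: xcoord_def zig_west_def field_simps)
    show ?Q
    proof (intro exI conjI)
      show "l = {Up (- j - 1) (k + 1), Down (- j - 1) (k + 1)}" by (rule leq)
      show "{(- j - 1, k + 1), (- j - 1, k + 1 + 1)} \<in> ?Z" unfolding e1 using b x by simp
      show "{(- j - 1, k + 1), (- j - 1 + 1, k + 1 - 1)} \<in> ?Z" unfolding e2 using b x by simp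
    qed
  next
    assume ?Q
    then obtain i k where ik: "l = {Up i k, Down i k}" "xcoord (i, k) = zig_west k" "xcoord (i, k + 1) = zig_west (k + 1)"
      unfolding e1 e2 by blast
    \<comment> \<open>Upwards along the side the abscissa grows by 1/2, whereas from an even height
      the zigzag turns west.\<close>
    have "odd k"
      using ik(2,3) by (auto simp: xcoord_def zig_west_def field_simps split: if_splits)
    then have "2 * i + k + 1 = 0"
      using ik(2) by (simp add: xcoord_def zig_west_def field_simps)
    then have "cell ` l = {(k - 1, 0), (k - 1 + 1, 0)}" using ik(1) by auto
    then show ?P by blast
  qed
  then show ?thesis by (simp add: brick_weight_def half_weight_def)
qed

section \<open>Product formulas for K and Q'\<close>

lemma finite_seg_pos: "finite (seg_pos par xs)"
  by (rule finite_subset[OF seg_pos_lt]) simp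

lemma osum_esum: "osum xs + esum xs = sum_list xs"
proof -
  have "card (seg_pos even xs \<union> seg_pos odd xs) = card (seg_pos even xs) + card (seg_pos odd xs)"
    using seg_pos_disjoint[of even xs] by (intro card_Un_disjoint) (simp_all add: finite_seg_pos)
  then show ?thesis using seg_pos_union[of even xs] by (simp add: card_seg_pos_even card_seg_pos_odd)
qed

lemma cell_quartered_dents: "cell ` quartered_dents t = (\<Union>s\<in>dent_segments even t. dent_tri s)"
proof -
  have "{i \<in> {1..length t}. even i} = (\<lambda>i. 2 * i) ` {1..length t div 2}"
  proof (intro equalityI subsetI)
    fix i assume "i \<in> {i \<in> {1..length t}. even i}"
    then have "i = 2 * (i div 2)" "i div 2 \<in> {1..length t div 2}" by (auto elim: evenE)
    then show "i \<in> (\<lambda>i. 2 * i) ` {1..length t div 2}" by blast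
  qed auto
  then show ?thesis
    by (simp add: quartered_dents_def dent_segments_def image_UN cell_up_triangle)
qed

text \<open>The region has no cell in column 0, so the weighted sum is the number of tilings. The
  number of dents matches the height by the definition of \<open>esum\<close>.\<close>

lemma Kfun_formula: "real (Kfun t) = east_coeff (esum t) * vander (centre ` seg_pos even t)"
proof (cases "esum t \<ge> 1")
  case False
  then have "card (seg_pos even t) = 0" by (simp add: card_seg_pos_even)
  then have "seg_pos even t = {}" by (simp add: finite_seg_pos)
  moreover have "esum t = 0" using False by simp
  ultimately show ?thesis by (simp add: Kfun_def east_coeff_def vander_def)
next
  case True
  let ?R = "strip 0 (2 * int (esum t) - 1) zig_east (quartered_east t) - quartered_dents t"
  let ?T = "trapezoid 1 0 (2 * int (esum t) - 1) (sum_list t)"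
  have east: "quartered_east t = (\<lambda>k. real (sum_list t) - real_of_int k / 2)"
    by (simp add: quartered_east_def osum_esum fun_eq_iff)
  have cells: "cell ` ?R = ?T - (\<Union>s\<in>dent_segments even t. dent_tri s) - {0} \<times> centre ` {}"
    unfolding cell_image_diff cell_quartered_dents east cells_strip_east by (auto simp: trapezoid_def)
  have "real (Kfun t) = tiling_sum (\<lambda>_. 1) ?R"
    using True by (simp add: Kfun_def tiling_sum_def)
  also have "\<dots> = brick_sum (cell ` ?R)"
  proof (rule tiling_sum_cells)
    fix l assume "l \<subseteq> ?R" "is_lozenge l"
    then have "cell ` l \<subseteq> ?T" using cells by blast
    then show "brick_weight (cell ` l) = 1" by (auto simp: brick_weight_def trapezoid_def)
  qed
  also have "\<dots> = of_bool (card (dent_pos (dent_segments even t) \<union> {}) = esum t) * east_coeff (esum t) * vander (centre ` (dent_pos (dent_segments even t) \<union> {}))"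
    unfolding cells
  proof (rule east_region)
    show "card (dent_pos (dent_segments even t)) \<le> esum t" by (simp add: dent_pos_dent_segments card_seg_pos_even)
    show "esum t \<le> sum_list t" using osum_esum[of t] by simp
  qed (use finite_dent_segments dent_segments_disjoint seg_pos_lt[of even t] in \<open>auto simp: dent_pos_dent_segments\<close>)
  finally show ?thesis by (simp add: dent_pos_dent_segments card_seg_pos_even)
qed

lemma Qprime_formula:
  "Qprime t = west_coeff (esum t) * ((\<Prod>c\<in>centre ` seg_pos even t. real_of_int c) * vander (centre ` seg_pos even t))"
proof -
  let ?R = "strip 0 (2 * int (esum t)) zig_west (quartered_east t) - quartered_dents t"
  let ?T = "trapezoid 0 0 (2 * int (esum t)) (sum_list t)"
  have east: "quartered_east t = (\<lambda>k. real (sum_list t) - real_of_int k / 2)"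
    by (simp add: quartered_east_def osum_esum fun_eq_iff)
  have h0: "half_tri 0 0 = {}" by (auto simp: half_tri_def)
  have cells: "cell ` ?R = ?T - half_tri 0 0 - (\<Union>s\<in>dent_segments even t. dent_tri s) - {0} \<times> centre ` {}"
    unfolding cell_image_diff cell_quartered_dents east cells_strip_west h0 by (auto simp: trapezoid_def)
  have "Qprime t = brick_sum (cell ` ?R)"
    unfolding Qprime_def
  proof (rule tiling_sum_cells, rule half_weight_brick_weight)
    fix k assume "(k, 0) \<in> cell ` ?R"
    then have "(k, 0) \<in> ?T" using cells by blast
    then show "0 \<le> k \<and> k < 2 * int (esum t)" by (auto simp: trapezoid_def)
  qed
  also have "\<dots> = 2 ^ 0 * (of_bool (card (seg_pos even t \<union> {}) = esum t) * west_coeff (esum t) *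
      ((\<Prod>c\<in>centre ` (seg_pos even t \<union> {}). real_of_int c) * vander (centre ` (seg_pos even t \<union> {}))))"
    unfolding cells
  proof (rule west_region)
    show "card (seg_pos even t) \<le> esum t" by (simp add: card_seg_pos_even)
    show "esum t \<le> sum_list t" using osum_esum[of t] by simp
  qed (use finite_dent_segments dent_segments_disjoint seg_pos_lt[of even t] in \<open>auto simp: dent_pos_dent_segments\<close>)
  finally show ?thesis by (simp add: card_seg_pos_even)
qed

text \<open>A mixed pair may come in either order. As all elements are non-negative, the absolute
  value picks the sign that the increasing order has.\<close>

lemma vander_union:
  assumes "finite A" "finite B" "A \<inter> B = {}" "\<And>c. c \<in> A \<union> B \<Longrightarrow> 0 \<le> c"
  shows "vander (A \<union> B) = vander A * vander B * (\<Prod>v\<in>A. \<Prod>u\<in>B. \<bar>(real_of_int v)\<^sup>2 - (real_of_int u)\<^sup>2\<bar>)"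
proof -
  let ?g = "\<lambda>(p, q). (real_of_int q)\<^sup>2 - (real_of_int p)\<^sup>2"
  define XA where "XA = {(p, q). p \<in> A \<and> q \<in> A \<and> p < q}"
  define XB where "XB = {(p, q). p \<in> B \<and> q \<in> B \<and> p < q}"
  define XM where "XM = {(p, q). (p \<in> A \<and> q \<in> B \<or> p \<in> B \<and> q \<in> A) \<and> p < q}"
  have fin: "finite XA" "finite XB" "finite XM"
    by (rule finite_subset[of _ "(A \<union> B) \<times> (A \<union> B)"]; use assms in \<open>auto simp: XA_def XB_def XM_def\<close>)+
  have split: "{(p, q). p \<in> A \<union> B \<and> q \<in> A \<union> B \<and> p < q} = XA \<union> XB \<union> XM"
    by (auto simp: XA_def XB_def XM_def)
  have dis: "XA \<inter> XB = {}" "(XA \<union> XB) \<inter> XM = {}"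
    using assms(3) by (auto simp: XA_def XB_def XM_def)
  have "vander (A \<union> B) = prod ?g XA * prod ?g XB * prod ?g XM"
    unfolding vander_def split using fin dis by (simp add: prod.union_disjoint)
  also have "prod ?g XM = (\<Prod>(v, u)\<in>A \<times> B. \<bar>(real_of_int v)\<^sup>2 - (real_of_int u)\<^sup>2\<bar>)"
  proof (rule prod.reindex_bij_witness[where i = "\<lambda>(v, u). (min v u, max v u)" and
        j = "\<lambda>(p, q). if p \<in> A then (p, q) else (q, p)"])
    fix t assume "t \<in> XM"
    then obtain p q where t: "t = (p, q)" "p < q" and pq: "p \<in> A \<and> q \<in> B \<or> p \<in> B \<and> q \<in> A"
      by (auto simp: XM_def)
    have nn: "0 \<le> p" "0 \<le> q" using pq assms(4) by auto
    have "(real_of_int p)\<^sup>2 \<le> (real_of_int q)\<^sup>2" using nn t(2) by (intro power_mono) auto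
    then show "(case (case t of (p, q) \<Rightarrow> if p \<in> A then (p, q) else (q, p)) of (v, u) \<Rightarrow>
        \<bar>(real_of_int v)\<^sup>2 - (real_of_int u)\<^sup>2\<bar>) = (case t of (p, q) \<Rightarrow> (real_of_int q)\<^sup>2 - (real_of_int p)\<^sup>2)"
      by (simp add: t(1))
    show "(case (case t of (p, q) \<Rightarrow> if p \<in> A then (p, q) else (q, p)) of (v, u) \<Rightarrow> (min v u, max v u)) = t"
      using t by auto
    show "(case t of (p, q) \<Rightarrow> if p \<in> A then (p, q) else (q, p)) \<in> A \<times> B"
      using t(1) pq assms(3) by auto
  next
    fix t assume "t \<in> A \<times> B"
    then obtain v u where t: "t = (v, u)" "v \<in> A" "u \<in> B" by auto
    then have "v \<noteq> u" "u \<notin> A" using assms(3) by auto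
    then show "(case (case t of (v, u) \<Rightarrow> (min v u, max v u)) of (p, q) \<Rightarrow> if p \<in> A then (p, q) else (q, p)) = t"
      "(case t of (v, u) \<Rightarrow> (min v u, max v u)) \<in> XM"
      using t by (auto simp: XM_def min_def max_def)
  qed
  also have "\<dots> = (\<Prod>v\<in>A. \<Prod>u\<in>B. \<bar>(real_of_int v)\<^sup>2 - (real_of_int u)\<^sup>2\<bar>)"
    by (rule prod.cartesian_product[symmetric])
  finally show ?thesis by (simp add: vander_def XA_def XB_def)
qed

lemma vander_pos:
  assumes "finite A" "\<And>c. c \<in> A \<Longrightarrow> 0 \<le> c"
  shows "vander A > 0"
  unfolding vander_def
proof (rule prod_pos, clarify)
  fix p q assume "p \<in> A" "q \<in> A" "p < q"
  then have "(real_of_int p)\<^sup>2 < (real_of_int q)\<^sup>2" using assms(2) by (intro power_strict_mono) auto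
  then show "0 < (real_of_int q)\<^sup>2 - (real_of_int p)\<^sup>2" by simp
qed

section \<open>Cutting along the line\<close>

lemma dent_cell_tri_row0:
  "(0, centre v) \<in> dent_tri (p, q) \<longleftrightarrow> p \<le> v \<and> v < q"
  by (auto simp: dent_tri_def cell_tri_def centre_def)

lemma dents_row0: "(0, centre v) \<in> (\<Union>s\<in>I. dent_tri s) \<longleftrightarrow> v \<in> dent_pos I"
  by (force simp: dent_pos_def dent_cell_tri_row0)

lemma odd_nonneg_centre: "odd c \<Longrightarrow> 0 \<le> c \<Longrightarrow> \<exists>v. c = centre v"
proof -
  assume "odd c" "0 \<le> c"
  then obtain k where "c = 2 * k + 1" "0 \<le> k" by (auto elim!: oddE)
  then have "c = centre (nat k)" by (simp add: centre_def)
  then show ?thesis by blast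
qed

lemma UN_if_split:
  "(\<Union>i\<in>A. (if p i then u else d) (f i) (g i)) =
     (\<Union>i\<in>{i \<in> A. p i}. u (f i) (g i)) \<union> (\<Union>i\<in>{i \<in> A. \<not> p i}. d (f i) (g i))"
  by (auto split: if_splits)

definition up_dents :: "nat \<Rightarrow> nat list \<Rightarrow> nat list \<Rightarrow> (nat \<times> nat) set" where
  "up_dents L a b = dent_segments even a \<union> refl_segments odd L b"

text \<open>The segment from \<open>L\<close> to \<open>L + z\<close> produces the kink: a straight
  east side from \<open>L + z\<close> with this dent removed is the boundary that first moves east
  by \<open>z / 2\<close> and then west. The first entry of \<open>a\<close> is absent because its
  half triangle is removed separately.\<close>

definition down_dents :: "nat \<Rightarrow> nat \<Rightarrow> nat list \<Rightarrow> nat list \<Rightarrow> (nat \<times> nat) set" where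
  "down_dents L z a b = dent_segments (\<lambda>i. odd i \<and> i \<noteq> 1) a \<union> refl_segments even L b \<union> {(L, L + z)}"

definition upper_cells :: "nat \<Rightarrow> nat \<Rightarrow> nat list \<Rightarrow> nat list \<Rightarrow> (int \<times> int) set" where
  "upper_cells J L a b = trapezoid 1 0 (2 * int J - 1) L - (\<Union>s\<in>up_dents L a b. dent_tri s)"

definition lower_cells :: "nat \<Rightarrow> nat \<Rightarrow> nat \<Rightarrow> nat list \<Rightarrow> nat list \<Rightarrow> (int \<times> int) set" where
  "lower_cells J L z a b = trapezoid 0 0 (2 * int J) (L + z) - half_tri 0 (entry a 1) - (\<Union>s\<in>down_dents L z a b. dent_tri s)"

lemma cell_NR_dents_a:
  "cell ` NR_dents_a a = (\<Union>s\<in>dent_segments even a. dent_tri s) \<union> reflect ` (\<Union>s\<in>dent_segments (\<lambda>i. odd i \<and> i \<noteq> 1) a. dent_tri s)"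
proof -
  have 1: "{i \<in> {2..length a}. even i} = {i \<in> {1..length a}. even i}"
    and 2: "{i \<in> {2..length a}. odd i} = {i \<in> {1..length a}. odd i \<and> i \<noteq> 1}"
    by (auto; presburger)+
  show ?thesis
    unfolding NR_dents_a_def UN_if_split 1 2 image_Un image_UN cell_up_triangle cell_down_triangle dent_segments_def
    by (simp add: image_UN)
qed

lemma cell_NR_dents_b:
  assumes "sum_list b \<le> L"
  shows "cell ` NR_dents_b L b = (\<Union>s\<in>refl_segments odd L b. dent_tri s) \<union> reflect ` (\<Union>s\<in>refl_segments even L b. dent_tri s)"
proof -
  have le: "psum b j \<le> L" for j using psum_le[of b j] assms by simp
  have sub: "real L - real (psum b j) = real (L - psum b j)" for j
    using le by (simp add: of_nat_diff)
  show ?thesis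
    unfolding NR_dents_b_def UN_if_split image_Un image_UN sub cell_up_triangle cell_down_triangle refl_segments_def
    by (simp add: image_UN)
qed

lemma cell_NR2:
  assumes "L = NR_L x y a b" "J = y + esum a + osum b" "J' = y + z + osum a + esum b"
  shows "cell ` NR2 x y z a b = reflect ` lower_cells J' L z a b \<union> upper_cells J L a b"
proof -
  have sum_list_b_le: "sum_list b \<le> L" using assms(1) by (simp add: NR_L_def)
  have up: "cell ` NR_upper x y a b = trapezoid 1 0 (2 * int J - 1) L"
    unfolding NR_upper_def NR_A_def cells_strip_east by (auto simp: trapezoid_def assms)
  have low: "cell ` NR_lower x y z a b = reflect ` (trapezoid 0 0 (2 * int J') (L + z) - dent_tri (L, L + z))"
    unfolding NR_lower_def NR_B_def cells_strip_kinked assms(1)[symmetric]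
  proof (rule Set.set_eqI)
    fix p :: "int \<times> int"
    obtain k c where p: "p = (k, c)" by (cases p)
    show "p \<in> {(k, c). - (2 * int (y + z + osum a + esum b)) \<le> k \<and> k < 0 \<and> 0 \<le> c \<and>
        c \<le> (if - k \<le> int z then 2 * int L - k - 1 else 2 * int L + 2 * int z + k)} \<longleftrightarrow>
      p \<in> reflect ` (trapezoid 0 0 (2 * int J') (L + z) - dent_tri (L, L + z))"
      unfolding reflect_image_iff p
      by (auto simp: reflect_def trapezoid_def dent_tri_def cell_tri_def assms)
  qed
  have half: "cell ` NR_half_triangle a = {(k, c). c \<le> 2 * int (entry a 1) + k}"
    by (rule cells_half_triangle)
  have pos: "k \<ge> 0" if "(k, c) \<in> dent_tri s" for k c s
    using that by (auto simp: dent_tri_def cell_tri_def split: prod.splits)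
  show ?thesis
    unfolding NR2_def cell_image_diff image_Un up low half assms(1)[symmetric] cell_NR_dents_a cell_NR_dents_b[OF sum_list_b_le]
  proof (rule Set.set_eqI)
    fix p :: "int \<times> int"
    obtain k c where p: "p = (k, c)" by (cases p)
    define r where "r = - 1 - k"
    have fp: "reflect p = (r, c)" by (simp add: p reflect_def r_def)
    show "p \<in> trapezoid 1 0 (2 * int J - 1) L \<union>
         (reflect ` (trapezoid 0 0 (2 * int J') (L + z) - dent_tri (L, L + z)) - {(k, c). c \<le> 2 * int (entry a 1) + k}) -
         ((\<Union>s\<in>dent_segments even a. dent_tri s) \<union> reflect ` (\<Union>s\<in>dent_segments (\<lambda>i. odd i \<and> i \<noteq> 1) a. dent_tri s)) -
         ((\<Union>s\<in>refl_segments odd L b. dent_tri s) \<union> reflect ` (\<Union>s\<in>refl_segments even L b. dent_tri s)) \<longleftrightarrow>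
       p \<in> reflect ` lower_cells J' L z a b \<union> upper_cells J L a b"
    proof (cases "k \<ge> 0")
      case True
      then have "(r, c) \<notin> dent_tri s" "(r, c) \<notin> trapezoid 0 0 (2 * int J') (L + z)" for s
        using pos[of r c s] by (auto simp: r_def trapezoid_def)
      then show ?thesis
        unfolding Un_iff Diff_iff reflect_image_iff fp by (auto simp: lower_cells_def upper_cells_def up_dents_def p)
    next
      case False
      then have "(k, c) \<notin> dent_tri s" "(k, c) \<notin> trapezoid 1 0 (2 * int J - 1) L" for s
        using pos[of k c s] by (auto simp: trapezoid_def)
      moreover have "(r, c) \<in> trapezoid 0 0 (2 * int J') (L + z) \<Longrightarrow> c \<le> 2 * int (entry a 1) + k \<longleftrightarrow> (r, c) \<in> half_tri 0 (entry a 1)"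
        by (auto simp: half_tri_def trapezoid_def r_def)
      ultimately show ?thesis
        unfolding Un_iff Diff_iff reflect_image_iff fp by (auto simp: lower_cells_def upper_cells_def down_dents_def p)
    qed
  qed
qed

lemma M_NR2_matching_sum:
  assumes "L = NR_L x y a b" "J = y + esum a + osum b" "J' = y + z + osum a + esum b"
  shows "M_NR2 x y z a b = brick_sum (reflect ` lower_cells J' L z a b \<union> upper_cells J L a b)"
  unfolding M_NR2_def cell_NR2[OF assms, symmetric]
proof (rule tiling_sum_cells, rule half_weight_brick_weight)
  fix k assume "(k, 0) \<in> cell ` NR2 x y z a b"
  then have "(k, 0) \<in> reflect ` lower_cells J' L z a b \<union> upper_cells J L a b" unfolding cell_NR2[OF assms] .
  then have "(k, 0) \<in> reflect ` lower_cells J' L z a b" by (auto simp: upper_cells_def trapezoid_def)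
  then have "reflect (k, 0) \<in> lower_cells J' L z a b" unfolding reflect_image_iff .
  then show "- NR_B y z a b \<le> k \<and> k < 0"
    by (auto simp: reflect_def lower_cells_def trapezoid_def NR_B_def assms)
qed

lemma finite_upper_cells: "finite (upper_cells J L a b)" and finite_lower_cells: "finite (lower_cells J L z a b)"
  by (simp_all add: upper_cells_def lower_cells_def)

definition crossing_term :: "nat \<Rightarrow> nat \<Rightarrow> nat \<Rightarrow> nat set \<Rightarrow> nat set \<Rightarrow> nat set \<Rightarrow> real" where
  "crossing_term h J J' P P' V = 2 ^ h * east_coeff J * vander (centre ` (P \<union> V)) * (west_coeff J' * ((\<Prod>c\<in>centre ` (P' \<union> V). real_of_int c) * vander (centre ` (P' \<union> V))))"

lemma seg_pos_odd_split: "seg_pos odd a = {..<entry a 1} \<union> seg_pos (\<lambda>i. odd i \<and> i \<noteq> 1) a"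
proof (rule Set.set_eqI)
  fix x
  have p1: "psum a 1 = entry a 1" using psum_Suc[of a 0] by simp
  show "x \<in> seg_pos odd a \<longleftrightarrow> x \<in> {..<entry a 1} \<union> seg_pos (\<lambda>i. odd i \<and> i \<noteq> 1) a"
  proof
    assume "x \<in> seg_pos odd a"
    then obtain i where i: "i \<ge> 1" "odd i" "psum a (i - 1) \<le> x" "x < psum a i" by (auto simp: seg_pos_def)
    then show "x \<in> {..<entry a 1} \<union> seg_pos (\<lambda>i. odd i \<and> i \<noteq> 1) a"
      using p1 by (cases "i = 1") (auto simp: seg_pos_def)
  next
    assume "x \<in> {..<entry a 1} \<union> seg_pos (\<lambda>i. odd i \<and> i \<noteq> 1) a"
    then consider "x < entry a 1" | "x \<in> seg_pos (\<lambda>i. odd i \<and> i \<noteq> 1) a" by auto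
    then show "x \<in> seg_pos odd a"
    proof cases
      case 1
      then show ?thesis using p1 by (auto simp: seg_pos_def intro!: exI[of _ 1])
    qed (auto simp: seg_pos_def)
  qed
qed

lemma seg_pos_ge:
  assumes "\<And>i. par i \<Longrightarrow> k < i" shows "seg_pos par a \<subseteq> {psum a k..<sum_list a}"
proof
  fix x assume x: "x \<in> seg_pos par a"
  then obtain i where i: "par i" "psum a (i - 1) \<le> x" by (auto simp: seg_pos_def)
  have "k \<le> i - 1" using assms[OF i(1)] by linarith
  from psum_mono[OF this, of a] show "x \<in> {psum a k..<sum_list a}" using i x seg_pos_lt[of par a] by auto
qed

lemma segs_disjoint:
  assumes "seg_pos par a \<inter> refl_pos par' L b = {}" "sum_list b \<le> L"
    "i \<in> dent_segments par a \<union> refl_segments par' L b" "j \<in> dent_segments par a \<union> refl_segments par' L b" "i \<noteq> j"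
  shows "{fst i..<snd i} \<inter> {fst j..<snd j} = {}"
proof (rule dents_disjoint_Un[OF _ _ _ assms(3-5)])
  show "dent_pos (dent_segments par a) \<inter> dent_pos (refl_segments par' L b) = {}"
    using assms(1) by (simp add: dent_pos_dent_segments dent_pos_refl_segments)
qed (use dent_segments_disjoint refl_segments_disjoint assms(2) in blast)+

lemma dent_pos_single: "dent_pos {(p, q)} = {p..<q}"
  by (simp add: dent_pos_def)

text \<open>The upper part has \<open>2 * J - 1\<close> rows and the lower one
  \<open>2 * J'\<close>; \<open>P\<close> and \<open>P'\<close> are their unit dents on the line.
  The half triangle counts with \<open>entry a 1\<close> unit dents, and the kink in the east with
  \<open>z\<close>.\<close>

locale NR_setting =
  fixes x y z :: nat and a b :: "nat list" and L J J' :: nat and P P' :: "nat set"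
  assumes L: "L = NR_L x y a b" and J: "J = y + esum a + osum b" and J': "J' = y + z + osum a + esum b"
    and P: "P = seg_pos even a \<union> refl_pos odd L b" and P': "P' = seg_pos odd a \<union> {L..<L + z} \<union> refl_pos even L b"
begin

lemma sum_list_b_le: "sum_list b \<le> L" and L_eq: "L = sum_list a + (x + y) + sum_list b"
  using L by (simp_all add: NR_L_def)

lemma refl_pos_subset: "refl_pos par L b \<subseteq> {sum_list a + (x + y)..<L}"
  using refl_pos_bounds[of par L b] L_eq by simp

lemma dents_union: "P \<union> P' = {..<sum_list a} \<union> {sum_list a + (x + y)..<L + z}"
proof -
  have e: "seg_pos even a \<union> seg_pos odd a = {..<sum_list a}" using seg_pos_union[of even a] by simp
  have r: "refl_pos odd L b \<union> refl_pos even L b = {sum_list a + (x + y)..<L}"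
    using refl_pos_union[OF sum_list_b_le, of odd] L_eq by simp
  have "P \<union> P' = (seg_pos even a \<union> seg_pos odd a) \<union> ((refl_pos odd L b \<union> refl_pos even L b) \<union> {L..<L + z})"
    by (auto simp: P P')
  also have "\<dots> = {..<sum_list a} \<union> {sum_list a + (x + y)..<L + z}"
    unfolding e r using L_eq by auto
  finally show ?thesis .
qed

lemma dents_disjoint: "P \<inter> P' = {}"
proof -
  have "seg_pos even a \<inter> seg_pos odd a = {}" using seg_pos_disjoint[of even a] by simp
  moreover have "refl_pos odd L b \<inter> refl_pos even L b = {}" using refl_pos_disjoint[OF sum_list_b_le, of odd] by simp
  moreover have "seg_pos par a \<inter> refl_pos par' L b = {}" for par par'
    using seg_pos_lt[of par a] refl_pos_subset[of par'] by fastforce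
  moreover have "seg_pos par a \<inter> {L..<L + z} = {}" "refl_pos par L b \<inter> {L..<L + z} = {}" for par
    using seg_pos_lt[of par a] refl_pos_subset[of par] L_eq by fastforce+
  ultimately show ?thesis unfolding P P' by blast
qed

lemma finite_dents: "finite P" "finite P'"
  using dents_union by (metis finite_Un finite_atLeastLessThan finite_lessThan)+

lemma card_dents: "card P = esum a + osum b" "card P' = osum a + z + esum b"
proof -
  have d: "seg_pos par a \<inter> refl_pos par' L b = {}" "seg_pos par a \<inter> {L..<L + z} = {}" "refl_pos par L b \<inter> {L..<L + z} = {}" for par par'
    using seg_pos_lt[of par a] refl_pos_subset[of par'] refl_pos_subset[of par] L_eq by fastforce+
  have fin: "finite (seg_pos par a)" "finite (refl_pos par L b)" for par
    using finite_seg_pos finite_subset[OF refl_pos_subset] by auto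
  have cr: "card (refl_pos odd L b) = osum b" "card (refl_pos even L b) = esum b"
    using card_refl_pos[OF sum_list_b_le] by (simp_all add: card_seg_pos_even card_seg_pos_odd)
  show "card P = esum a + osum b"
    unfolding P using d fin cr by (simp add: card_Un_disjoint card_seg_pos_even)
  have "P' = (seg_pos odd a \<union> refl_pos even L b) \<union> {L..<L + z}" by (auto simp: P')
  moreover have "(seg_pos odd a \<union> refl_pos even L b) \<inter> {L..<L + z} = {}" using d by blast
  ultimately show "card P' = osum a + z + esum b"
    using d fin cr by (simp add: card_Un_disjoint card_seg_pos_odd)
qed

lemma dents_subset: "P \<subseteq> {..<L}" "P' \<subseteq> {..<L + z}"
proof -
  have "P' \<subseteq> P \<union> P'" by blast
  then show "P' \<subseteq> {..<L + z}" unfolding dents_union using L_eq by auto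
  show "P \<subseteq> {..<L}" unfolding P using seg_pos_lt[of even a] refl_pos_subset[of odd] L_eq by fastforce
qed

lemma up_region:
  assumes "V \<subseteq> {..<L}" "V \<inter> P = {}" "J = 0 \<Longrightarrow> V = {}"
  shows "brick_sum (upper_cells J L a b - {0} \<times> centre ` V) = of_bool (card (P \<union> V) = J) * east_coeff J * vander (centre ` (P \<union> V))"
proof -
  have dp: "dent_pos (up_dents L a b) = P"
    by (simp add: up_dents_def dent_pos_Un dent_pos_dent_segments dent_pos_refl_segments P)
  have "seg_pos even a \<inter> refl_pos odd L b = {}" using seg_pos_lt[of even a] refl_pos_subset[of odd] by fastforce
  then have dis: "{fst i..<snd i} \<inter> {fst j..<snd j} = {}" if "i \<in> up_dents L a b" "j \<in> up_dents L a b" "i \<noteq> j" for i j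
    using segs_disjoint[OF _ sum_list_b_le] that unfolding up_dents_def by blast
  have "J \<le> L" using osum_esum[of a] osum_esum[of b] by (simp add: J L_eq)
  then show ?thesis
    unfolding upper_cells_def dp[symmetric]
  proof (intro east_region dis)
    show "finite (up_dents L a b)" by (simp add: up_dents_def finite_dent_segments)
  qed (use assms dents_subset card_dents J in \<open>auto simp: dp\<close>)
qed

lemma low_region:
  assumes "V \<subseteq> {..<L + z}" "V \<inter> P' = {}" "J' = 0 \<Longrightarrow> V = {}"
  shows "brick_sum (lower_cells J' L z a b - {0} \<times> centre ` V) = 2 ^ entry a 1 *
    (of_bool (card (P' \<union> V) = J') * west_coeff J' * ((\<Prod>c\<in>centre ` (P' \<union> V). real_of_int c) * vander (centre ` (P' \<union> V))))"
proof -
  let ?par = "\<lambda>i. odd i \<and> i \<noteq> (1::nat)"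
  have dp: "dent_pos (down_dents L z a b) = seg_pos ?par a \<union> refl_pos even L b \<union> {L..<L + z}"
    unfolding down_dents_def dent_pos_Un dent_pos_dent_segments dent_pos_refl_segments dent_pos_single ..
  have "1 < i" if "?par i" for i using that by (cases "i = 0") auto
  from seg_pos_ge[of ?par 1 a, OF this] have sub: "seg_pos ?par a \<subseteq> {entry a 1..<sum_list a}"
    using psum_Suc[of a 0] by simp
  have PD: "P' = {..<entry a 1} \<union> dent_pos (down_dents L z a b)"
    unfolding dp P' seg_pos_odd_split by auto
  have d1: "seg_pos ?par a \<inter> refl_pos even L b = {}" using seg_pos_lt[of ?par a] refl_pos_subset[of even] by fastforce
  have d2: "(seg_pos ?par a \<union> refl_pos even L b) \<inter> {L..<L + z} = {}"
    using seg_pos_lt[of ?par a] refl_pos_subset[of even] L_eq by fastforce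
  have dis1: "{fst i..<snd i} \<inter> {fst j..<snd j} = {}"
    if "i \<in> dent_segments ?par a \<union> refl_segments even L b" "j \<in> dent_segments ?par a \<union> refl_segments even L b" "i \<noteq> j" for i j
    using segs_disjoint[OF d1 sum_list_b_le that] .
  have dis: "{fst i..<snd i} \<inter> {fst j..<snd j} = {}" if "i \<in> down_dents L z a b" "j \<in> down_dents L z a b" "i \<noteq> j" for i j
  proof (rule dents_disjoint_Un[of "dent_segments ?par a \<union> refl_segments even L b" "{(L, L + z)}", OF dis1 _ _ that[unfolded down_dents_def]])
    show "dent_pos (dent_segments ?par a \<union> refl_segments even L b) \<inter> dent_pos {(L, L + z)} = {}"
      unfolding dent_pos_Un dent_pos_dent_segments dent_pos_refl_segments using d2 by (simp add: dent_pos_def)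
  qed auto
  have ge: "entry a 1 \<le> sum_list a" using psum_le[of a 1] psum_Suc[of a 0] by simp
  have "J' \<le> L + z" using osum_esum[of a] osum_esum[of b] by (simp add: J' L_eq)
  then show ?thesis
    unfolding lower_cells_def
  proof (intro west_region dis)
    show "P' = {..<entry a 1} \<union> dent_pos (down_dents L z a b)" by (rule PD)
    show "dent_pos (down_dents L z a b) \<subseteq> {entry a 1..<L + z}"
      unfolding dp using sub refl_pos_subset[of even] ge L_eq by fastforce
    show "card P' \<le> J'" using card_dents J' by simp
  qed (use assms ge L_eq in \<open>auto simp: down_dents_def finite_dent_segments\<close>)
qed

text \<open>The numbers of dents required by the heights are \<open>J\<close> and \<open>J'\<close>,
  and each exceeds the number of given dents by \<open>y\<close>. Both parts therefore impose the
  same condition on the crossing set.\<close>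

lemma M_sum:
  "M_NR2 x y z a b = (\<Sum>V | V \<subseteq> {sum_list a..<sum_list a + (x + y)} \<and> card V = y. crossing_term (entry a 1) J J' P P' V)"
proof -
  let ?X = "{sum_list a..<sum_list a + (x + y)}"
  \<comment> \<open>If one of the parts is empty, nothing crosses the line. Then
    \<open>y = 0\<close>, and the sum over sets of size \<open>y\<close> has only the empty set as
    well.\<close>
  define U where "U = (if J = 0 \<or> J' = 0 then {} else ?X)"
  have J0: "J = 0 \<or> J' = 0 \<Longrightarrow> y = 0" using J J' by auto
  have UX: "U \<subseteq> ?X" by (simp add: U_def)
  have Xdis: "?X \<inter> P = {}" "?X \<inter> P' = {}"
  proof -
    have "?X \<inter> (P \<union> P') = {}" unfolding dents_union by auto
    then show "?X \<inter> P = {}" "?X \<inter> P' = {}" by auto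
  qed
  have cross: "{c. even (c - (- 1)) \<and> (- 1, c) \<in> reflect ` lower_cells J' L z a b \<and> (- 1 + 1, c) \<in> upper_cells J L a b} = centre ` U"
  proof -
    have up0: "(0, centre v) \<in> upper_cells J L a b \<longleftrightarrow> J \<noteq> 0 \<and> v < L \<and> v \<notin> P" for v
    proof -
      have "dent_pos (up_dents L a b) = P"
        by (simp add: up_dents_def dent_pos_Un dent_pos_dent_segments dent_pos_refl_segments P)
      then show ?thesis unfolding upper_cells_def Diff_iff dents_row0 by (auto simp: trapezoid_def centre_def)
    qed
    have low0: "(- 1, centre v) \<in> reflect ` lower_cells J' L z a b \<longleftrightarrow> J' \<noteq> 0 \<and> v < L + z \<and> v \<notin> P'" for v
    proof -
      have dp: "dent_pos (down_dents L z a b) = seg_pos (\<lambda>i. odd i \<and> i \<noteq> 1) a \<union> refl_pos even L b \<union> {L..<L + z}"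
        unfolding down_dents_def dent_pos_Un dent_pos_dent_segments dent_pos_refl_segments dent_pos_single ..
      have "(- 1, centre v) \<in> reflect ` lower_cells J' L z a b \<longleftrightarrow> (0, centre v) \<in> lower_cells J' L z a b"
        unfolding reflect_image_iff by (simp add: reflect_def)
      also have "\<dots> \<longleftrightarrow> J' \<noteq> 0 \<and> v < L + z \<and> \<not> v < entry a 1 \<and> v \<notin> dent_pos (down_dents L z a b)"
        unfolding lower_cells_def Diff_iff dents_row0 by (auto simp: trapezoid_def half_tri_def centre_def)
      also have "\<dots> \<longleftrightarrow> J' \<noteq> 0 \<and> v < L + z \<and> v \<notin> P'"
        unfolding dp P' seg_pos_odd_split by auto
      finally show ?thesis .
    qed
    have both: "(- 1, centre v) \<in> reflect ` lower_cells J' L z a b \<and> (0, centre v) \<in> upper_cells J L a b \<longleftrightarrow> v \<in> U" for v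
    proof -
      have "v < L \<and> v \<notin> P \<and> v < L + z \<and> v \<notin> P' \<longleftrightarrow> v < L \<and> v \<notin> P \<union> P'" by auto
      also have "\<dots> \<longleftrightarrow> v \<in> ?X" unfolding dents_union using L_eq by auto
      finally show ?thesis unfolding up0 low0 U_def by auto
    qed
    have odd: "odd (centre v)" for v by (simp add: centre_def)
    have nn: "0 \<le> c" if "(0, c) \<in> upper_cells J L a b" for c using that by (auto simp: upper_cells_def trapezoid_def)
    show ?thesis
    proof (intro equalityI subsetI)
      fix c assume "c \<in> {c. even (c - (- 1)) \<and> (- 1, c) \<in> reflect ` lower_cells J' L z a b \<and> (- 1 + 1, c) \<in> upper_cells J L a b}"
      then have c: "odd c" "(- 1, c) \<in> reflect ` lower_cells J' L z a b" "(0, c) \<in> upper_cells J L a b" by auto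
      obtain v where "c = centre v" using odd_nonneg_centre[OF c(1) nn[OF c(3)]] by blast
      then show "c \<in> centre ` U" using both[of v] c by blast
    next
      fix c assume "c \<in> centre ` U"
      then obtain v where "c = centre v" "v \<in> U" by blast
      then show "c \<in> {c. even (c - (- 1)) \<and> (- 1, c) \<in> reflect ` lower_cells J' L z a b \<and> (- 1 + 1, c) \<in> upper_cells J L a b}"
        using both[of v] odd[of v] by simp
    qed
  qed
  have injI: "inj_on ((`) centre) (Pow U)"
    by (rule inj_on_image_Pow) (use inj_centre in \<open>auto intro: inj_on_subset\<close>)
  have "M_NR2 x y z a b = (\<Sum>V\<in>Pow (centre ` U). (if 0 \<in> V then 1 / 2 else 1) *
      brick_sum (reflect ` lower_cells J' L z a b - {- 1} \<times> V) * brick_sum (upper_cells J L a b - {- 1 + 1} \<times> V))"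
    unfolding M_NR2_matching_sum[OF L J J'] cross[symmetric]
  proof (rule matching_sum_cut_rows)
    show "finite (reflect ` lower_cells J' L z a b)" "finite (upper_cells J L a b)" by (simp_all add: finite_upper_cells finite_lower_cells)
    show "fst p \<le> - 1" if "p \<in> reflect ` lower_cells J' L z a b" for p
      using that unfolding reflect_image_iff by (cases p) (auto simp: reflect_def lower_cells_def trapezoid_def)
    show "- 1 + 1 \<le> fst p" if "p \<in> upper_cells J L a b" for p
      using that by (auto simp: upper_cells_def trapezoid_def)
  qed
  also have "\<dots> = (\<Sum>V\<in>Pow U. (if 0 \<in> centre ` V then 1 / 2 else 1) *
      brick_sum (reflect ` lower_cells J' L z a b - {- 1} \<times> centre ` V) * brick_sum (upper_cells J L a b - {- 1 + 1} \<times> centre ` V))"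
    unfolding image_Pow_surj[OF refl, of centre U, symmetric] by (subst sum.reindex[OF injI]) simp
  also have "\<dots> = (\<Sum>V\<in>Pow U. of_bool (card V = y) * crossing_term (entry a 1) J J' P P' V)"
  proof (rule sum.cong[OF refl])
    fix V assume "V \<in> Pow U"
    then have V12: "V \<subseteq> U" "V \<subseteq> ?X" using UX by auto
    moreover have "finite V" using finite_subset[OF V12(2)] by simp
    ultimately have V: "V \<subseteq> U" "V \<subseteq> ?X" "finite V" by simp_all
    have "0 \<notin> centre ` V" by (auto simp: centre_def)
    have VL: "V \<subseteq> {..<L}" "V \<subseteq> {..<L + z}" using V(2) L_eq by auto
    have VP: "V \<inter> P = {}" "V \<inter> P' = {}" using V(2) Xdis by auto
    have V0: "J = 0 \<Longrightarrow> V = {}" "J' = 0 \<Longrightarrow> V = {}" using V(1) by (auto simp: U_def)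
    have "reflect ` lower_cells J' L z a b - {- 1} \<times> centre ` V = reflect ` (lower_cells J' L z a b - {0} \<times> centre ` V)"
    proof -
      have "reflect ` ({0} \<times> centre ` V) = {- 1} \<times> centre ` V" by (auto simp: reflect_def image_iff)
      then show ?thesis using image_set_diff[OF inj_reflect, of "lower_cells J' L z a b" "{0} \<times> centre ` V"] by simp
    qed
    then have low: "brick_sum (reflect ` lower_cells J' L z a b - {- 1} \<times> centre ` V) =
        2 ^ entry a 1 * (of_bool (card (P' \<union> V) = J') * west_coeff J' * ((\<Prod>c\<in>centre ` (P' \<union> V). real_of_int c) * vander (centre ` (P' \<union> V))))"
      using low_region[OF VL(2) VP(2) V0(2)] by (simp add: matching_sum_reflect)
    have up: "brick_sum (upper_cells J L a b - {- 1 + 1} \<times> centre ` V) =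
        of_bool (card (P \<union> V) = J) * east_coeff J * vander (centre ` (P \<union> V))"
      using up_region[OF VL(1) VP(1) V0(1)] by simp
    have "card (P \<union> V) = card P + card V" "card (P' \<union> V) = card P' + card V"
      using finite_dents V(3) VP by (simp_all add: card_Un_disjoint Int_commute)
    then have "card (P \<union> V) = J \<longleftrightarrow> card V = y" "card (P' \<union> V) = J' \<longleftrightarrow> card V = y"
      using card_dents J J' by auto
    then show "(if 0 \<in> centre ` V then 1 / 2 else 1) *
      brick_sum (reflect ` lower_cells J' L z a b - {- 1} \<times> centre ` V) * brick_sum (upper_cells J L a b - {- 1 + 1} \<times> centre ` V) =
      of_bool (card V = y) * crossing_term (entry a 1) J J' P P' V"
      unfolding low up using \<open>0 \<notin> centre ` V\<close> by (simp add: crossing_term_def)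
  qed
  also have "\<dots> = (\<Sum>V | V \<subseteq> ?X \<and> card V = y. crossing_term (entry a 1) J J' P P' V)"
  proof (rule sum.mono_neutral_cong)
    show "finite (Pow U)" using UX finite_subset by auto
    show "finite {V. V \<subseteq> ?X \<and> card V = y}" by simp
    show "of_bool (card V = y) * crossing_term (entry a 1) J J' P P' V = 0" if "V \<in> Pow U - {V. V \<subseteq> ?X \<and> card V = y}" for V
      using that UX by auto
    show "crossing_term (entry a 1) J J' P P' V = 0" if "V \<in> {V. V \<subseteq> ?X \<and> card V = y} - Pow U" for V
    proof -
      have V: "V \<subseteq> ?X" "card V = y" "\<not> V \<subseteq> U" using that by auto
      then have "J = 0 \<or> J' = 0" by (auto simp: U_def split: if_splits)
      then have "V = {}" using J0 V(1,2) finite_subset by fastforce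
      then show ?thesis using V(3) by simp
    qed
  qed auto
  finally show ?thesis .
qed

end

section \<open>The closed form of the tiling sum\<close>

definition selberg_product :: "nat \<Rightarrow> nat \<Rightarrow> nat \<Rightarrow> nat \<Rightarrow> real" where
  "selberg_product N y a C = (\<Prod>i<y. 4 ^ (a + C + 2 * i) * fact (a + i) * fact (C + i) * fact i * fact (a + N + C + i) * fact (a + N + a + C + i) /
       (fact (N - 1 - i) * fact (a + N - 1 - i) * fact (a + C + y + i)))"

lemma gap_centre: "gap (2 * int p) (2 * int q) = centre ` {p..<q}"
  unfolding centre_interval gap_def by (auto; presburger)

lemma prod_centre_below:
  assumes "a \<le> v"
  shows "(\<Prod>u\<in>centre ` {..<a}. \<bar>(real_of_int (centre v))\<^sup>2 - (real_of_int u)\<^sup>2\<bar>) = phi a (real_of_int (centre v))"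
proof -
  have "(\<Prod>u\<in>centre ` {..<a}. \<bar>(real_of_int (centre v))\<^sup>2 - (real_of_int u)\<^sup>2\<bar>) =
      (\<Prod>k<a. \<bar>(real_of_int (centre v))\<^sup>2 - (real_of_int (centre k))\<^sup>2\<bar>)"
    using inj_centre by (subst prod.reindex) (auto intro: inj_on_subset)
  also have "\<dots> = phi a (real_of_int (centre v))"
    unfolding phi_def
  proof (rule prod.cong[OF refl])
    fix k assume "k \<in> {..<a}"
    then have "(2 * real k + 1)\<^sup>2 \<le> (real_of_int (centre v))\<^sup>2"
      using assms by (intro power_mono) (auto simp: centre_def)
    then show "\<bar>(real_of_int (centre v))\<^sup>2 - (real_of_int (centre k))\<^sup>2\<bar> = (real_of_int (centre v))\<^sup>2 - (2 * real k + 1)\<^sup>2"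
      by (simp add: centre_def)
  qed
  finally show ?thesis .
qed

lemma prod_centre_above:
  assumes "v < W"
  shows "(\<Prod>u\<in>centre ` {W..<W + C}. \<bar>(real_of_int (centre v))\<^sup>2 - (real_of_int u)\<^sup>2\<bar>) = chi W C (real_of_int (centre v))"
proof -
  have im: "centre ` {W..<W + C} = (\<lambda>k. centre (W + k)) ` {..<C}"
  proof -
    have "{W..<W + C} = (\<lambda>k. W + k) ` {..<C}" by (simp add: lessThan_atLeast0 add.commute)
    then show ?thesis by (simp only: image_image)
  qed
  have "inj_on (\<lambda>k. centre (W + k)) {..<C}" by (auto simp: inj_on_def centre_def)
  then have "(\<Prod>u\<in>centre ` {W..<W + C}. \<bar>(real_of_int (centre v))\<^sup>2 - (real_of_int u)\<^sup>2\<bar>) =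
      (\<Prod>k<C. \<bar>(real_of_int (centre v))\<^sup>2 - (real_of_int (centre (W + k)))\<^sup>2\<bar>)"
    unfolding im by (simp add: prod.reindex)
  also have "\<dots> = chi W C (real_of_int (centre v))"
    unfolding chi_def
  proof (rule prod.cong[OF refl])
    fix k
    have "(real_of_int (centre v))\<^sup>2 \<le> (2 * real W + 2 * real k + 1)\<^sup>2"
      using assms by (intro power_mono) (auto simp: centre_def)
    then show "\<bar>(real_of_int (centre v))\<^sup>2 - (real_of_int (centre (W + k)))\<^sup>2\<bar> = (2 * real W + 2 * real k + 1)\<^sup>2 - (real_of_int (centre v))\<^sup>2"
      by (simp add: centre_def algebra_simps)
  qed
  finally show ?thesis .
qed

text \<open>The interaction of the given dents among themselves, the part of
  \<open>crossing_term\<close> that is the same for every crossing set.\<close>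

definition dent_factor :: "nat set \<Rightarrow> nat set \<Rightarrow> real" where
  "dent_factor P P' = vander (centre ` P) * ((\<Prod>c\<in>centre ` P'. real_of_int c) * vander (centre ` P'))"

lemma dent_factor_pos: "finite P \<Longrightarrow> finite P' \<Longrightarrow> dent_factor P P' > 0"
  unfolding dent_factor_def by (intro mult_pos_pos vander_pos prod_pos) (auto simp: centre_def)

context NR_setting
begin

text \<open>Every position outside the free interval is a dent of exactly one of the two parts.  Therefore the
  factors joining \<open>V\<close> to the dents do not depend on which dents point upwards.\<close>

lemma crossing_term_factor:
  assumes V: "V \<subseteq> {sum_list a..<sum_list a + (x + y)}"
  defines "w \<equiv> \<lambda>s. real_of_int s * phi (sum_list a) (real_of_int s) *
      chi (sum_list a + (x + y)) (sum_list b + z) (real_of_int s)"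
  shows "crossing_term h J J' P P' V = 2 ^ h * east_coeff J * west_coeff J' * dent_factor P P' * ((vander (centre ` V))\<^sup>2 * (\<Prod>s\<in>centre ` V. w s))"
proof -
  let ?W = "sum_list a + (x + y)"
  have finV: "finite V" using finite_subset[OF V] by simp
  have "V \<inter> (P \<union> P') = {}" unfolding dents_union using V by auto
  then have VP: "V \<inter> P = {}" "V \<inter> P' = {}" by auto
  have dis: "centre ` V \<inter> centre ` P = {}" "centre ` V \<inter> centre ` P' = {}" "centre ` P \<inter> centre ` P' = {}"
    using VP dents_disjoint by (simp_all flip: image_Int[OF inj_centre])
  have nn: "0 \<le> c" if "c \<in> centre ` A \<union> centre ` B" for A B c using that by (auto simp: centre_def)
  let ?r = "\<lambda>v u. \<bar>(real_of_int v)\<^sup>2 - (real_of_int u)\<^sup>2\<bar>"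
  have vP: "vander (centre ` (P \<union> V)) = vander (centre ` V) * vander (centre ` P) * (\<Prod>v\<in>centre ` V. \<Prod>u\<in>centre ` P. ?r v u)"
    unfolding image_Un Un_commute[of "centre ` P"]
    by (rule vander_union) (use finite_dents finV dis nn in auto)
  have vP': "vander (centre ` (P' \<union> V)) = vander (centre ` V) * vander (centre ` P') * (\<Prod>v\<in>centre ` V. \<Prod>u\<in>centre ` P'. ?r v u)"
    unfolding image_Un Un_commute[of "centre ` P'"]
    by (rule vander_union) (use finite_dents finV dis nn in auto)
  have pr: "(\<Prod>c\<in>centre ` (P' \<union> V). real_of_int c) = (\<Prod>c\<in>centre ` P'. real_of_int c) * (\<Prod>c\<in>centre ` V. real_of_int c)"
    unfolding image_Un by (rule prod.union_disjoint) (use finite_dents finV dis in auto)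
  have pw: "(\<Prod>u\<in>centre ` P. ?r v u) * (\<Prod>u\<in>centre ` P'. ?r v u) * real_of_int v = w v" if v: "v \<in> centre ` V" for v
  proof -
    obtain k where k: "v = centre k" "k \<in> V" using v by blast
    have "(\<Prod>u\<in>centre ` P. ?r v u) * (\<Prod>u\<in>centre ` P'. ?r v u) = (\<Prod>u\<in>centre ` P \<union> centre ` P'. ?r v u)"
      by (rule prod.union_disjoint[symmetric]) (use finite_dents dis in auto)
    also have "centre ` P \<union> centre ` P' = centre ` {..<sum_list a} \<union> centre ` {?W..<?W + (sum_list b + z)}"
      unfolding image_Un[symmetric] dents_union by (simp add: L_eq add.assoc)
    also have "(\<Prod>u\<in>\<dots>. ?r v u) = (\<Prod>u\<in>centre ` {..<sum_list a}. ?r v u) * (\<Prod>u\<in>centre ` {?W..<?W + (sum_list b + z)}. ?r v u)"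
    proof (rule prod.union_disjoint)
      have "{..<sum_list a} \<inter> {?W..<?W + (sum_list b + z)} = {}" by auto
      then show "centre ` {..<sum_list a} \<inter> centre ` {?W..<?W + (sum_list b + z)} = {}"
        by (simp flip: image_Int[OF inj_centre])
    qed auto
    also have "\<dots> = phi (sum_list a) (real_of_int v) * chi ?W (sum_list b + z) (real_of_int v)"
    proof -
      have "sum_list a \<le> k" "k < ?W" using V k(2) by auto
      then show ?thesis unfolding k(1) using prod_centre_below prod_centre_above by simp
    qed
    finally show ?thesis by (simp add: w_def mult_ac)
  qed
  have "(\<Prod>v\<in>centre ` V. \<Prod>u\<in>centre ` P. ?r v u) * (\<Prod>v\<in>centre ` V. \<Prod>u\<in>centre ` P'. ?r v u) * (\<Prod>c\<in>centre ` V. real_of_int c) =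
      (\<Prod>s\<in>centre ` V. w s)"
    unfolding prod.distrib[symmetric] by (rule prod.cong[OF refl pw])
  then have "(\<Prod>s\<in>centre ` V. w s) = (\<Prod>v\<in>centre ` V. \<Prod>u\<in>centre ` P. ?r v u) * (\<Prod>v\<in>centre ` V. \<Prod>u\<in>centre ` P'. ?r v u) * (\<Prod>c\<in>centre ` V. real_of_int c)" ..
  then show ?thesis
    unfolding crossing_term_def vP vP' pr dent_factor_def by (simp add: power2_eq_square mult_ac)
qed

lemma M_closed:
  "M_NR2 x y z a b = 2 ^ entry a 1 * east_coeff J * west_coeff J' * dent_factor P P' * selberg_product (x + y) y (sum_list a) (sum_list b + z)"
proof -
  let ?W = "sum_list a + (x + y)"
  let ?w = "\<lambda>s. real_of_int s * phi (sum_list a) (real_of_int s) * chi ?W (sum_list b + z) (real_of_int s)"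
  let ?K = "2 ^ entry a 1 * east_coeff J * west_coeff J' * dent_factor P P'"
  have "M_NR2 x y z a b = (\<Sum>V | V \<subseteq> {sum_list a..<?W} \<and> card V = y. ?K * ((vander (centre ` V))\<^sup>2 * (\<Prod>s\<in>centre ` V. ?w s)))"
    unfolding M_sum by (rule sum.cong[OF refl], rule crossing_term_factor) auto
  also have "\<dots> = ?K * (\<Sum>V | V \<subseteq> {sum_list a..<?W} \<and> card V = y. (vander (centre ` V))\<^sup>2 * (\<Prod>s\<in>centre ` V. ?w s))"
    by (rule sum_distrib_left[symmetric])
  also have "(\<Sum>V | V \<subseteq> {sum_list a..<?W} \<and> card V = y. (vander (centre ` V))\<^sup>2 * (\<Prod>s\<in>centre ` V. ?w s)) =
      (\<Sum>S | S \<subseteq> gap (2 * int (sum_list a)) (2 * int ?W) \<and> card S = y. (vander S)\<^sup>2 * (\<Prod>s\<in>S. ?w s))"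
  proof -
    have "{S. S \<subseteq> gap (2 * int (sum_list a)) (2 * int ?W) \<and> card S = y} =
        (`) centre ` {V. V \<subseteq> {sum_list a..<?W} \<and> card V = y}"
    proof (intro equalityI subsetI)
      fix S assume S: "S \<in> {S. S \<subseteq> gap (2 * int (sum_list a)) (2 * int ?W) \<and> card S = y}"
      then obtain V where "V \<subseteq> {sum_list a..<?W}" "S = centre ` V"
        unfolding gap_centre by (auto simp: subset_image_iff)
      moreover from this S have "card V = y" using card_image[OF inj_on_subset[OF inj_centre subset_UNIV], of V] by auto
      ultimately show "S \<in> (`) centre ` {V. V \<subseteq> {sum_list a..<?W} \<and> card V = y}" by blast
    next
      fix S assume "S \<in> (`) centre ` {V. V \<subseteq> {sum_list a..<?W} \<and> card V = y}"
      then obtain V where V: "V \<subseteq> {sum_list a..<?W}" "card V = y" "S = centre ` V" by blast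
      then show "S \<in> {S. S \<subseteq> gap (2 * int (sum_list a)) (2 * int ?W) \<and> card S = y}"
        unfolding gap_centre using card_image[OF inj_on_subset[OF inj_centre subset_UNIV], of V] by auto
    qed
    moreover have "inj_on ((`) centre) {V. V \<subseteq> {sum_list a..<?W} \<and> card V = y}"
      using inj_image_eq_iff[OF inj_centre] by (auto simp: inj_on_def)
    ultimately show ?thesis by (simp add: sum.reindex)
  qed
  also have "\<dots> = selberg_product (x + y) y (sum_list a) (sum_list b + z)"
    unfolding selberg_product_def by (rule selberg_sum) simp
  finally show ?thesis .
qed

end

section \<open>The constants in terms of H, H_2 and T\<close>

definition four_power :: "nat \<Rightarrow> real" where
  "four_power n = (\<Prod>m<n. 4 ^ m)"

lemma four_power_pos: "four_power n > 0"
  unfolding four_power_def by (rule prod_pos) simp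

lemma prod_lessThan_reflect: "(\<Prod>i<n. f (n - 1 - i)) = (\<Prod>i<(n::nat). f i :: 'a::comm_monoid_mult)"
  using prod.nat_diff_reindex[of f n] by simp

lemma Hfun2_even: "Hfun2 (2 * n) = (\<Prod>m<n. fact (2 * m))"
proof -
  have "Hfun2 (2 * n) = (\<Prod>i<n. fact (2 * n - 2 * Suc i))"
    unfolding Hfun2_def by (rule prod.reindex_bij_witness[where i = Suc and j = "\<lambda>i. i - 1"]) auto
  also have "\<dots> = (\<Prod>i<n. fact (2 * (n - 1 - i)))"
    by (intro prod.cong refl arg_cong[of _ _ fact]) auto
  also have "\<dots> = (\<Prod>m<n. fact (2 * m))" by (rule prod_lessThan_reflect)
  finally show ?thesis .
qed

lemma Hfun2_odd: "Hfun2 (2 * n + 1) = (\<Prod>m<n. fact (2 * m + 1))"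
proof -
  have "Hfun2 (2 * n + 1) = (\<Prod>i<n. fact (2 * n + 1 - 2 * Suc i))"
    unfolding Hfun2_def by (rule prod.reindex_bij_witness[where i = Suc and j = "\<lambda>i. i - 1"]) auto
  also have "\<dots> = (\<Prod>i<n. fact (2 * (n - 1 - i) + 1))"
    by (intro prod.cong refl arg_cong[of _ _ fact]) auto
  also have "\<dots> = (\<Prod>m<n. fact (2 * m + 1))" by (rule prod_lessThan_reflect)
  finally show ?thesis .
qed

lemma Hfun2_pos: "Hfun2 n > 0"
  unfolding Hfun2_def by (rule prod_pos) simp

lemma Hfun_pos: "Hfun n > 0"
  unfolding Hfun_def by (rule prod_pos) simp

lemma east_coeff_Hfun2: "east_coeff n = 1 / (four_power n * Hfun2 (2 * n))"
  unfolding east_coeff_def four_power_def Hfun2_even by (simp add: prod_dividef prod.distrib)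

text \<open>The denominators of the additional row turn each \<open>fact (2 * m)\<close> into twice
  \<open>fact (2 * m + 1)\<close>; the twos collect in \<open>2 ^ n\<close>.\<close>

lemma west_coeff_Hfun2: "west_coeff n = 1 / (four_power n * 2 ^ n * Hfun2 (2 * n + 1))"
proof -
  have h: "Hfun2 (2 * n + 1) * 2 ^ n = Hfun2 (2 * n) * (\<Prod>j<n. 2 * (2 * real j + 1))"
    unfolding Hfun2_odd Hfun2_even prod.distrib[symmetric] prod_constant[symmetric]
  proof -
    have "(\<Prod>m<n. fact (2 * m + 1)) * 2 ^ n = (\<Prod>m<n. fact (2 * m + 1) * 2 :: real)"
      by (simp add: prod.distrib)
    also have "\<dots> = (\<Prod>m<n. fact (2 * m) * (2 * (2 * real m + 1)))"
      by (intro prod.cong refl) (simp add: algebra_simps)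
    finally show "(\<Prod>m<n. fact (2 * m + 1)) * 2 ^ n = (\<Prod>m<n. fact (2 * m) * (2 * (2 * real m + 1)))" .
  qed
  have "four_power n * (Hfun2 (2 * n + 1) * 2 ^ n) = four_power n * (Hfun2 (2 * n) * (\<Prod>j<n. 2 * (2 * real j + 1)))"
    by (simp only: h)
  then have "four_power n * 2 ^ n * Hfun2 (2 * n + 1) = four_power n * Hfun2 (2 * n) * (\<Prod>j<n. 2 * (2 * real j + 1))"
    by (simp only: mult_ac)
  then show ?thesis unfolding west_coeff_def east_coeff_Hfun2 by (simp only: divide_divide_eq_left)
qed

lemma prod_add_index: "(\<Prod>m<e + (y::nat). f m) = (\<Prod>m<e. f m) * (\<Prod>i<y. f (e + i) :: 'a::comm_monoid_mult)"
  by (induction y) (simp_all add: mult.assoc)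

lemma four_power_add: "four_power (e + y) * four_power (e' + y) = four_power e * four_power e' * (\<Prod>i<y. 4 ^ (e + e' + 2 * i))"
proof -
  have "(4::real) ^ (e + e' + 2 * i) = 4 ^ (e + i) * 4 ^ (e' + i)" for i
    by (simp add: power_add mult_2)
  then show ?thesis
    unfolding four_power_def prod_add_index by (simp add: prod.distrib mult_ac)
qed

lemma Hfun_add: "Hfun (n + y) = Hfun n * (\<Prod>i<y. fact (n + i))"
  unfolding Hfun_def by (rule prod_add_index)

definition T_product :: "nat \<Rightarrow> nat \<Rightarrow> nat \<Rightarrow> nat \<Rightarrow> real" where
  "T_product x y a C = (\<Prod>i<y. fact (x + y + a + C + i) * fact (x + y + 2 * a + C + i) / (fact (x + i) * fact (x + a + i)))"

text \<open>While the start of the rising factorials grows by 1, their length drops by 2. So their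
  upper ends run through consecutive factorials in decreasing order.\<close>

lemma Tfun_fact:
  "Tfun (real u + 1) (int (n + 2 * y) - 1) y = (\<Prod>i<y. fact (u + n + y + i) / fact (u + i))"
proof -
  have "Tfun (real u + 1) (int (n + 2 * y) - 1) y = (\<Prod>i<y. fact (u + n + y + (y - 1 - i)) / fact (u + i))"
    unfolding Tfun_def
  proof (rule prod.cong[OF refl])
    fix i assume "i \<in> {..<y}"
    then have "nat (int (n + 2 * y) - 1 - 2 * int i) = n + 2 * y - 1 - 2 * i" by auto
    moreover have "real u + 1 + real i = real (Suc (u + i))" by simp
    moreover have "u + i + (n + 2 * y - 1 - 2 * i) = u + n + y + (y - 1 - i)"
      using \<open>i \<in> {..<y}\<close> by auto
    ultimately show "pochhammer (real u + 1 + real i) (nat (int (n + 2 * y) - 1 - 2 * int i)) =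
        fact (u + n + y + (y - 1 - i)) / fact (u + i)"
      by (simp only: pochhammer_fact_quotient)
  qed
  then show ?thesis
    using prod_lessThan_reflect[of "\<lambda>i. fact (u + n + y + i)" y] by (simp add: prod_dividef)
qed

lemma T_product_Tfun:
  "Tfun (real x + 1) (int (2 * a + C + 2 * y) - 1) y * Tfun (real x + real a + 1) (int (C + 2 * y) - 1) y = T_product x y a C"
proof -
  have "Tfun (real x + real a + 1) (int (C + 2 * y) - 1) y = (\<Prod>i<y. fact (x + a + C + y + i) / fact (x + a + i))"
    using Tfun_fact[of "x + a" C y] by simp
  moreover have "Tfun (real x + 1) (int (2 * a + C + 2 * y) - 1) y = (\<Prod>i<y. fact (x + (2 * a + C) + y + i) / fact (x + i))"
    by (rule Tfun_fact)
  ultimately show ?thesis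
    unfolding T_product_def by (simp add: prod.distrib[symmetric] add_ac mult_ac)
qed

lemma T_product_pos: "T_product x y a C > 0"
  unfolding T_product_def by (rule prod_pos) simp

text \<open>All dependence on \<open>x\<close> sits in \<open>T_product\<close>. Dividing by its
  value at 0 cancels the other factors except two blocks of consecutive factorials, which are
  quotients of values of \<open>Hfun\<close>.\<close>

lemma selberg_product_T_product:
  "selberg_product (x + y) y a C = (\<Prod>i<y. 4 ^ (a + C + 2 * i)) *
     (Hfun (2 * a + C + 2 * y) * Hfun (C + y) / (Hfun (2 * a + C + y) * Hfun C)) * (T_product x y a C / T_product 0 y a C)"
proof -
  let ?F = "\<lambda>n. \<Prod>i<y. fact (n + i) :: real"
  have F: "?F n \<noteq> 0" for n by simp
  have r1: "(\<Prod>i<y. fact (x + y - 1 - i)) = ?F x"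
  proof -
    have "(\<Prod>i<y. fact (x + y - 1 - i)) = (\<Prod>i<y. fact (x + (y - 1 - i)) :: real)"
      by (intro prod.cong refl arg_cong[of _ _ fact]) auto
    then show ?thesis using prod_lessThan_reflect[of "\<lambda>i. fact (x + i) :: real" y] by simp
  qed
  have r2: "(\<Prod>i<y. fact (a + (x + y) - 1 - i)) = ?F (x + a)"
  proof -
    have "(\<Prod>i<y. fact (a + (x + y) - 1 - i)) = (\<Prod>i<y. fact (x + a + (y - 1 - i)) :: real)"
      by (intro prod.cong refl arg_cong[of _ _ fact]) auto
    then show ?thesis using prod_lessThan_reflect[of "\<lambda>i. fact (x + a + i) :: real" y] by simp
  qed
  have Z: "selberg_product (x + y) y a C = (\<Prod>i<y. 4 ^ (a + C + 2 * i)) * ?F a * ?F C * ?F 0 * ?F (x + y + a + C) * ?F (x + y + 2 * a + C) /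
      (?F x * ?F (x + a) * ?F (a + C + y))"
  proof -
    have e: "a + (x + y) + C = x + y + a + C" "a + (x + y) + a + C = x + y + 2 * a + C" by simp_all
    show ?thesis unfolding selberg_product_def e prod_dividef prod.distrib r1 r2 by simp
  qed
  have T: "T_product u y a C = ?F (u + y + a + C) * ?F (u + y + 2 * a + C) / (?F u * ?F (u + a))" for u
    unfolding T_product_def by (simp add: prod_dividef prod.distrib)
  have H1: "Hfun (2 * a + C + 2 * y) = Hfun (2 * a + C + y) * ?F (2 * a + C + y)"
    using Hfun_add[of "2 * a + C + y" y] by (simp add: mult_2 add.assoc)
  have H2: "Hfun (C + y) = Hfun C * ?F C" by (rule Hfun_add)
  have nz: "Hfun C \<noteq> 0" "Hfun (2 * a + C + y) \<noteq> 0" using Hfun_pos by (metis less_irrefl)+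
  have e: "0 + y + a + C = a + C + y" "0 + y + 2 * a + C = 2 * a + C + y" by simp_all
  have H: "Hfun (2 * a + C + 2 * y) * Hfun (C + y) / (Hfun (2 * a + C + y) * Hfun C) = ?F (2 * a + C + y) * ?F C"
    unfolding H1 H2 using nz by simp
  show ?thesis
    unfolding Z H T e using F by (simp add: field_simps)
qed

section \<open>Comparison of the cases y and 0\<close>

definition up_pos :: "nat \<Rightarrow> nat list \<Rightarrow> nat list \<Rightarrow> nat set" where
  "up_pos N a b = seg_pos even a \<union> refl_pos odd (sum_list a + N + sum_list b) b"

definition down_pos :: "nat \<Rightarrow> nat \<Rightarrow> nat list \<Rightarrow> nat list \<Rightarrow> nat set" where
  "down_pos N z a b = seg_pos odd a \<union>
     {sum_list a + N + sum_list b..<sum_list a + N + sum_list b + z} \<union> refl_pos even (sum_list a + N + sum_list b) b"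

lemma NR_setting_pos:
  "NR_setting x y z a b (sum_list a + (x + y) + sum_list b) (y + esum a + osum b) (y + z + osum a + esum b)
     (up_pos (x + y) a b) (down_pos (x + y) z a b)"
  by unfold_locales (simp_all add: NR_L_def up_pos_def down_pos_def)

lemma M_NR2_formula:
  "M_NR2 x y z a b = 2 ^ entry a 1 * dent_factor (up_pos (x + y) a b) (down_pos (x + y) z a b) *
     (east_coeff (esum a + osum b + y) * west_coeff (osum a + esum b + z + y) * selberg_product (x + y) y (sum_list a) (sum_list b + z))"
proof -
  interpret NR_setting x y z a b "sum_list a + (x + y) + sum_list b" "y + esum a + osum b" "y + z + osum a + esum b"
    "up_pos (x + y) a b" "down_pos (x + y) z a b" by (rule NR_setting_pos)
  have e: "y + esum a + osum b = esum a + osum b + y" "y + z + osum a + esum b = osum a + esum b + z + y" by simp_all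
  show ?thesis unfolding M_closed e by (simp only: mult_ac)
qed

lemma dent_factor_up_down_pos: "dent_factor (up_pos N a b) (down_pos N z a b) > 0"
proof -
  interpret NR_setting N 0 z a b "sum_list a + (N + 0) + sum_list b" "0 + esum a + osum b" "0 + z + osum a + esum b"
    "up_pos (N + 0) a b" "down_pos (N + 0) z a b" by (rule NR_setting_pos)
  show ?thesis using dent_factor_pos[OF finite_dents] by simp
qed

text \<open>The powers of four from both coefficients cancel those of the Selberg product, because
  \<open>e + e' = a + C\<close>. The power of two in \<open>west_coeff\<close> leaves
  \<open>1 / 2 ^ y\<close>, which is the origin of \<open>- y\<close> in the exponent of the
  theorem.\<close>

lemma east_coeff_west_coeff_selberg_product:
  assumes "e + e' = a + C"
  shows "east_coeff (e + y) * west_coeff (e' + y) * selberg_product (x + y) y a C = east_coeff e * west_coeff e' *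
    ((Hfun2 (2 * e) * Hfun2 (2 * e' + 1)) / (Hfun2 (2 * e + 2 * y) * Hfun2 (2 * e' + 2 * y + 1)) *
     ((Hfun (2 * a + C + 2 * y) * Hfun (C + y)) / (Hfun (2 * a + C + y) * Hfun C)) / 2 ^ y * (T_product x y a C / T_product 0 y a C))"
proof -
  define G where "G = Hfun (2 * a + C + 2 * y) * Hfun (C + y) / (Hfun (2 * a + C + y) * Hfun C)"
  define t where "t = T_product x y a C / T_product 0 y a C"
  define q where "q = (\<Prod>i<y. 4 ^ (a + C + 2 * i) :: real)"
  have q0: "q \<noteq> 0" by (simp add: q_def)
  have nz: "four_power n \<noteq> 0" "Hfun2 n \<noteq> 0" for n using four_power_pos[of n] Hfun2_pos[of n] by auto
  have dist: "2 * (e + y) = 2 * e + 2 * y" "2 * (e' + y) = 2 * e' + 2 * y" by simp_all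
  have "east_coeff (e + y) * west_coeff (e' + y) = 1 / (four_power (e + y) * four_power (e' + y) * 2 ^ (e' + y) *
      (Hfun2 (2 * e + 2 * y) * Hfun2 (2 * e' + 2 * y + 1)))"
    unfolding east_coeff_Hfun2 west_coeff_Hfun2 dist by (simp add: mult_ac)
  also have "four_power (e + y) * four_power (e' + y) = four_power e * four_power e' * q"
    unfolding four_power_add assms q_def ..
  finally have 1: "east_coeff (e + y) * west_coeff (e' + y) = 1 / (four_power e * four_power e' * q * 2 ^ (e' + y) *
      (Hfun2 (2 * e + 2 * y) * Hfun2 (2 * e' + 2 * y + 1)))" .
  have 2: "selberg_product (x + y) y a C = q * G * t"
    unfolding selberg_product_T_product G_def t_def q_def ..
  show ?thesis
    unfolding 1 2 east_coeff_Hfun2[of e] west_coeff_Hfun2[of e'] G_def[symmetric] t_def[symmetric]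
    using q0 nz by (simp add: power_add)
qed

text \<open>The free interval is absorbed into the merged entry at an odd place, so the even places
  of \<open>t_plus\<close> are exactly the up-pointing dents of the region.\<close>

lemma Kfun_t_plus: "real (Kfun (t_plus x y a b)) = east_coeff (esum a + osum b) * vander (centre ` up_pos (x + y) a b)"
proof -
  interpret NR_setting x y 0 a b "sum_list a + (x + y) + sum_list b" "y + esum a + osum b" "y + 0 + osum a + esum b"
    "up_pos (x + y) a b" "down_pos (x + y) 0 a b" by (rule NR_setting_pos)
  have ep: "seg_pos even (t_plus x y a b) = up_pos (x + y) a b"
    unfolding t_plus_mid(1) up_pos_def by (rule seg_pos_mid_list) (rule t_plus_mid)+
  then have "esum (t_plus x y a b) = esum a + osum b"
    using card_seg_pos_even[of "t_plus x y a b"] card_dents(1) by simp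
  then show ?thesis unfolding Kfun_formula ep by simp
qed

lemma Qprime_t_minus: "Qprime (t_minus x y z a b) = west_coeff (osum a + esum b + z) *
    ((\<Prod>c\<in>centre ` down_pos (x + y) z a b. real_of_int c) * vander (centre ` down_pos (x + y) z a b))"
proof -
  interpret NR_setting x y z a b "sum_list a + (x + y) + sum_list b" "y + esum a + osum b" "y + z + osum a + esum b"
    "up_pos (x + y) a b" "down_pos (x + y) z a b" by (rule NR_setting_pos)
  let ?L = "sum_list a + (x + y) + sum_list b"
  have "seg_pos even (t_minus x y z a b) =
      seg_pos even (0 # a) \<union> refl_pos odd (sum_list (0 # a) + (x + y) + sum_list (z # b)) (z # b)"
    unfolding t_minus_mid(1) by (rule seg_pos_mid_list) (rule t_minus_mid)+
  also have "sum_list (0 # a) + (x + y) + sum_list (z # b) = ?L + z" by simp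
  finally have ep: "seg_pos even (t_minus x y z a b) = down_pos (x + y) z a b"
    unfolding seg_pos_Cons_0 refl_pos_Cons down_pos_def by (simp only: Un_assoc)
  then have "esum (t_minus x y z a b) = osum a + esum b + z"
    using card_seg_pos_even[of "t_minus x y z a b"] card_dents(2) by simp
  then show ?thesis unfolding Qprime_formula ep by simp
qed

theorem theorem2p17:
  fixes x y z :: nat and av bv :: "nat list"
  shows "let a = sum_list av; b = sum_list bv;
             oa = osum av; ea = esum av; ob = osum bv; eb = esum bv;
             R = (Tfun (real x + 1) (int (2 * a + b + 2 * y + z) - 1) y
                    * Tfun (real x + real a + 1) (int (b + 2 * y + z) - 1) y)
                 / (Tfun 1 (int (2 * a + b + 2 * y + z) - 1) y
                    * Tfun (real a + 1) (int (b + 2 * y + z) - 1) y)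
         in M_NR2 y 0 z av bv \<noteq> 0
          \<and> M_NR2 x y z av bv
              = M_NR2 (x + y) 0 z av bv * M_NR2 0 y z av bv / M_NR2 y 0 z av bv * R
          \<and> M_NR2 x y z av bv
              = 2 powi (int (entry av 1) - int y)
                * real (Kfun (t_plus x y av bv)) * Qprime (t_minus x y z av bv)
                * ((Hfun2 (2 * ea + 2 * ob) * Hfun2 (2 * oa + 2 * eb + 2 * z + 1))
                   / (Hfun2 (2 * ea + 2 * ob + 2 * y) * Hfun2 (2 * oa + 2 * eb + 2 * y + 2 * z + 1)))
                * ((Hfun (2 * a + b + 2 * y + z) * Hfun (b + y + z))
                   / (Hfun (2 * a + b + y + z) * Hfun (b + z)))
                * R"
proof -
  define a where "a = sum_list av"
  define b where "b = sum_list bv"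
  define e where "e = esum av + osum bv"
  define e' where "e' = osum av + esum bv + z"
  \<comment> \<open>The only quantity that depends on the arrangement of the dents; it is a function
    of \<open>x + y\<close>.\<close>
  define B where "B = (\<lambda>N. dent_factor (up_pos N av bv) (down_pos N z av bv))"
  define H2 where "H2 = (Hfun2 (2 * esum av + 2 * osum bv) * Hfun2 (2 * osum av + 2 * esum bv + 2 * z + 1))
      / (Hfun2 (2 * esum av + 2 * osum bv + 2 * y) * Hfun2 (2 * osum av + 2 * esum bv + 2 * y + 2 * z + 1))"
  define H where "H = (Hfun (2 * a + b + 2 * y + z) * Hfun (b + y + z)) / (Hfun (2 * a + b + y + z) * Hfun (b + z))"
  define R where "R = (Tfun (real x + 1) (int (2 * a + b + 2 * y + z) - 1) y
        * Tfun (real x + real a + 1) (int (b + 2 * y + z) - 1) y)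
      / (Tfun 1 (int (2 * a + b + 2 * y + z) - 1) y * Tfun (real a + 1) (int (b + 2 * y + z) - 1) y)"
  have ee: "e + e' = a + (b + z)"
    using osum_esum[of av] osum_esum[of bv] by (simp add: e_def e'_def a_def b_def)
  have R_TT: "R = T_product x y a (b + z) / T_product 0 y a (b + z)"
  proof -
    have 1: "2 * a + b + 2 * y + z = 2 * a + (b + z) + 2 * y" "b + 2 * y + z = (b + z) + 2 * y" by simp_all
    show ?thesis
      unfolding R_def 1 using T_product_Tfun[of x a "b + z" y] T_product_Tfun[of 0 a "b + z" y] by simp
  qed
  have H2_e: "H2 = (Hfun2 (2 * e) * Hfun2 (2 * e' + 1)) / (Hfun2 (2 * e + 2 * y) * Hfun2 (2 * e' + 2 * y + 1))"
    by (simp add: H2_def e_def e'_def add_ac)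
  have H_C: "H = (Hfun (2 * a + (b + z) + 2 * y) * Hfun (b + z + y)) / (Hfun (2 * a + (b + z) + y) * Hfun (b + z))"
    by (simp add: H_def add_ac)
  \<comment> \<open>For \<open>y = 0\<close> the Selberg product is empty.\<close>
  have zero: "M_NR2 N 0 z av bv = 2 ^ entry av 1 * B N * (east_coeff e * west_coeff e')" for N
    unfolding M_NR2_formula by (simp add: B_def e_def e'_def selberg_product_def)
  \<comment> \<open>To be used at \<open>u = x\<close> and at \<open>u = 0\<close>. In the second
    case the quotient of the \<open>T_product\<close> values is 1, which isolates the factor
    \<open>H2 * H / 2 ^ y\<close>.\<close>
  have general: "M_NR2 u y z av bv = 2 ^ entry av 1 * B (u + y) *
      (east_coeff e * west_coeff e' * (H2 * H / 2 ^ y * (T_product u y a (b + z) / T_product 0 y a (b + z))))" for u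
  proof -
    have "east_coeff (e + y) * west_coeff (e' + y) * selberg_product (u + y) y a (b + z) =
        east_coeff e * west_coeff e' * (H2 * H / 2 ^ y * (T_product u y a (b + z) / T_product 0 y a (b + z)))"
      unfolding H2_e H_C by (rule east_coeff_west_coeff_selberg_product[OF ee])
    then show ?thesis unfolding M_NR2_formula B_def e_def e'_def a_def b_def by simp
  qed
  have pos: "B N > 0" for N unfolding B_def by (rule dent_factor_up_down_pos)
  have al_pos: "east_coeff e > 0" "west_coeff e' > 0"
    unfolding east_coeff_Hfun2 west_coeff_Hfun2 using four_power_pos Hfun2_pos by simp_all
  have TT0: "T_product 0 y a (b + z) \<noteq> 0" using T_product_pos[of 0 y a "b + z"] by simp
  have nz: "M_NR2 N 0 z av bv \<noteq> 0" for N
    unfolding zero using pos[of N] al_pos by simp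
  have "M_NR2 0 y z av bv = M_NR2 y 0 z av bv * (H2 * H / 2 ^ y)"
    unfolding general zero using TT0 by simp
  moreover have main: "M_NR2 x y z av bv = M_NR2 (x + y) 0 z av bv * (H2 * H / 2 ^ y) * R"
    unfolding general zero R_TT by simp
  ultimately have first: "M_NR2 x y z av bv = M_NR2 (x + y) 0 z av bv * M_NR2 0 y z av bv / M_NR2 y 0 z av bv * R"
    using nz[of y] by simp
  \<comment> \<open>Without crossings the region splits into the two quartered hexagons; the half
    triangle in place of unit dents gives the power of two.\<close>
  have "M_NR2 (x + y) 0 z av bv = 2 ^ entry av 1 * real (Kfun (t_plus x y av bv)) * Qprime (t_minus x y z av bv)"
    unfolding zero Kfun_t_plus Qprime_t_minus by (simp add: B_def dent_factor_def e_def e'_def)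
  moreover have "2 powi (int (entry av 1) - int y) = (2 ^ entry av 1 / 2 ^ y :: real)"
    by (simp add: power_int_diff)
  ultimately have "M_NR2 x y z av bv = 2 powi (int (entry av 1) - int y)
      * real (Kfun (t_plus x y av bv)) * Qprime (t_minus x y z av bv) * H2 * H * R"
    unfolding main by simp
  then show ?thesis
    unfolding Let_def a_def[symmetric] b_def[symmetric] R_def[symmetric] H2_def[symmetric] H_def[symmetric]
    using nz[of y] first by blast
qed

end
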